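(* For each positive integer $n$ let $X_n$ be the random variable `size' on the set of $(2n+1,2n+3)$-core partitions with distinct parts, equipped with the uniform distribution. Then the scaled seventh moment of $X_n$ satisfies $$ \lim_{n\to\infty}\frac{\mathbb{E}\big[(X_n-\mathbb{E}[X_n])^7\big]}{\mathrm{Var}(X_n)^{7/2}}=\frac{56459262321071884675}{62988906654652346368}\,\sqrt{467}\,\sqrt{7680}. $$
   Context: A partition is a non-increasing finite sequence $\lambda=(\lambda_1,\dots,\lambda_k)$, $k\ge 0$, of positive integers (the empty partition is allowed); its size is $\lambda_1+\dots+\lambda_k$, and it has distinct parts if the $\lambda_i$ are pairwise distinct. The hook length of a cell $(i,j)$, $1\le j\le\lambda_i$, of its Ferrers (Young) diagram is $\lambda_i-i+\lambda'_j-j+1$, where $\lambda'$ is the conjugate partition. A partition is an $(s,t)$-core partition if none of its hook lengths equals $s$ and none equals $t$. For $s=2n+1$, $t=2n+3$ (relatively prime) the set of $(s,t)$-core partitions is finite. *)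

theory Defs
  imports "HOL-Probability.Probability"
begin

definition is_partition :: "nat list \<Rightarrow> bool" where
  "is_partition l \<longleftrightarrow> sorted_wrt (\<ge>) l \<and> (\<forall>p \<in> set l. 0 < p)"

text \<open>Parts are indexed from \<open>1\<close>: this is the part number \<open>i\<close>, for \<open>1 \<le> i \<le> length l\<close>.\<close>
definition part :: "nat list \<Rightarrow> nat \<Rightarrow> nat" where
  "part l i = l ! (i - 1)"

definition conjugate_part :: "nat list \<Rightarrow> nat \<Rightarrow> nat" where
  "conjugate_part l j = card {i \<in> {1..length l}. j \<le> part l i}"

definition cells :: "nat list \<Rightarrow> (nat \<times> nat) set" where
  "cells l = {(i, j). 1 \<le> i \<and> i \<le> length l \<and> 1 \<le> j \<and> j \<le> part l i}"

text \<open>Integer-valued, since \<open>part l i - i\<close> can be negative.\<close>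
definition hook_length :: "nat list \<Rightarrow> nat \<times> nat \<Rightarrow> int" where
  "hook_length l = (\<lambda>(i, j). int (part l i) - int i + int (conjugate_part l j) - int j + 1)"

definition core_partition :: "nat \<Rightarrow> nat \<Rightarrow> nat list \<Rightarrow> bool" where
  "core_partition s t l \<longleftrightarrow> is_partition l \<and>
     (\<forall>c \<in> cells l. hook_length l c \<noteq> int s \<and> hook_length l c \<noteq> int t)"

definition distinct_cores :: "nat \<Rightarrow> nat \<Rightarrow> nat list set" where
  "distinct_cores s t = {l. core_partition s t l \<and> distinct l}"

definition random_core :: "nat \<Rightarrow> nat list pmf" where
  "random_core n = pmf_of_set (distinct_cores (2 * n + 1) (2 * n + 3))"

definition core_size :: "nat list \<Rightarrow> real" where
  "core_size l = real (sum_list l)"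

end

theory Submission
  imports Defs "HOL-Real_Asymp.Real_Asymp"
begin

unbundle no vec_syntax
unbundle fps_syntax

text \<open>
A partition is determined by its beta set, the set of its first-column hook lengths. It has no
hook of length \<open>s\<close> iff the beta set is closed under subtracting \<open>s\<close>, and its parts are distinct
iff the beta set contains no two consecutive numbers. For \<open>s = 2n+1\<close> and \<open>t = 2n+3\<close>, let \<open>h r\<close> be
the number of elements of the beta set in the residue class \<open>r\<close> modulo \<open>2n+1\<close>. The cores become
the functions \<open>h\<close> that grow by at most 1 from \<open>r\<close> to \<open>r+2\<close> and by at most 2 from \<open>2n\<close> to 1, with no
two neighbouring values positive (\<open>bij_betw_beta_set\<close>, \<open>bij_betw_height_set\<close>). With \<open>T = \<Sum>h\<^sup>2\<close> and \<open>H = \<Sum>h\<close>, the size is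
\<open>n T - H\<^sup>2 / 2\<close> up to terms of smaller order, since typically \<open>h\<close> has order \<open>\<surd>n\<close>. So it suffices to know
the limits of \<open>E[T\<^sup>a H\<^sup>b] / n\<^bsup>2a+3b/2\<^esup>\<close> for even \<open>b\<close>.

For these, give every height the formal weight \<open>exp(u h\<^sup>2 + v h)\<close>. Read along \<open>r\<close>, a height function
is a closed walk built from runs of positive heights in steps of 2. A run is a Dyck path in
disguise, so the generating function \<open>D0\<close> of runs, with \<open>X\<close> marking the number of heights, satisfies
\<open>D0 = 1 + X exp(u+v) D0 D1\<close>, where \<open>D1\<close> is \<open>D0\<close> with all heights raised by one. That operation
replaces \<open>v\<close> by \<open>v + 2u\<close> and \<open>X\<close> by \<open>X exp(u+v)\<close>. The closed walks have the generating function
\<open>(D0 + X D0' + W) / (1 - X D0\<^sup>2)\<close> (\<open>config_gf\<close>), where \<open>W\<close> accounts for the one place at which \<open>h\<close> may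
jump by 2.

Every coefficient of \<open>u\<^sup>a v\<^sup>b\<close> in these series is, up to a power of \<open>X\<close>, a Laurent polynomial in
\<open>\<delta> = \<surd>(1-4X)\<close>. Counting \<open>u\<close> as \<open>\<delta>\<^sup>4\<close> and \<open>v\<close> as \<open>\<delta>\<^sup>3\<close>, only the terms of least order matter. In these
terms \<open>Y = 1 - D0/2\<close> satisfies a Riccati equation \<open>Y\<^sup>2 = \<delta>\<^sup>2 + v X Y' + 2u \<partial>Y/\<partial>v\<close> (\<open>graded_Y\<close>), and the closed
walks have the generating function \<open>- 2 X (log Y)'\<close> (\<open>graded_quotient\<close>). This is the Laplace transform
of the corresponding functional of a Brownian path \<open>w\<close> with \<open>w(1) = - w(0)\<close>. Since the
coefficient of \<open>X\<^sup>n\<close> in \<open>(1-4X)\<^bsup>-k/2\<^esup>\<close> is asymptotic to \<open>4\<^sup>n n\<^bsup>k/2-1\<^esup> / \<Gamma>(k/2)\<close>, the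
limits of the moments are read off from the coefficients \<open>z\<close> of the leading part. They obey a
quadratic recursion and a linear one, which are evaluated for \<open>2a + b \<le> 14\<close>.
\<close>

section \<open>Leading singular behaviour at 1/4\<close>

text \<open>The power series of \<open>(1 - 4X)\<^sup>c\<close>; the growth rate 4 is that of the Catalan numbers.\<close>

definition binpow :: "real \<Rightarrow> real fps" where
  "binpow c = Abs_fps (\<lambda>n. (c gchoose n) * (- 4) ^ n)"

definition four_X :: "real fps" where
  "four_X = fps_const 4 * fps_X"

lemma binpow_add: "binpow (c + d) = binpow c * binpow d"
proof (rule fps_ext)
  fix n
  have "binpow (c + d) $ n = (\<Sum>k=0..n. (c gchoose k) * (d gchoose (n - k))) * (- 4) ^ n"
    by (simp add: binpow_def gbinomial_Vandermonde)
  also have "\<dots> = (\<Sum>k=0..n. ((c gchoose k) * (- 4) ^ k) * ((d gchoose (n - k)) * (- 4) ^ (n - k)))"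
    unfolding sum_distrib_right by (rule sum.cong) (auto simp flip: power_add)
  finally show "binpow (c + d) $ n = (binpow c * binpow d) $ n"
    by (simp add: binpow_def fps_mult_nth)
qed

lemma binpow_0 [simp]: "binpow 0 = 1"
  by (rule fps_ext) (auto simp: binpow_def gbinomial_0_left)

lemma binpow_1: "binpow 1 = 1 - four_X"
proof (rule fps_ext)
  fix n
  have "(1::real) gchoose n = of_nat (1 choose n)"
    by (metis binomial_gbinomial of_nat_1)
  then show "binpow 1 $ n = (1 - four_X) $ n"
    by (cases n; cases "n - 1") (auto simp: binpow_def four_X_def binomial_eq_0)
qed

lemma binpow_nth_0 [simp]: "binpow c $ 0 = 1"
  by (simp add: binpow_def)

lemma XD_mult: "fps_XD (f * g) = fps_XD f * g + f * (fps_XD g :: 'a::comm_ring_1 fps)"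
  by (simp add: fps_XD_def algebra_simps)

lemma XD_nth: "fps_XD f $ n = of_nat n * (f $ n :: 'a::comm_ring_1)"
  by (cases n) (auto simp: fps_XD_def)

lemma XD_four_X: "fps_XD four_X = four_X"
  by (rule fps_ext) (auto simp: XD_nth four_X_def fps_X_def)

lemma XD_four_X_power: "fps_XD (four_X ^ m) = of_nat m * four_X ^ m"
proof (induction m)
  case 0
  show ?case by (simp add: fps_XD_def)
next
  case (Suc m)
  then show ?case by (simp add: XD_mult XD_four_X algebra_simps)
qed

lemma XD_binpow: "fps_XD (binpow c) = - fps_const c * four_X * binpow (c - 1)"
proof (rule fps_ext)
  fix n
  show "fps_XD (binpow c) $ n = (- fps_const c * four_X * binpow (c - 1)) $ n"
  proof (cases n)
    case (Suc k)
    have "(1 + real k) * (c gchoose Suc k) = c * ((c - 1) gchoose k)"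
      using gbinomial_absorption[of k c] by simp
    then have "fps_XD (binpow c) $ n = c * ((c - 1) gchoose k) * (- 4) ^ Suc k"
      using Suc by (simp add: XD_nth binpow_def)
    also have "\<dots> = (- fps_const c * four_X * binpow (c - 1)) $ n"
      by (simp add: Suc four_X_def binpow_def mult.assoc)
    finally show ?thesis .
  qed (simp add: XD_nth four_X_def)
qed

text \<open>A polynomial in \<open>\<delta> = \<surd>(1-4X)\<close>. Its coefficient 0 is the value at the singularity \<open>X = 1/4\<close>.\<close>

definition sqrt_poly :: "real poly \<Rightarrow> real fps" where
  "sqrt_poly q = poly (map_poly fps_const q) (binpow (1 / 2))"

lemma sqrt_poly_0 [simp]: "sqrt_poly 0 = 0"
  by (simp add: sqrt_poly_def)

lemma sqrt_poly_pCons: "sqrt_poly (pCons a q) = fps_const a + binpow (1 / 2) * sqrt_poly q"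
  by (simp add: sqrt_poly_def map_poly_pCons)

lemma sqrt_poly_add: "sqrt_poly (p + q) = sqrt_poly p + sqrt_poly q"
proof (induction p q rule: poly_induct2)
  case (pCons a p b q)
  then show ?case by (simp add: sqrt_poly_pCons algebra_simps)
qed simp

lemma sqrt_poly_smult: "sqrt_poly (smult c q) = fps_const c * sqrt_poly q"
  by (induction q) (simp_all add: sqrt_poly_pCons algebra_simps)

lemma sqrt_poly_mult: "sqrt_poly (p * q) = sqrt_poly p * sqrt_poly q"
  by (induction p) (simp_all add: sqrt_poly_pCons sqrt_poly_add sqrt_poly_smult algebra_simps)

lemma sqrt_poly_power: "sqrt_poly (p ^ n) = sqrt_poly p ^ n"
  by (induction n) (simp_all add: sqrt_poly_mult one_pCons sqrt_poly_pCons)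

lemma binpow_half_square: "binpow (1 / 2) * binpow (1 / 2) = 1 - four_X"
  by (simp flip: binpow_add binpow_1)

lemma sqrt_poly_four_X: "sqrt_poly [:1, 0, - 1:] = four_X"
  using binpow_half_square by (simp add: sqrt_poly_pCons fps_const_neg[symmetric] del: fps_const_neg)

lemma sqrt_poly_delta: "sqrt_poly [:0, 1:] = binpow (1 / 2)"
  by (simp add: sqrt_poly_pCons)

lemma XD_const [simp]: "fps_XD (fps_const (c :: 'a::comm_ring_1)) = 0"
  by (simp add: fps_XD_def)

lemma XD_sqrt_poly: "fps_XD (sqrt_poly q) = - fps_const (1 / 2) * four_X * binpow (- (1 / 2)) * sqrt_poly (pderiv q)"
proof (induction q)
  case (pCons a q)
  then show ?case
    using XD_binpow[of "1 / 2"]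
    by (simp add: sqrt_poly_pCons XD_mult pderiv_pCons sqrt_poly_add fps_const_neg algebra_simps)
qed (simp add: fps_XD_def)

text \<open>Near \<open>X = 1/4\<close> the series \<open>f\<close> behaves like \<open>c (1-4X)\<^bsup>-K/2\<^esup>\<close>. The case \<open>c = 0\<close> is allowed, so this is an
upper bound on the order of the pole with a prescribed coefficient at that order. The factor
\<open>(4X)\<^sup>m\<close> equals 1 at the singularity; it clears the denominators \<open>1 + \<delta>\<close>, because \<open>(1-\<delta>)(1+\<delta>) = 4X\<close>.\<close>

definition lead :: "int \<Rightarrow> real \<Rightarrow> real fps \<Rightarrow> bool" where
  "lead K c f \<longleftrightarrow> (\<exists>m q. coeff q 0 = c \<and> four_X ^ m * f = binpow (- (of_int K / 2)) * sqrt_poly q)"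

lemma leadI:
  assumes "four_X ^ m * f = binpow (- (of_int K / 2)) * sqrt_poly q" "coeff q 0 = c"
  shows "lead K c f"
  using assms unfolding lead_def by blast

lemma lead_0 [simp]: "lead K 0 0"
  by (rule leadI[of 0 _ _ 0]) auto

lemma lead_mult:
  assumes "lead K c f" "lead L d g"
  shows "lead (K + L) (c * d) (f * g)"
proof -
  obtain m q where q: "coeff q 0 = c" "four_X ^ m * f = binpow (- (of_int K / 2)) * sqrt_poly q"
    using assms(1) unfolding lead_def by blast
  obtain n r where r: "coeff r 0 = d" "four_X ^ n * g = binpow (- (of_int L / 2)) * sqrt_poly r"
    using assms(2) unfolding lead_def by blast
  have "- (of_int (K + L) / 2 :: real) = - (of_int K / 2) + - (of_int L / 2)"
    by (simp add: field_simps)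
  then have binpow: "binpow (- (of_int (K + L) / 2)) = binpow (- (of_int K / 2)) * binpow (- (of_int L / 2))"
    by (metis binpow_add)
  have "four_X ^ (m + n) * (f * g) = (four_X ^ m * f) * (four_X ^ n * g)"
    by (simp add: power_add algebra_simps)
  also have "\<dots> = binpow (- (of_int (K + L) / 2)) * sqrt_poly (q * r)"
    unfolding q r binpow sqrt_poly_mult by (simp add: algebra_simps)
  finally show ?thesis
    by (rule leadI) (simp add: q r coeff_mult)
qed

lemma lead_raise_common:
  assumes "lead K c f" "lead K d g"
  obtains m q r where "coeff q 0 = c" "four_X ^ m * f = binpow (- (of_int K / 2)) * sqrt_poly q"
    "coeff r 0 = d" "four_X ^ m * g = binpow (- (of_int K / 2)) * sqrt_poly r"
proof -
  obtain m q where q: "coeff q 0 = c" "four_X ^ m * f = binpow (- (of_int K / 2)) * sqrt_poly q"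
    using assms(1) unfolding lead_def by blast
  obtain n r where r: "coeff r 0 = d" "four_X ^ n * g = binpow (- (of_int K / 2)) * sqrt_poly r"
    using assms(2) unfolding lead_def by blast
  let ?t = "[:1, 0, - 1:] :: real poly"
  have c0: "coeff (?t ^ k) 0 = 1" for k
    by (induction k) (auto simp: coeff_mult)
  show ?thesis
  proof (rule that)
    show "coeff (?t ^ n * q) 0 = c" "coeff (?t ^ m * r) 0 = d"
      using c0 q r by (simp_all add: coeff_mult)
    have "four_X ^ (m + n) * f = four_X ^ n * (four_X ^ m * f)"
      by (simp add: power_add algebra_simps)
    then show "four_X ^ (m + n) * f = binpow (- (of_int K / 2)) * sqrt_poly (?t ^ n * q)"
      unfolding q sqrt_poly_mult sqrt_poly_power sqrt_poly_four_X by (simp add: algebra_simps)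
    have "four_X ^ (m + n) * g = four_X ^ m * (four_X ^ n * g)"
      by (simp add: power_add algebra_simps)
    then show "four_X ^ (m + n) * g = binpow (- (of_int K / 2)) * sqrt_poly (?t ^ m * r)"
      unfolding r sqrt_poly_mult sqrt_poly_power sqrt_poly_four_X by (simp add: algebra_simps)
  qed
qed

lemma lead_add:
  assumes "lead K c f" "lead K d g"
  shows "lead K (c + d) (f + g)"
proof -
  obtain m q r where "coeff q 0 = c" "four_X ^ m * f = binpow (- (of_int K / 2)) * sqrt_poly q"
    "coeff r 0 = d" "four_X ^ m * g = binpow (- (of_int K / 2)) * sqrt_poly r"
    using lead_raise_common[OF assms] .
  then show ?thesis
    by (intro leadI[of m _ _ "q + r"]) (auto simp: sqrt_poly_add algebra_simps)
qed

lemma lead_const: "lead 0 c (fps_const c)"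
  by (rule leadI[of 0 _ _ "[:c:]"]) (simp_all add: sqrt_poly_pCons)

lemma lead_1: "lead 0 1 1"
  using lead_const[of 1] by simp

lemma lead_cmult: "lead K c f \<Longrightarrow> lead K (d * c) (fps_const d * f)"
  using lead_mult[OF lead_const] by fastforce

lemma lead_minus: "lead K c f \<Longrightarrow> lead K (- c) (- f)"
  using lead_cmult[of K c f "- 1"] by (simp flip: fps_const_neg)

lemma lead_diff: "lead K c f \<Longrightarrow> lead K d g \<Longrightarrow> lead K (c - d) (f - g)"
  using lead_add[OF _ lead_minus, of K c f d g] by simp

lemma lead_sum:
  "(\<And>i. i \<in> A \<Longrightarrow> lead K (c i) (f i)) \<Longrightarrow> lead K (\<Sum>i\<in>A. c i) (\<Sum>i\<in>A. f i)"
  by (induction A rule: infinite_finite_induct) (auto intro: lead_add)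

lemma lead_binpow: "lead K 1 (binpow (- (of_int K / 2)))"
  by (rule leadI[of 0 _ _ "[:1:]"]) (simp_all add: sqrt_poly_pCons)

lemma lead_delta: "lead (- 1) 1 (binpow (1 / 2))"
  using lead_binpow[of "- 1"] by simp

lemma lead_four_X: "lead 0 1 four_X"
  by (rule leadI[of 0 _ _ "[:1, 0, - 1:]"]) (simp_all add: sqrt_poly_four_X)

lemma lead_weaken:
  assumes "lead K c f" "K < L"
  shows "lead L 0 f"
proof -
  have one: "lead 1 0 1"
    by (rule leadI[of 0 _ _ "[:0, 1:]"]) (simp_all add: sqrt_poly_delta flip: binpow_add)
  have "lead (K + 1 + int j) 0 f" for j
  proof (induction j)
    case 0
    show ?case using lead_mult[OF assms(1) one] by simp
  next
    case (Suc j)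
    show ?case using lead_mult[OF Suc one] by (simp add: algebra_simps)
  qed
  from this[of "nat (L - K - 1)"] show ?thesis
    using assms(2) by simp
qed

text \<open>The Euler operator \<open>X d/dX\<close> raises the order of the pole by 2 since \<open>X d\<delta>/dX = - 4X/(2\<delta>)\<close>.\<close>

lemma lead_XD:
  assumes "lead K c f"
  shows "lead (K + 2) (of_int K / 2 * c) (fps_XD f)"
proof -
  obtain m q where q: "coeff q 0 = c" "four_X ^ m * f = binpow (- (of_int K / 2)) * sqrt_poly q"
    using assms unfolding lead_def by blast
  define k where "k = (of_int K / 2 :: real)"
  let ?t = "[:1, 0, - 1:] :: real poly"
  let ?r = "?t * (smult k q - smult (1 / 2) ([:0, 1:] * pderiv q)) - smult (real m) ([:0, 0, 1:] * q)"
  have k2: "- (of_int (K + 2) / 2 :: real) = - k - 1"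
    by (simp add: k_def field_simps)
  have p1: "binpow (- k) = binpow (- k - 1) * binpow 1" "binpow (- k) * binpow (- (1 / 2)) = binpow (- k - 1) * binpow (1 / 2)"
    by (simp_all add: algebra_simps flip: binpow_add)
  have d2: "sqrt_poly [:0, 0, 1:] = binpow 1"
    by (simp add: sqrt_poly_pCons flip: binpow_add)
  have "of_nat m * (four_X ^ m * f) + four_X ^ m * fps_XD f = fps_XD (binpow (- k) * sqrt_poly q)"
    unfolding q(2)[folded k_def, symmetric] by (simp add: XD_mult XD_four_X_power algebra_simps)
  then have "four_X ^ m * fps_XD f
    = fps_XD (binpow (- k) * sqrt_poly q) - of_nat m * (binpow (- k) * sqrt_poly q)"
    unfolding q(2)[folded k_def, symmetric] by (simp add: algebra_simps)
  also have "fps_XD (binpow (- k) * sqrt_poly q) = fps_const k * four_X * binpow (- k - 1) * sqrt_poly q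
      - fps_const (1 / 2) * four_X * (binpow (- k) * binpow (- (1 / 2))) * sqrt_poly (pderiv q)"
    by (simp add: XD_mult XD_binpow XD_sqrt_poly algebra_simps fps_const_neg[symmetric] del: fps_const_neg)
  also have "\<dots> - of_nat m * (binpow (- k) * sqrt_poly q) = binpow (- k - 1) * sqrt_poly ?r"
  proof -
    have "sqrt_poly (p - p') = sqrt_poly p - sqrt_poly p'" for p p'
      using sqrt_poly_add[of "p - p'" p'] by (simp add: algebra_simps)
    moreover have "of_nat m = fps_const (real m)"
      by (simp add: fps_of_nat)
    ultimately show ?thesis
      unfolding p1(2) unfolding p1(1) by (simp only: sqrt_poly_mult sqrt_poly_smult sqrt_poly_four_X sqrt_poly_delta d2) (simp add: algebra_simps)
  qed
  finally have "four_X ^ m * fps_XD f = binpow (- (of_int (K + 2) / 2)) * sqrt_poly ?r"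
    unfolding k2 .
  then show ?thesis
    by (rule leadI) (simp add: q k_def coeff_mult)
qed

lemma sqrt_poly_altdef: "sqrt_poly q = (\<Sum>i\<le>degree q. fps_const (coeff q i) * binpow (real i / 2))"
proof -
  have "binpow (1 / 2) ^ i = binpow (real i / 2)" for i
    by (induction i) (simp_all flip: binpow_add add: field_simps)
  then show ?thesis
    unfolding sqrt_poly_def poly_altdef
    by (cases "q = 0") (auto simp: degree_map_poly coeff_map_poly)
qed

lemma binpow_nth_asymp:
  "(\<lambda>n. binpow (- s) $ n / (4 ^ n * real n powr (s - 1))) \<longlonglongrightarrow> rGamma s"
proof -
  have "(\<lambda>n. (- s gchoose n) / ((- 1) ^ n / exp ((- s + 1) * of_real (ln (real n))))) \<longlonglongrightarrow> inverse (Gamma s)"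
    using gbinomial_asymptotic[of "- s"] by simp
  moreover have "eventually (\<lambda>n. (- s gchoose n) / ((- 1) ^ n / exp ((- s + 1) * of_real (ln (real n))))
     = binpow (- s) $ n / (4 ^ n * real n powr (s - 1))) sequentially"
    using eventually_gt_at_top[of 0]
  proof eventually_elim
    case (elim n)
    have e: "exp ((- s + 1) * of_real (ln (real n))) = inverse (real n powr (s - 1))"
      using elim by (simp add: powr_def exp_minus[symmetric] algebra_simps)
    have "(- 4 :: real) ^ n = (- 1) ^ n * 4 ^ n"
      by (simp flip: power_mult_distrib)
    then show ?case
      unfolding e by (cases "even n") (simp_all add: binpow_def divide_inverse)
  qed
  ultimately show ?thesis
    by (simp add: rGamma_inverse_Gamma tendsto_cong)
qed

text \<open>Each power of \<open>\<delta>\<close> beyond the leading one costs a factor \<open>1/\<surd>n\<close>. The reciprocal Gamma function covers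
the case of a polynomial \<open>(1-4X)\<^sup>k\<close>, whose coefficients vanish from some index on.\<close>

lemma lead_nth_asymp:
  assumes "lead K c f"
  shows "(\<lambda>n. f $ n / (4 ^ n * real n powr (of_int K / 2 - 1))) \<longlonglongrightarrow> c * rGamma (of_int K / 2)"
proof -
  obtain m q where q: "coeff q 0 = c" "four_X ^ m * f = binpow (- (of_int K / 2)) * sqrt_poly q"
    using assms unfolding lead_def by blast
  define k where "k = (of_int K / 2 :: real)"
  have "four_X ^ m * f = (\<Sum>i\<le>degree q. fps_const (coeff q i) * (binpow (- k) * binpow (real i / 2)))"
    unfolding q(2) sqrt_poly_altdef sum_distrib_left k_def by (rule sum.cong) (auto simp: algebra_simps)
  also have "\<dots> = (\<Sum>i\<le>degree q. fps_const (coeff q i) * binpow (- (k - real i / 2)))"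
    by (simp flip: binpow_add)
  finally have *: "four_X ^ m * f = (\<Sum>i\<le>degree q. fps_const (coeff q i) * binpow (- (k - real i / 2)))" .
  have X4m: "four_X ^ m = fps_const (4 ^ m) * fps_X ^ m"
    by (simp add: four_X_def power_mult_distrib flip: fps_const_power)
  have fn: "4 ^ m * f $ n = (\<Sum>i\<le>degree q. coeff q i * binpow (- (k - real i / 2)) $ (n + m))" for n
    using arg_cong[OF *, of "\<lambda>g. g $ (n + m)"]
    by (simp add: X4m mult.assoc fps_sum_nth fps_X_power_mult_nth)
  have lim: "(\<lambda>n. binpow (- (k - real i / 2)) $ (n + m) / (4 ^ (n + m) * real n powr (k - 1)))
      \<longlonglongrightarrow> (if i = 0 then rGamma k else 0)" for i
  proof -
    have "(\<lambda>n. binpow (- (k - real i / 2)) $ (n + m) / (4 ^ (n + m) * real (n + m) powr (k - real i / 2 - 1)))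
      \<longlonglongrightarrow> rGamma (k - real i / 2)"
      using LIMSEQ_ignore_initial_segment[OF binpow_nth_asymp, of "k - real i / 2" m] .
    moreover have "(\<lambda>n. real (n + m) powr (k - real i / 2 - 1) / real n powr (k - 1))
       \<longlonglongrightarrow> (if i = 0 then 1 else 0)"
    proof -
      have "(\<lambda>n. real (n + m) / real n) \<longlonglongrightarrow> 1"
        by real_asymp
      then have "(\<lambda>n. (real (n + m) / real n) powr (k - 1)) \<longlonglongrightarrow> 1 powr (k - 1)"
        by (intro tendsto_powr) auto
      moreover have "(\<lambda>n. real (n + m) powr (- (real i / 2))) \<longlonglongrightarrow> (if i = 0 then 1 else 0)"
      proof (cases "i = 0")
        case True
        have "eventually (\<lambda>n. real (n + m) powr (- (real i / 2)) = 1) sequentially"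
          using eventually_gt_at_top[of 0] by eventually_elim (use True in auto)
        then have "(\<lambda>n. real (n + m) powr (- (real i / 2))) \<longlonglongrightarrow> 1"
          by (rule tendsto_eventually)
        then show ?thesis
          using True by simp
      next
        case False
        have "filterlim (\<lambda>n. real (n + m)) at_top sequentially"
          by real_asymp
        then have "(\<lambda>n. real (n + m) powr (- (real i / 2))) \<longlonglongrightarrow> 0"
          using False by (intro tendsto_neg_powr) auto
        then show ?thesis using False by simp
      qed
      ultimately have "(\<lambda>n. (real (n + m) / real n) powr (k - 1) * real (n + m) powr (- (real i / 2)))
         \<longlonglongrightarrow> 1 powr (k - 1) * (if i = 0 then 1 else 0)"
        by (rule tendsto_mult)
      moreover have "eventually (\<lambda>n. (real (n + m) / real n) powr (k - 1) * real (n + m) powr (- (real i / 2))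
          = real (n + m) powr (k - real i / 2 - 1) / real n powr (k - 1)) sequentially"
        using eventually_gt_at_top[of 0]
      proof eventually_elim
        case (elim n)
        have "real (n + m) powr (k - real i / 2 - 1) = real (n + m) powr (k - 1) * real (n + m) powr (- (real i / 2))"
          by (simp add: algebra_simps flip: powr_add)
        then show ?case using elim by (simp add: powr_divide)
      qed
      ultimately show ?thesis
        by (simp add: tendsto_cong split: if_splits)
    qed
    ultimately have "(\<lambda>n. binpow (- (k - real i / 2)) $ (n + m) / (4 ^ (n + m) * real (n + m) powr (k - real i / 2 - 1))
        * (real (n + m) powr (k - real i / 2 - 1) / real n powr (k - 1)))
       \<longlonglongrightarrow> rGamma (k - real i / 2) * (if i = 0 then 1 else 0)"
      by (rule tendsto_mult)
    moreover have "rGamma (k - real i / 2) * (if i = 0 then 1 else 0) = (if i = 0 then rGamma k else 0)"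
      by simp
    moreover have "eventually (\<lambda>n. binpow (- (k - real i / 2)) $ (n + m) / (4 ^ (n + m) * real (n + m) powr (k - real i / 2 - 1))
        * (real (n + m) powr (k - real i / 2 - 1) / real n powr (k - 1))
        = binpow (- (k - real i / 2)) $ (n + m) / (4 ^ (n + m) * real n powr (k - 1))) sequentially"
      using eventually_gt_at_top[of 0] by eventually_elim simp
    ultimately show ?thesis
      by (simp add: tendsto_cong)
  qed
  have "(\<lambda>n. \<Sum>i\<le>degree q. coeff q i * (binpow (- (k - real i / 2)) $ (n + m) / (4 ^ (n + m) * real n powr (k - 1))))
     \<longlonglongrightarrow> (\<Sum>i\<le>degree q. coeff q i * (if i = 0 then rGamma k else 0))"
    by (intro tendsto_sum tendsto_mult tendsto_const lim)
  moreover have "(\<Sum>i\<le>degree q. coeff q i * (if i = 0 then rGamma k else 0)) = c * rGamma k"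
    by (subst sum.cong[OF refl, of _ _ "\<lambda>i. if i = 0 then c * rGamma k else 0"]) (auto simp: q)
  moreover have "(\<Sum>i\<le>degree q. coeff q i * (binpow (- (k - real i / 2)) $ (n + m) / (4 ^ (n + m) * real n powr (k - 1))))
      = f $ n / (4 ^ n * real n powr (k - 1))" for n
  proof -
    have "(\<Sum>i\<le>degree q. coeff q i * (binpow (- (k - real i / 2)) $ (n + m) / (4 ^ (n + m) * real n powr (k - 1))))
      = 4 ^ m * f $ n / (4 ^ (n + m) * real n powr (k - 1))"
      unfolding fn sum_divide_distrib by simp
    then show ?thesis by (simp add: power_add)
  qed
  ultimately show ?thesis
    by (simp add: k_def)
qed

section \<open>Power series weighted by two statistics\<close>

type_synonym wt = "real fps fps"

text \<open>The series \<open>exp(p u + q v)\<close>; the outer variable is \<open>u\<close>, the inner one is \<open>v\<close>. Summed over objects with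
statistics \<open>p\<close> and \<open>q\<close>, it collects all joint moments.\<close>

definition exp_uv :: "real \<Rightarrow> real \<Rightarrow> wt" where
  "exp_uv p q = Abs_fps (\<lambda>a. Abs_fps (\<lambda>b. p ^ a * q ^ b / (fact a * fact b)))"

lemma exp_uv_nth [simp]: "exp_uv p q $ a $ b = p ^ a * q ^ b / (fact a * fact b)"
  by (simp add: exp_uv_def)

lemma binomial_fact_sum:
  "(x + y :: real) ^ n / fact n = (\<Sum>i\<le>n. (x ^ i / fact i) * (y ^ (n - i) / fact (n - i)))"
  unfolding binomial_ring sum_divide_distrib
  by (rule sum.cong) (auto simp: binomial_fact)

lemma exp_uv_add: "exp_uv (p + p') (q + q') = exp_uv p q * exp_uv p' q'"
proof (intro fps_ext)
  fix a b
  have "exp_uv (p + p') (q + q') $ a $ b = ((p + p') ^ a / fact a) * ((q + q') ^ b / fact b)"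
    by simp
  also have "\<dots> = (\<Sum>i\<le>a. \<Sum>j\<le>b. ((p ^ i / fact i) * (p' ^ (a - i) / fact (a - i))) *
       ((q ^ j / fact j) * (q' ^ (b - j) / fact (b - j))))"
    unfolding binomial_fact_sum by (simp add: sum_product)
  also have "\<dots> = (exp_uv p q * exp_uv p' q') $ a $ b"
    unfolding fps_mult_nth fps_sum_nth atLeast0AtMost by (intro sum.cong) (simp_all add: mult_ac)
  finally show "exp_uv (p + p') (q + q') $ a $ b = (exp_uv p q * exp_uv p' q') $ a $ b" .
qed

lemma exp_uv_0 [simp]: "exp_uv 0 0 = 1"
  by (intro fps_ext) (auto simp: power_0_left)

text \<open>The generating function, in \<open>X\<close> alone, of the coefficients of \<open>u\<^sup>a v\<^sup>b\<close>.\<close>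

definition cf :: "wt fps \<Rightarrow> nat \<Rightarrow> nat \<Rightarrow> real fps" where
  "cf F a b = Abs_fps (\<lambda>k. F $ k $ a $ b)"

definition conv :: "(nat \<Rightarrow> nat \<Rightarrow> 'a::comm_ring_1) \<Rightarrow> (nat \<Rightarrow> nat \<Rightarrow> 'a) \<Rightarrow> nat \<Rightarrow> nat \<Rightarrow> 'a" where
  "conv f g a b = (\<Sum>(i, j)\<in>{..a} \<times> {..b}. f i j * g (a - i) (b - j))"

text \<open>The convolution without its two corner terms. When the coefficient at \<open>(a, b)\<close> of a product is used
to solve for the coefficient of a factor, these are the terms already known.\<close>

definition inner_conv :: "(nat \<Rightarrow> nat \<Rightarrow> 'a::comm_ring_1) \<Rightarrow> (nat \<Rightarrow> nat \<Rightarrow> 'a) \<Rightarrow> nat \<Rightarrow> nat \<Rightarrow> 'a" where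
  "inner_conv f g a b = (\<Sum>(i, j)\<in>{..a} \<times> {..b} - {(0, 0), (a, b)}. f i j * g (a - i) (b - j))"

lemma conv_00 [simp]: "conv f g 0 0 = f 0 0 * g 0 0"
  by (simp add: conv_def)

lemma conv_corners:
  assumes "(a, b) \<noteq> (0, 0)"
  shows "conv f g a b = f 0 0 * g a b + f a b * g 0 0 + inner_conv f g a b"
proof -
  let ?h = "\<lambda>(i, j). f i j * g (a - i) (b - j)"
  have "conv f g a b = sum ?h (insert (0, 0) (insert (a, b) ({..a} \<times> {..b} - {(0, 0), (a, b)})))"
    unfolding conv_def by (rule sum.cong) auto
  also have "\<dots> = ?h (0, 0) + (?h (a, b) + inner_conv f g a b)"
    unfolding inner_conv_def using assms by (subst sum.insert, simp, simp, subst sum.insert) auto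
  finally show ?thesis by simp
qed

lemma conv_nested: "conv f g a b = (\<Sum>i\<le>a. \<Sum>j\<le>b. f i j * g (a - i) (b - j))"
  by (simp add: conv_def sum.cartesian_product)

lemma cf_mult: "cf (F * G) a b = conv (cf F) (cf G) a b"
proof (rule fps_ext)
  fix k
  have "cf (F * G) a b $ k = (\<Sum>l\<le>k. \<Sum>i\<le>a. \<Sum>j\<le>b. F $ l $ i $ j * G $ (k - l) $ (a - i) $ (b - j))"
    by (simp add: cf_def fps_mult_nth fps_sum_nth atLeast0AtMost)
  also have "\<dots> = (\<Sum>i\<le>a. \<Sum>l\<le>k. \<Sum>j\<le>b. F $ l $ i $ j * G $ (k - l) $ (a - i) $ (b - j))"
    by (rule sum.swap)
  also have "\<dots> = (\<Sum>i\<le>a. \<Sum>j\<le>b. \<Sum>l\<le>k. F $ l $ i $ j * G $ (k - l) $ (a - i) $ (b - j))"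
    by (intro sum.cong sum.swap refl)
  also have "\<dots> = conv (cf F) (cf G) a b $ k"
    by (simp add: conv_nested cf_def fps_mult_nth fps_sum_nth atLeast0AtMost)
  finally show "cf (F * G) a b $ k = conv (cf F) (cf G) a b $ k" .
qed

lemma cf_add: "cf (F + G) a b = cf F a b + cf G a b"
  and cf_diff: "cf (F - G) a b = cf F a b - cf G a b"
  and cf_0 [simp]: "cf 0 a b = 0"
  by (auto simp: cf_def fps_eq_iff)

definition lift :: "real fps \<Rightarrow> wt fps" where
  "lift f = Abs_fps (\<lambda>k. fps_const (fps_const (f $ k)))"

lemma cf_lift: "cf (lift f) a b = (if a = 0 \<and> b = 0 then f else 0)"
  by (auto simp: cf_def lift_def fps_eq_iff)

lemma cf_lift_mult: "cf (lift f * F) a b = f * cf F a b"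
proof -
  have "cf (lift f * F) a b = (\<Sum>(i, j)\<in>{..a} \<times> {..b}. if (i, j) = (0, 0) then f * cf F a b else 0)"
    unfolding cf_mult conv_def by (rule sum.cong) (auto simp: cf_lift)
  also have "\<dots> = (\<Sum>p\<in>{..a} \<times> {..b}. if p = (0, 0) then f * cf F a b else 0)"
    by (rule sum.cong) (auto split: if_splits)
  also have "\<dots> = f * cf F a b"
    by (subst sum.delta) auto
  finally show ?thesis .
qed

lemma cf_eqI: "(\<And>a b. cf F a b = cf G a b) \<Longrightarrow> F = G"
  unfolding cf_def fps_eq_iff by simp

lemma lift_mult: "lift (f * g) = lift f * lift g"
  by (rule cf_eqI) (simp add: cf_lift_mult cf_lift)

lemma lift_diff: "lift (f - g) = lift f - lift g"
  and lift_1: "lift 1 = 1"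
  and lift_X: "lift fps_X = fps_X"
  by (auto simp: lift_def fps_eq_iff fps_X_def fps_one_def)

lemma cf_1: "cf 1 a b = (if a = 0 \<and> b = 0 then 1 else 0)"
  using cf_lift[of 1] by (simp add: lift_1)

lemma cf_X: "cf fps_X a b = (if a = 0 \<and> b = 0 then fps_X else 0)"
  using cf_lift[of fps_X] by (simp add: lift_X)

lemma cf_XD: "cf (fps_XD F) a b = fps_XD (cf F a b)"
proof (rule fps_ext)
  fix k
  have "(of_nat n * x) $ a $ b = of_nat n * (x $ a $ b)" for n and x :: wt
    by (induction n) (simp_all add: distrib_right)
  then show "cf (fps_XD F) a b $ k = fps_XD (cf F a b) $ k"
    by (simp add: cf_def XD_nth)
qed

lemma cf_const_exp_uv: "cf (fps_const (exp_uv p q)) a b = fps_const (p ^ a * q ^ b / (fact a * fact b))"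
  by (auto simp: cf_def fps_eq_iff)

text \<open>The weighted order of the double family is at least \<open>w\<close>, where \<open>\<delta>\<close> has order 1, \<open>v\<close> order 3 and \<open>u\<close> order 4;
the part of order exactly \<open>w\<close> has the coefficients \<open>c\<close>. This scaling balances \<open>\<delta>\<^sup>2\<close> against
\<open>v X d/dX\<close> and \<open>2u d/dv\<close>, the two first-order effects of raising all heights by one.\<close>

definition graded :: "int \<Rightarrow> (nat \<Rightarrow> nat \<Rightarrow> real) \<Rightarrow> wt fps \<Rightarrow> bool" where
  "graded w c F \<longleftrightarrow> (\<forall>a b. lead (4 * int a + 3 * int b - w) (c a b) (cf F a b))"

lemma gradedD: "graded w c F \<Longrightarrow> lead (4 * int a + 3 * int b - w) (c a b) (cf F a b)"
  by (simp add: graded_def)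

lemma lead_conv:
  assumes "\<And>i j. i \<le> a \<Longrightarrow> j \<le> b \<Longrightarrow> lead (4 * int i + 3 * int j - w) (c i j) (cf F i j)"
    and "\<And>i j. i \<le> a \<Longrightarrow> j \<le> b \<Longrightarrow> lead (4 * int i + 3 * int j - v) (d i j) (cf G i j)"
  shows "lead (4 * int a + 3 * int b - (w + v)) (conv c d a b) (cf (F * G) a b)"
  unfolding cf_mult conv_def case_prod_unfold
proof (intro lead_sum)
  fix p assume p: "p \<in> {..a} \<times> {..b}"
  then have eq: "4 * int a + 3 * int b - (w + v)
    = (4 * int (fst p) + 3 * int (snd p) - w) + (4 * int (a - fst p) + 3 * int (b - snd p) - v)"
    by (auto simp: of_nat_diff algebra_simps)
  show "lead (4 * int a + 3 * int b - (w + v)) (c (fst p) (snd p) * d (a - fst p) (b - snd p))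
         (cf F (fst p) (snd p) * cf G (a - fst p) (b - snd p))"
    unfolding eq by (rule lead_mult) (use p in \<open>auto intro!: assms\<close>)
qed

lemma graded_mult:
  assumes "graded w c F" "graded v d G"
  shows "graded (w + v) (conv c d) (F * G)"
  unfolding graded_def by (intro allI lead_conv gradedD[OF assms(1)] gradedD[OF assms(2)])

lemma graded_add: "graded w c F \<Longrightarrow> graded w d G \<Longrightarrow> graded w (\<lambda>a b. c a b + d a b) (F + G)"
  and graded_diff: "graded w c F \<Longrightarrow> graded w d G \<Longrightarrow> graded w (\<lambda>a b. c a b - d a b) (F - G)"
  by (simp_all add: graded_def cf_add cf_diff lead_add lead_diff)

lemma graded_weaken: "graded w c F \<Longrightarrow> v < w \<Longrightarrow> graded v (\<lambda>_ _. 0) F"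
  unfolding graded_def by (auto intro!: lead_weaken)

definition unit_at :: "nat \<Rightarrow> nat \<Rightarrow> real" where
  "unit_at a b = (if a = 0 \<and> b = 0 then 1 else 0)"

lemma graded_lift:
  assumes "lead (- w) c f"
  shows "graded w (\<lambda>a b. c * unit_at a b) (lift f)"
  using assms by (auto simp: graded_def cf_lift unit_at_def)

lemma graded_1: "graded 0 unit_at 1"
  using graded_lift[of 0 1 1] lead_1 by (simp add: lift_1)

lemma graded_XD:
  assumes "graded w c F"
  shows "graded (w - 2) (\<lambda>a b. (4 * real a + 3 * real b - of_int w) / 2 * c a b) (fps_XD F)"
  unfolding graded_def cf_XD
proof (intro allI)
  fix a b
  show "lead (4 * int a + 3 * int b - (w - 2)) ((4 * real a + 3 * real b - of_int w) / 2 * c a b) (fps_XD (cf F a b))"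
    using lead_XD[OF gradedD[OF assms, of a b]] by (simp add: algebra_simps)
qed

text \<open>Only indices of smaller level \<open>2i + j\<close> occur, so this can be used in an induction on the level. The level,
unlike the sum of the indices, also decreases along \<open>(a, b) \<mapsto> (a - 1, b + 1)\<close>, which occurs when heights
are raised.\<close>

lemma lead_inner_conv:
  assumes "\<And>i j. 2 * i + j < 2 * a + b \<Longrightarrow> lead (4 * int i + 3 * int j - w) (c i j) (cf F i j)"
    and "\<And>i j. 2 * i + j < 2 * a + b \<Longrightarrow> lead (4 * int i + 3 * int j - v) (d i j) (cf G i j)"
  shows "lead (4 * int a + 3 * int b - w - v) (inner_conv c d a b) (inner_conv (cf F) (cf G) a b)"
  unfolding inner_conv_def case_prod_unfold
proof (intro lead_sum)
  fix p assume p: "p \<in> {..a} \<times> {..b} - {(0, 0), (a, b)}"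
  obtain i j where ij: "p = (i, j)" by force
  have le: "i \<le> a" "j \<le> b" "(i, j) \<noteq> (0, 0)" "(i, j) \<noteq> (a, b)"
    using p ij by auto
  have "2 * i + j < 2 * a + b" "2 * (a - i) + (b - j) < 2 * a + b"
  proof -
    have "i < a \<or> j < b" "0 < i \<or> 0 < j" using le by auto
    then show "2 * i + j < 2 * a + b" "2 * (a - i) + (b - j) < 2 * a + b"
      using le(1,2) by linarith+
  qed
  from lead_mult[OF assms(1)[OF this(1)] assms(2)[OF this(2)]]
  have "lead (4 * int i + 3 * int j - w + (4 * int (a - i) + 3 * int (b - j) - v))
     (c i j * d (a - i) (b - j)) (cf F i j * cf G (a - i) (b - j))" .
  moreover have "4 * int i + 3 * int j - w + (4 * int (a - i) + 3 * int (b - j) - v) = 4 * int a + 3 * int b - w - v"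
    using le by (simp add: of_nat_diff algebra_simps)
  ultimately show "lead (4 * int a + 3 * int b - w - v) (c (fst p) (snd p) * d (a - fst p) (b - snd p))
         (cf F (fst p) (snd p) * cf G (a - fst p) (b - snd p))"
    unfolding ij by (metis fst_conv snd_conv)
qed

text \<open>If all \<open>k\<close> heights are raised by one, then \<open>H = \<Sum>h\<close> becomes \<open>H + k\<close> and \<open>T = \<Sum>h\<^sup>2\<close> becomes \<open>T + 2H + k\<close>. The
pair consists of a weighted sum of exponentials before and after this change.\<close>

definition shift_pair :: "nat \<Rightarrow> wt \<Rightarrow> wt \<Rightarrow> bool" where
  "shift_pair k f g \<longleftrightarrow> (\<exists>ps :: (real \<times> real \<times> real) list.
     f = (\<Sum>(x, T, H)\<leftarrow>ps. fps_const (fps_const x) * exp_uv T H) \<and>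
     g = (\<Sum>(x, T, H)\<leftarrow>ps. fps_const (fps_const x) * exp_uv (T + 2 * H + real k) (H + real k)))"

lemma shift_pair_add:
  assumes "shift_pair k f g" "shift_pair k f' g'"
  shows "shift_pair k (f + f') (g + g')"
  using assms unfolding shift_pair_def
proof (elim exE conjE)
  fix ps qs :: "(real \<times> real \<times> real) list"
  assume "f = (\<Sum>(x, T, H)\<leftarrow>ps. fps_const (fps_const x) * exp_uv T H)"
     "g = (\<Sum>(x, T, H)\<leftarrow>ps. fps_const (fps_const x) * exp_uv (T + 2 * H + real k) (H + real k))"
     "f' = (\<Sum>(x, T, H)\<leftarrow>qs. fps_const (fps_const x) * exp_uv T H)"
     "g' = (\<Sum>(x, T, H)\<leftarrow>qs. fps_const (fps_const x) * exp_uv (T + 2 * H + real k) (H + real k))"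
  then show "\<exists>ps. f + f' = (\<Sum>(x, T, H)\<leftarrow>ps. fps_const (fps_const x) * exp_uv T H) \<and>
     g + g' = (\<Sum>(x, T, H)\<leftarrow>ps. fps_const (fps_const x) * exp_uv (T + 2 * H + real k) (H + real k))"
    by (intro exI[of _ "ps @ qs"]) auto
qed

lemma shift_pair_0 [simp]: "shift_pair k 0 0"
  unfolding shift_pair_def by (intro exI[of _ "[]"]) simp

lemma shift_pair_exp_uv: "shift_pair k (exp_uv T H) (exp_uv (T + 2 * H + real k) (H + real k))"
  unfolding shift_pair_def by (intro exI[of _ "[(1, T, H)]"]) simp

lemma shift_pair_scale:
  assumes "shift_pair k f g"
  shows "shift_pair (l + k) (fps_const (fps_const c) * exp_uv T H * f)
     (fps_const (fps_const c) * exp_uv (T + 2 * H + real l) (H + real l) * g)"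
proof -
  obtain ps :: "(real \<times> real \<times> real) list" where ps:
    "f = (\<Sum>(x, T, H)\<leftarrow>ps. fps_const (fps_const x) * exp_uv T H)"
    "g = (\<Sum>(x, T, H)\<leftarrow>ps. fps_const (fps_const x) * exp_uv (T + 2 * H + real k) (H + real k))"
    using assms unfolding shift_pair_def by blast
  have "shift_pair (l + k)
     (fps_const (fps_const c) * exp_uv T H * (\<Sum>(x, T, H)\<leftarrow>ps. fps_const (fps_const x) * exp_uv T H))
     (fps_const (fps_const c) * exp_uv (T + 2 * H + real l) (H + real l) *
       (\<Sum>(x, T, H)\<leftarrow>ps. fps_const (fps_const x) * exp_uv (T + 2 * H + real k) (H + real k)))"
  proof (induction ps)
    case (Cons p ps)
    obtain x T' H' where p: "p = (x, T', H')" by (cases p)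
    have e1: "fps_const (fps_const c) * exp_uv T H * (fps_const (fps_const x) * exp_uv T' H')
      = fps_const (fps_const (c * x)) * exp_uv (T + T') (H + H')"
      unfolding exp_uv_add fps_const_mult[symmetric] by (simp only: mult_ac)
    have e2: "fps_const (fps_const c) * exp_uv (T + 2 * H + real l) (H + real l) *
         (fps_const (fps_const x) * exp_uv (T' + 2 * H' + real k) (H' + real k))
      = fps_const (fps_const (c * x)) * exp_uv ((T + T') + 2 * (H + H') + real (l + k)) ((H + H') + real (l + k))"
    proof -
      have "(T + T') + 2 * (H + H') + real (l + k) = (T + 2 * H + real l) + (T' + 2 * H' + real k)"
        "(H + H') + real (l + k) = (H + real l) + (H' + real k)"
        by simp_all
      then show ?thesis
        unfolding fps_const_mult[symmetric] by (simp only: exp_uv_add mult_ac)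
    qed
    have "shift_pair (l + k) (fps_const (fps_const (c * x)) * exp_uv (T + T') (H + H'))
      (fps_const (fps_const (c * x)) * exp_uv ((T + T') + 2 * (H + H') + real (l + k)) ((H + H') + real (l + k)))"
      unfolding shift_pair_def by (intro exI[of _ "[(c * x, T + T', H + H')]"]) simp
    from shift_pair_add[OF this Cons] show ?case
      by (simp add: p distrib_left e1 e2)
  qed simp
  then show ?thesis by (simp add: ps)
qed

lemma shift_pair_mult:
  assumes "shift_pair k f g" "shift_pair l f' g'"
  shows "shift_pair (k + l) (f * f') (g * g')"
proof -
  obtain ps :: "(real \<times> real \<times> real) list" where ps:
    "f = (\<Sum>(x, T, H)\<leftarrow>ps. fps_const (fps_const x) * exp_uv T H)"
    "g = (\<Sum>(x, T, H)\<leftarrow>ps. fps_const (fps_const x) * exp_uv (T + 2 * H + real k) (H + real k))"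
    using assms(1) unfolding shift_pair_def by blast
  have "shift_pair (k + l) ((\<Sum>(x, T, H)\<leftarrow>ps. fps_const (fps_const x) * exp_uv T H) * f')
     ((\<Sum>(x, T, H)\<leftarrow>ps. fps_const (fps_const x) * exp_uv (T + 2 * H + real k) (H + real k)) * g')"
    by (induction ps) (auto simp: distrib_right intro!: shift_pair_add shift_pair_scale assms(2))
  then show ?thesis by (simp add: ps)
qed

lemma shift_pair_sum:
  "(\<And>i. i \<in> A \<Longrightarrow> shift_pair k (f i) (g i)) \<Longrightarrow> shift_pair k (\<Sum>i\<in>A. f i) (\<Sum>i\<in>A. g i)"
  by (induction A rule: infinite_finite_induct) (auto intro: shift_pair_add)

text \<open>Raising the heights, for generating functions in which \<open>X\<close> marks the number of heights.\<close>

definition shifted :: "wt fps \<Rightarrow> wt fps \<Rightarrow> bool" where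
  "shifted F G \<longleftrightarrow> (\<forall>k. shift_pair k (F $ k) (G $ k))"

lemma shifted_add: "shifted F G \<Longrightarrow> shifted F' G' \<Longrightarrow> shifted (F + F') (G + G')"
  by (simp add: shifted_def shift_pair_add)

lemma shifted_mult:
  assumes "shifted F G" "shifted F' G'"
  shows "shifted (F * F') (G * G')"
  unfolding shifted_def fps_mult_nth
proof (intro allI shift_pair_sum)
  fix k i :: nat assume "i \<in> {0..k}"
  then show "shift_pair k (F $ i * F' $ (k - i)) (G $ i * G' $ (k - i))"
    using shift_pair_mult[of i "F $ i" "G $ i" "k - i"] assms by (simp add: shifted_def)
qed

lemma shifted_exp_uv: "shifted (fps_const (exp_uv T H)) (fps_const (exp_uv (T + 2 * H) H))"
  using shift_pair_exp_uv[of 0 T H] by (auto simp: shifted_def)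

lemma shifted_1: "shifted 1 1"
  using shifted_exp_uv[of 0 0] by simp

lemma shifted_const: "shifted (lift (fps_const c)) (lift (fps_const c))"
proof -
  have "shift_pair 0 (fps_const (fps_const c)) (fps_const (fps_const c))"
    unfolding shift_pair_def by (intro exI[of _ "[(c, 0, 0)]"]) simp
  then show ?thesis by (auto simp: shifted_def lift_def)
qed

lemma shifted_X: "shifted fps_X (fps_const (exp_uv 1 1) * fps_X)"
proof -
  have "shift_pair 1 1 (exp_uv 1 1)"
    using shift_pair_exp_uv[of 1 0 0] by simp
  then show ?thesis by (auto simp: shifted_def fps_X_def)
qed

lemma shifted_diff:
  assumes "shifted F G" "shifted F' G'"
  shows "shifted (F - F') (G - G')"
proof -
  have "lift (fps_const (- 1)) = - 1"
    by (auto simp: lift_def fps_eq_iff fps_one_def)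
  then show ?thesis
    using shifted_add[OF assms(1) shifted_mult[OF shifted_const[of "- 1"] assms(2)]] by simp
qed

section \<open>Raising all heights by one\<close>

definition shift_idx :: "nat \<Rightarrow> nat \<Rightarrow> (nat \<times> nat \<times> nat) set" where
  "shift_idx a b = (SIGMA j:{..b}. SIGMA i:{..a}. {..a - i})"

lemma finite_shift_idx [simp]: "finite (shift_idx a b)"
  by (simp add: shift_idx_def)

text \<open>The coefficients in the expansion of \<open>(T + 2H + x)\<^sup>a (H + x)\<^sup>b\<close>: the index \<open>j\<close> counts the factors \<open>x\<close> taken from
\<open>H + x\<close>, while \<open>i\<close> and \<open>m\<close> count the factors \<open>x\<close> and \<open>2H\<close> taken from \<open>T + 2H + x\<close>.\<close>

definition shift_coeff :: "nat \<Rightarrow> nat \<times> nat \<times> nat \<Rightarrow> real" where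
  "shift_coeff b = (\<lambda>(j, i, m). 2 ^ m * real ((b - j + m) choose m) / (fact j * fact i))"

lemma sum_shift_idx:
  "(\<Sum>j\<le>b. \<Sum>i\<le>a. \<Sum>m\<le>a-i. t j i m) = (\<Sum>(j, i, m)\<in>shift_idx a b. t j i m)"
  unfolding shift_idx_def by (simp add: sum.Sigma case_prod_unfold)

lemma exp_uv_shift_nth:
  "exp_uv (T + 2 * H + x) (H + x) $ a $ b =
     (\<Sum>(j, i, m)\<in>shift_idx a b. shift_coeff b (j, i, m) * x ^ (i + j) * exp_uv T H $ (a - i - m) $ (b - j + m))"
proof -
  have H: "(H + x) ^ b / fact b = (\<Sum>j\<le>b. (x ^ j / fact j) * (H ^ (b - j) / fact (b - j)))"
    using binomial_fact_sum[of x H b] by (simp add: add.commute)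
  have T: "(T + 2 * H + x) ^ a / fact a = (\<Sum>i\<le>a. (x ^ i / fact i) *
      (\<Sum>m\<le>a-i. ((2 * H) ^ m / fact m) * (T ^ (a - i - m) / fact (a - i - m))))"
    unfolding binomial_fact_sum[of "2 * H" T, symmetric]
    using binomial_fact_sum[of x "T + 2 * H" a] by (simp add: add.commute)
  have "exp_uv (T + 2 * H + x) (H + x) $ a $ b = ((H + x) ^ b / fact b) * ((T + 2 * H + x) ^ a / fact a)"
    by (simp add: mult.commute)
  also have "\<dots> = (\<Sum>j\<le>b. \<Sum>i\<le>a. \<Sum>m\<le>a-i. (x ^ j / fact j) * (H ^ (b - j) / fact (b - j)) *
       ((x ^ i / fact i) * (((2 * H) ^ m / fact m) * (T ^ (a - i - m) / fact (a - i - m)))))"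
    unfolding H T sum_product unfolding sum_distrib_left ..
  also have "\<dots> = (\<Sum>j\<le>b. \<Sum>i\<le>a. \<Sum>m\<le>a-i.
       shift_coeff b (j, i, m) * x ^ (i + j) * exp_uv T H $ (a - i - m) $ (b - j + m))"
  proof (intro sum.cong refl)
    fix j i m
    have "real ((b - j + m) choose m) = fact (b - j + m) / (fact m * fact (b - j))"
      by (simp add: binomial_fact)
    then show "(x ^ j / fact j) * (H ^ (b - j) / fact (b - j)) *
       ((x ^ i / fact i) * (((2 * H) ^ m / fact m) * (T ^ (a - i - m) / fact (a - i - m))))
      = shift_coeff b (j, i, m) * x ^ (i + j) * exp_uv T H $ (a - i - m) $ (b - j + m)"
      by (simp add: shift_coeff_def power_add power_mult_distrib mult_ac)
  qed
  also have "\<dots> = (\<Sum>(j, i, m)\<in>shift_idx a b.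
       shift_coeff b (j, i, m) * x ^ (i + j) * exp_uv T H $ (a - i - m) $ (b - j + m))"
    by (rule sum_shift_idx)
  finally show ?thesis .
qed

lemma shift_pair_nth:
  assumes "shift_pair k f g"
  shows "g $ a $ b =
     (\<Sum>(j, i, m)\<in>shift_idx a b. shift_coeff b (j, i, m) * real k ^ (i + j) * f $ (a - i - m) $ (b - j + m))"
proof -
  obtain ps :: "(real \<times> real \<times> real) list" where ps:
    "f = (\<Sum>(x, T, H)\<leftarrow>ps. fps_const (fps_const x) * exp_uv T H)"
    "g = (\<Sum>(x, T, H)\<leftarrow>ps. fps_const (fps_const x) * exp_uv (T + 2 * H + real k) (H + real k))"
    using assms unfolding shift_pair_def by blast
  show ?thesis unfolding ps
  proof (induction ps)
    case (Cons p ps)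
    obtain x T H where p: "p = (x, T, H)" by (cases p)
    show ?case
      unfolding p list.map sum_list.Cons case_prod_conv fps_add_nth fps_mult_left_const_nth
        Cons[unfolded case_prod_unfold] exp_uv_shift_nth[unfolded case_prod_unfold] case_prod_unfold sum_distrib_left sum.distrib[symmetric] fst_conv snd_conv
      by (rule sum.cong) (simp_all add: algebra_simps)
  qed (simp add: case_prod_unfold)
qed

lemma XD_funpow_nth: "(fps_XD ^^ m) f $ k = real k ^ m * (f $ k :: real)"
  by (induction m) (simp_all add: XD_nth)

text \<open>A factor \<open>k\<close> on the coefficient of \<open>X\<^sup>k\<close> is an application of the Euler operator.\<close>

lemma cf_shifted:
  assumes "shifted F G"
  shows "cf G a b = (\<Sum>(j, i, m)\<in>shift_idx a b.
     fps_const (shift_coeff b (j, i, m)) * (fps_XD ^^ (i + j)) (cf F (a - i - m) (b - j + m)))"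
proof (rule fps_ext)
  fix k
  have "shift_pair k (F $ k) (G $ k)"
    using assms by (simp add: shifted_def)
  from shift_pair_nth[OF this, of a b]
  show "cf G a b $ k = (\<Sum>(j, i, m)\<in>shift_idx a b.
     fps_const (shift_coeff b (j, i, m)) * (fps_XD ^^ (i + j)) (cf F (a - i - m) (b - j + m))) $ k"
    by (simp add: fps_sum_nth case_prod_unfold XD_funpow_nth cf_def mult.assoc)
qed

text \<open>The coefficients of \<open>v X dF/dX + 2u dF/dv\<close> for a leading part \<open>c\<close> of order \<open>w\<close>.\<close>

definition drift :: "int \<Rightarrow> (nat \<Rightarrow> nat \<Rightarrow> real) \<Rightarrow> nat \<Rightarrow> nat \<Rightarrow> real" where
  "drift w c a b =
     (if b = 0 then 0 else (4 * real a + 3 * (real b - 1) - of_int w) / 2 * c a (b - 1)) +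
     (if a = 0 then 0 else 2 * (real b + 1) * c (a - 1) (b + 1))"

lemma lead_XD_funpow:
  assumes "lead K c f"
  shows "\<exists>d. lead (K + 2 * int m) d ((fps_XD ^^ m) f)"
proof (induction m)
  case (Suc m)
  then obtain d where "lead (K + 2 * int m) d ((fps_XD ^^ m) f)" ..
  from lead_XD[OF this] show ?case
    by (auto simp: algebra_simps)
qed (use assms in auto)

text \<open>All terms of the expansion except three have order at least two more than \<open>F\<close>. One of the three is \<open>F\<close>
itself, the other two make up \<open>drift\<close>. They involve lower levels only.\<close>

lemma shifted_lead:
  assumes FG: "shifted F G"
    and lower: "\<And>i j. 2 * i + j < 2 * a + b \<Longrightarrow> lead (4 * int i + 3 * int j - w) (c i j) (cf F i j)"
  shows "lead (4 * int a + 3 * int b - w - 1) (drift w c a b) (cf G a b - cf F a b)"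
proof -
  define t where "t = (\<lambda>(j, i, m). fps_const (shift_coeff b (j, i, m)) *
    (fps_XD ^^ (i + j)) (cf F (a - i - m) (b - j + m)))"
  define l where "l = (\<lambda>p :: nat \<times> nat \<times> nat.
     (if p = (1, 0, 0) then (4 * real a + 3 * (real b - 1) - of_int w) / 2 * c a (b - 1) else 0) +
     (if p = (0, 0, 1) then 2 * (real b + 1) * c (a - 1) (b + 1) else 0))"
  have mem0: "(0, 0, 0) \<in> shift_idx a b"
    by (simp add: shift_idx_def)
  have "cf G a b = t (0, 0, 0) + (\<Sum>p\<in>shift_idx a b - {(0, 0, 0)}. t p)"
    unfolding cf_shifted[OF FG] t_def by (rule sum.remove) (use mem0 in auto)
  also have "t (0, 0, 0) = cf F a b"
    by (simp add: t_def shift_coeff_def)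
  finally have "cf G a b - cf F a b = (\<Sum>p\<in>shift_idx a b - {(0, 0, 0)}. t p)"
    by simp
  moreover have "lead (4 * int a + 3 * int b - w - 1) (\<Sum>p\<in>shift_idx a b - {(0, 0, 0)}. l p)
     (\<Sum>p\<in>shift_idx a b - {(0, 0, 0)}. t p)"
  proof (rule lead_sum)
    fix p assume p: "p \<in> shift_idx a b - {(0, 0, 0)}"
    obtain j i m where jim: "p = (j, i, m)" by (cases p)
    have le: "j \<le> b" "i \<le> a" "m \<le> a - i" "(j, i, m) \<noteq> (0, 0, 0)"
      using p by (auto simp: jim shift_idx_def)
    have "0 < j + i + m" using le(4) by auto
    then have lev: "2 * (a - i - m) + (b - j + m) < 2 * a + b"
      using le(1-3) by linarith
    let ?K = "4 * int (a - i - m) + 3 * int (b - j + m) - w"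
    have K: "?K = 4 * int a + 3 * int b - w - 4 * int i - int m - 3 * int j"
      using le(1-3) by (simp add: of_nat_diff algebra_simps)
    consider "p = (1, 0, 0)" | "p = (0, 0, 1)" | "j + 2 * i + m \<ge> 2"
      using le(4) by (cases "j + 2 * i + m \<ge> 2") (auto simp: jim not_le less_2_cases_iff)
    then show "lead (4 * int a + 3 * int b - w - 1) (l p) (t p)"
    proof cases
      case 1
      then have "t p = fps_XD (cf F a (b - 1))" "1 \<le> b"
        using le by (simp_all add: t_def shift_coeff_def jim)
      moreover have "lead (?K + 2) (of_int ?K / 2 * c a (b - 1)) (fps_XD (cf F a (b - 1)))"
        using lead_XD[OF lower[OF lev]] 1 by (simp add: jim)
      moreover have "?K + 2 = 4 * int a + 3 * int b - w - 1" "l p = of_int ?K / 2 * c a (b - 1)"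
        using 1 \<open>1 \<le> b\<close> unfolding K by (simp_all add: l_def jim algebra_simps)
      ultimately show ?thesis by (simp only:)
    next
      case 2
      then have "t p = fps_const (2 * (real b + 1)) * cf F (a - 1) (b + 1)"
        using le by (simp add: t_def shift_coeff_def jim)
      moreover have "l p = 2 * (real b + 1) * c (a - 1) (b + 1)"
        using 2 by (simp add: l_def)
      moreover have "?K = 4 * int a + 3 * int b - w - 1"
        using 2 unfolding K by (simp add: jim)
      with lower[OF lev] have "lead (4 * int a + 3 * int b - w - 1) (c (a - i - m) (b - j + m)) (cf F (a - i - m) (b - j + m))"
        by (simp only:)
      from lead_cmult[OF this, of "2 * (real b + 1)"]
      have "lead (4 * int a + 3 * int b - w - 1) (2 * (real b + 1) * c (a - 1) (b + 1))
          (fps_const (2 * (real b + 1)) * cf F (a - 1) (b + 1))"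
        using 2 by (simp add: jim)
      ultimately show ?thesis by (simp only:)
    next
      case 3
      obtain d where "lead (?K + 2 * int (i + j)) d ((fps_XD ^^ (i + j)) (cf F (a - i - m) (b - j + m)))"
        using lead_XD_funpow[OF lower[OF lev]] by blast
      from lead_cmult[OF this, of "shift_coeff b (j, i, m)"]
      have "lead (?K + 2 * int (i + j)) (shift_coeff b (j, i, m) * d) (t p)"
        by (simp add: t_def jim)
      moreover have "?K + 2 * int (i + j) < 4 * int a + 3 * int b - w - 1"
      proof -
        have "2 \<le> int j + 2 * int i + int m" using 3 by linarith
        then show ?thesis unfolding K unfolding of_nat_add distrib_left by linarith
      qed
      moreover have "l p = 0"
        using 3 by (auto simp: l_def jim)
      ultimately show ?thesis
        using lead_weaken by simp
    qed
  qed
  moreover have "(\<Sum>p\<in>shift_idx a b - {(0, 0, 0)}. l p) = drift w c a b"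
  proof -
    have "(\<Sum>p\<in>shift_idx a b - {(0, 0, 0)}. l p) =
      (if (1, 0, 0) \<in> shift_idx a b - {(0, 0, 0)} then (4 * real a + 3 * (real b - 1) - of_int w) / 2 * c a (b - 1) else 0) +
      (if (0, 0, 1) \<in> shift_idx a b - {(0, 0, 0)} then 2 * (real b + 1) * c (a - 1) (b + 1) else 0)"
      unfolding l_def sum.distrib by (subst (1 2) sum.delta) (simp_all)
    also have "(1, 0, 0) \<in> shift_idx a b - {(0, 0, 0)} \<longleftrightarrow> b \<noteq> 0"
      by (auto simp: shift_idx_def)
    also have "(0, 0, 1) \<in> shift_idx a b - {(0, 0, 0)} \<longleftrightarrow> a \<noteq> 0"
      by (auto simp: shift_idx_def)
    finally show ?thesis
      by (simp add: drift_def)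
  qed
  ultimately show ?thesis by simp
qed

lemma graded_shifted_diff:
  "graded w c F \<Longrightarrow> shifted F G \<Longrightarrow> graded (w + 1) (drift w c) (G - F)"
  using shifted_lead[of F G _ _ w c] by (simp add: graded_def cf_diff diff_diff_eq)

lemma graded_shifted:
  assumes "graded w c F" "shifted F G"
  shows "graded w c G"
  using graded_add[OF assms(1) graded_weaken[OF graded_shifted_diff[OF assms], of w]] by simp

lemma cf_shifted_00: "shifted F G \<Longrightarrow> cf G 0 0 = cf F 0 0"
  by (subst cf_shifted[of F G]) (simp_all add: shift_idx_def shift_coeff_def)

lemma conv_unit_left: "conv (\<lambda>a b. x * unit_at a b) d a b = x * d a b"
proof -
  have "conv (\<lambda>a b. x * unit_at a b) d a b = (\<Sum>p\<in>{..a} \<times> {..b}. if p = (0, 0) then x * d a b else 0)"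
    unfolding conv_def unit_at_def by (rule sum.cong) (auto split: if_splits)
  also have "\<dots> = x * d a b"
    by (subst sum.delta) auto
  finally show ?thesis .
qed

lemma conv_commute: "conv f g a b = conv g f a b"
  unfolding conv_def
  by (rule sum.reindex_bij_witness[of _ "\<lambda>(i, j). (a - i, b - j)" "\<lambda>(i, j). (a - i, b - j)"])
    (auto simp: mult.commute)

text \<open>Division by a series \<open>L\<close>, one coefficient at a time: the corner term \<open>cf L 0 0 * cf Z a b\<close> of the convolution
is what remains when all terms of lower level are known.\<close>

lemma lead_divide:
  assumes L: "graded v l L" and l0: "l 0 0 \<noteq> 0"
    and inv: "I * cf L 0 0 = 1" "lead v (1 / l 0 0) I"
    and N: "lead (4 * int a + 3 * int b - w) (conv l z a b) (cf (L * Z) a b)"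
    and lower: "\<And>i j. 2 * i + j < 2 * a + b \<Longrightarrow> lead (4 * int i + 3 * int j - (w - v)) (z i j) (cf Z i j)"
  shows "lead (4 * int a + 3 * int b - (w - v)) (z a b) (cf Z a b)"
proof (cases "(a, b) = (0, 0)")
  case True
  have "cf Z 0 0 = I * cf (L * Z) 0 0"
    using inv(1) by (simp add: cf_mult mult.assoc[symmetric])
  moreover have "lead (v + (0 - w)) (1 / l 0 0 * conv l z 0 0) (I * cf (L * Z) 0 0)"
    using True N by (intro lead_mult inv(2)) simp
  ultimately show ?thesis using True l0 by simp
next
  case False
  define J where "J = inner_conv (cf L) (cf Z) a b"
  have J: "lead (4 * int a + 3 * int b - v - (w - v)) (inner_conv l z a b) J"
    unfolding J_def by (rule lead_inner_conv) (auto intro: gradedD[OF L] lower)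
  have Z0: "lead (4 * int 0 + 3 * int 0 - (w - v)) (z 0 0) (cf Z 0 0)"
    using False by (intro lower) auto
  have LZ: "lead (4 * int a + 3 * int b - w) (l a b * z 0 0) (cf L a b * cf Z 0 0)"
    using lead_mult[OF gradedD[OF L, of a b] Z0] by (simp add: algebra_simps)
  have "cf L 0 0 * cf Z a b = cf (L * Z) a b - cf L a b * cf Z 0 0 - J"
    using conv_corners[OF False, of "cf L" "cf Z"] by (simp add: J_def cf_mult algebra_simps)
  then have "I * (cf L 0 0 * cf Z a b) = I * (cf (L * Z) a b - cf L a b * cf Z 0 0 - J)"
    by simp
  then have "cf Z a b = I * (cf (L * Z) a b - cf L a b * cf Z 0 0 - J)"
    using inv(1) by (simp add: mult.assoc[symmetric])
  moreover have "lead (4 * int a + 3 * int b - w) (conv l z a b - l a b * z 0 0 - inner_conv l z a b)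
      (cf (L * Z) a b - cf L a b * cf Z 0 0 - J)"
    using J by (intro lead_diff N LZ) (simp add: algebra_simps)
  from lead_mult[OF inv(2) this]
  have "lead (4 * int a + 3 * int b - (w - v)) (1 / l 0 0 * (conv l z a b - l a b * z 0 0 - inner_conv l z a b))
      (I * (cf (L * Z) a b - cf L a b * cf Z 0 0 - J))"
    by (simp add: algebra_simps)
  moreover have "z a b = 1 / l 0 0 * (conv l z a b - l a b * z 0 0 - inner_conv l z a b)"
    using conv_corners[OF False, of l z] l0 by (simp add: field_simps)
  ultimately show ?thesis by simp
qed

section \<open>Leading order of the functional equations\<close>

text \<open>Here \<open>y\<close> and \<open>z\<close> are the leading parts of \<open>Y = 1 - D0/2\<close> and of the generating function of closed walks.
The equations say \<open>Y\<^sup>2 = \<delta>\<^sup>2 + v X Y' + 2u dY/dv\<close> and \<open>Z Y = - 2 X Y'\<close> for these parts.\<close>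

locale scaled_coeffs =
  fixes y z :: "nat \<Rightarrow> nat \<Rightarrow> real"
  assumes y_00: "y 0 0 = 1"
    and y_rec: "(a, b) \<noteq> (0, 0) \<Longrightarrow> conv y y a b = drift 1 y a b"
    and z_rec: "conv y z a b = - (4 * real a + 3 * real b - 1) * y a b"
begin

text \<open>The leading part of \<open>- 2 X Y'\<close>. Both \<open>X D0'\<close> and the jump series \<open>W\<close> turn out to have it.\<close>

definition w :: "nat \<Rightarrow> nat \<Rightarrow> real" where
  "w a b = - (4 * real a + 3 * real b - 1) * y a b"

text \<open>This is the Riccati equation differentiated: \<open>4a + 3b\<close> is additive under convolution, so multiplication
by it is a derivation.\<close>

lemma w_rec:
  assumes "(a, b) \<noteq> (0, 0)"
  shows "2 * conv y w a b = drift (- 1) w a b"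
proof -
  define e where "e = (\<lambda>a b :: nat. 4 * real a + 3 * real b)"
  let ?ey = "\<lambda>i j. e i j * y i j"
  have "conv y ?ey a b = conv ?ey y a b"
    by (rule conv_commute)
  then have "2 * conv y ?ey a b = conv ?ey y a b + conv y ?ey a b"
    by simp
  also have "\<dots> = (\<Sum>(i, j)\<in>{..a} \<times> {..b}. e a b * (y i j * y (a - i) (b - j)))"
    unfolding conv_def sum.distrib[symmetric]
    by (rule sum.cong) (auto simp: e_def of_nat_diff algebra_simps)
  also have "\<dots> = e a b * conv y y a b"
    by (simp add: conv_def sum_distrib_left case_prod_unfold)
  finally have ey: "2 * conv y ?ey a b = e a b * drift 1 y a b"
    by (simp add: y_rec[OF assms])
  have "conv y w a b = conv y y a b - conv y ?ey a b"
    unfolding conv_def sum_subtractf[symmetric]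
    by (rule sum.cong) (auto simp: w_def e_def algebra_simps)
  with ey have "2 * conv y w a b = - (e a b - 2) * drift 1 y a b"
    by (simp add: y_rec[OF assms] algebra_simps)
  also have "\<dots> = drift (- 1) w a b"
    by (cases a; cases b) (simp_all add: drift_def w_def e_def field_simps)
  finally show ?thesis .
qed

end

text \<open>The functional equations of the generating functions of runs, without their combinatorial meaning;
\<open>D1\<close>, \<open>D2\<close> and \<open>W1\<close> arise from \<open>D0\<close>, \<open>D1\<close> and \<open>W\<close> by raising all heights by one. The constants
\<open>exp_uv 1 1\<close> and \<open>exp_uv 4 2\<close> are the weights of the heights 1 and 2.\<close>

locale run_series = scaled_coeffs +
  fixes D0 D1 D2 W W1 :: "wt fps"
  assumes D0_rec: "D0 = 1 + fps_X * fps_const (exp_uv 1 1) * D0 * D1"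
    and D_shifted: "shifted D0 D1" "shifted D1 D2"
    and W_rec: "W = fps_X * fps_const (exp_uv 4 2) * D2 * D1 * D0 + fps_X * fps_const (exp_uv 1 1) * D0\<^sup>2 * W1"
    and W_shifted: "shifted W W1"
begin

abbreviation "\<delta> \<equiv> binpow (1 / 2)"
abbreviation "half \<equiv> lift (fps_const (1 / 2))"

text \<open>In terms of \<open>Y\<close> and \<open>V\<close> the functional equation is \<open>(1 - Y)(1 + V) = 1\<close>. The series \<open>V\<close> is \<open>V0\<close> with raised
heights, and \<open>V0\<close> differs from \<open>Y\<close> only by terms of higher order.\<close>

definition "Y = 1 - half * D0"
definition "V = 1 - lift four_X * fps_const (exp_uv 1 1) * half * D1"
definition "V0 = 1 - lift four_X * (1 - Y)"

lemma lift_numeral: "lift (numeral n) = numeral n"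
  by (auto simp: lift_def fps_eq_iff fps_numeral_nth)

lemma half: "half * 2 = 1"
proof -
  have "fps_const (1 / 2) * 2 = (1 :: real fps)"
    by (simp add: numeral_fps_const)
  then show ?thesis
    by (metis lift_mult lift_numeral lift_1)
qed

lemma lift_four_X: "lift four_X = 4 * fps_X"
  using lift_numeral[of "num.Bit0 (num.Bit0 num.One)"]
  by (simp add: four_X_def lift_mult lift_X numeral_fps_const)

lemma D0_Y: "2 * (1 - Y) = D0"
  using half by (simp add: Y_def mult.assoc[symmetric] mult.commute[of 2])

lemma YV: "V - Y = Y * V"
proof -
  have "(1 - Y) * (1 + V) = (1 - Y) * (2 - 4 * fps_X * fps_const (exp_uv 1 1) * half * D1)"
    unfolding V_def lift_four_X by (simp add: algebra_simps)
  also have "\<dots> = 2 * (1 - Y) - 2 * (1 - Y) * (2 * half) * fps_X * fps_const (exp_uv 1 1) * D1"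
    by (simp add: algebra_simps)
  also have "\<dots> = D0 - fps_X * fps_const (exp_uv 1 1) * D0 * D1"
    unfolding D0_Y mult.commute[of 2 half] half by (simp add: mult_ac)
  also have "\<dots> = 1"
    by (subst (1) D0_rec) simp
  finally show ?thesis by (simp add: algebra_simps)
qed

lemma four_X_shifted: "shifted (lift four_X) (lift four_X * fps_const (exp_uv 1 1))"
  using shifted_mult[OF shifted_const[of 4] shifted_X]
  by (simp add: four_X_def lift_mult lift_X mult_ac)

lemma V0_shifted: "shifted V0 V"
proof -
  have "shifted (lift four_X * (half * D0)) (lift four_X * fps_const (exp_uv 1 1) * (half * D1))"
    by (intro shifted_mult four_X_shifted shifted_const D_shifted)
  then show ?thesis
    unfolding V0_def V_def Y_def using shifted_diff[OF shifted_1] by (simp add: mult.assoc)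
qed

text \<open>For \<open>u = v = 0\<close> the runs are counted by the Catalan series \<open>d = 1 + X d\<^sup>2\<close>, and \<open>V = 1 - 2Xd\<close> is its
discriminant root.\<close>

lemma cf_V_00: "cf V 0 0 = \<delta>"
proof -
  define d where "d = cf D0 0 0"
  have "cf D1 0 0 = d"
    unfolding d_def by (rule cf_shifted_00[OF D_shifted(1)])
  moreover have "cf D0 0 0 = 1 + fps_X * cf D0 0 0 * cf D1 0 0"
    by (subst (1) D0_rec) (simp add: cf_add cf_1 cf_mult cf_X cf_const_exp_uv)
  ultimately have d: "d = 1 + fps_X * d * d" and d1: "cf D1 0 0 = d"
    by (simp_all flip: d_def)
  have V: "cf V 0 0 = 1 - four_X * (fps_const (1 / 2) * d)"
    by (simp add: V_def cf_diff cf_1 cf_mult cf_lift cf_const_exp_uv d1 mult.assoc)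
  have four_X: "four_X * fps_const (1 / 2) = 2 * fps_X"
    by (simp add: four_X_def numeral_fps_const)
  have V': "cf V 0 0 = 1 - 2 * fps_X * d"
    unfolding V mult.assoc[symmetric] four_X ..
  have "cf V 0 0 * cf V 0 0 = 1 - 4 * fps_X * d + 4 * fps_X * (fps_X * d * d)"
    unfolding V' by (simp add: algebra_simps)
  also have "fps_X * d * d = d - 1"
    using d by (metis add_diff_cancel_left')
  also have "1 - 4 * fps_X * d + 4 * fps_X * (d - 1) = 1 - four_X"
    by (simp add: four_X_def numeral_fps_const algebra_simps)
  finally have "cf V 0 0 * cf V 0 0 = \<delta> * \<delta>"
    by (simp only: binpow_half_square)
  then have "(cf V 0 0 - \<delta>) * (cf V 0 0 + \<delta>) = 0"
    by (simp add: algebra_simps)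
  moreover have "(cf V 0 0 + \<delta>) $ 0 = 2"
    by (simp add: V' mult.assoc)
  then have "cf V 0 0 + \<delta> \<noteq> 0"
    by (metis fps_zero_nth zero_neq_numeral)
  ultimately show ?thesis by simp
qed

lemma Y_00: "(1 - cf Y 0 0) * (1 + \<delta>) = 1"
  using arg_cong[OF YV, of "\<lambda>F. cf F 0 0"] cf_V_00
  by (simp add: cf_diff cf_mult algebra_simps)

lemma Y_00': "cf Y 0 0 = \<delta> * (1 - cf Y 0 0)"
  using Y_00 by (simp add: algebra_simps)

lemma four_X_delta: "four_X = (1 - \<delta>) * (1 + \<delta>)"
  using binpow_half_square by (simp add: algebra_simps)

lemma four_X_Y_00: "four_X * (1 - cf Y 0 0) = (1 - \<delta>)"
proof -
  have "four_X * (1 - cf Y 0 0) = (1 - \<delta>) * ((1 - cf Y 0 0) * (1 + \<delta>))"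
    unfolding four_X_delta by (simp only: mult_ac)
  then show ?thesis by (simp add: Y_00)
qed

lemma lead_1_minus: "lead 0 1 (1 - cf Y 0 0)"
proof -
  have "four_X ^ 1 * (1 - cf Y 0 0) = binpow (- (of_int 0 / 2)) * sqrt_poly [:1, - 1:]"
    by (simp add: four_X_Y_00 sqrt_poly_pCons fps_const_neg[symmetric] del: fps_const_neg)
  then show ?thesis
    by (rule leadI) simp
qed

lemma lead_Y_00: "lead (- 1) 1 (cf Y 0 0)"
  using lead_mult[OF lead_delta lead_1_minus] by (simp flip: Y_00')

lemma cf_V0: "(a, b) \<noteq> (0, 0) \<Longrightarrow> cf V0 a b = four_X * cf Y a b"
  by (auto simp: V0_def cf_diff cf_1 cf_lift_mult)

lemma lead_V0:
  assumes "lead (4 * int a + 3 * int b - 1) (y a b) (cf Y a b)"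
  shows "lead (4 * int a + 3 * int b - 1) (y a b) (cf V0 a b)"
proof (cases "(a, b) = (0, 0)")
  case True
  then show ?thesis
    using lead_delta cf_V_00 cf_shifted_00[OF V0_shifted] y_00 by simp
next
  case False
  then show ?thesis
    using lead_mult[OF lead_four_X assms] by (simp add: cf_V0)
qed

text \<open>The coefficient of \<open>V - Y = Y V\<close> at \<open>(a, b)\<close> is linear in \<open>cf Y a b\<close>, with the factor \<open>2\<delta>\<close> up to a unit. What
remains is of lower level: the effect \<open>V - V0\<close> of raising the heights and the inner convolution.\<close>

lemma graded_Y: "graded 1 y Y"
proof -
  have "lead (4 * int a + 3 * int b - 1) (y a b) (cf Y a b)" for a b
  proof (induction "2 * a + b" arbitrary: a b rule: less_induct)
    case less
    show ?case
    proof (cases "(a, b) = (0, 0)")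
      case True
      then show ?thesis using lead_Y_00 y_00 by simp
    next
      case False
      define S where "S = cf V a b - cf V0 a b"
      define J where "J = inner_conv (cf Y) (cf V) a b"
      have lowV: "lead (4 * int i + 3 * int j - 1 - 1) (drift 1 y i j) (cf V i j - cf V0 i j)"
        if "2 * i + j \<le> 2 * a + b" for i j
        by (rule shifted_lead[OF V0_shifted]) (use that in \<open>auto intro!: lead_V0 less\<close>)
      have S: "lead (4 * int a + 3 * int b - 1 - 1) (drift 1 y a b) S"
        unfolding S_def by (rule lowV) simp
      have J: "lead (4 * int a + 3 * int b - 1 - 1) (inner_conv y y a b) J"
        unfolding J_def
      proof (rule lead_inner_conv)
        fix i j assume ij: "2 * i + j < 2 * a + b"
        show "lead (4 * int i + 3 * int j - 1) (y i j) (cf Y i j)"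
          using ij by (rule less)
        have "lead (4 * int i + 3 * int j - 1) 0 (cf V i j - cf V0 i j)"
          by (rule lead_weaken[OF lowV]) (use ij in auto)
        from lead_add[OF this lead_V0[OF less[OF ij]]]
        show "lead (4 * int i + 3 * int j - 1) (y i j) (cf V i j)"
          by simp
      qed
      let ?u = "1 - cf Y 0 0"
      have VX: "cf V a b = four_X * cf Y a b + S"
        using cf_V0[OF False] by (simp add: S_def)
      have "cf V a b - cf Y a b = cf Y 0 0 * cf V a b + cf Y a b * \<delta> + J"
        using arg_cong[OF YV, of "\<lambda>F. cf F a b"] conv_corners[OF False, of "cf Y" "cf V"]
        by (simp add: cf_diff cf_mult cf_V_00 J_def)
      then have *: "?u * cf V a b = (1 + \<delta>) * cf Y a b + J"
        by (simp add: algebra_simps)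
      have "?u * four_X = 1 - \<delta>"
        using four_X_Y_00 by (simp only: mult.commute)
      moreover have "?u * four_X * cf Y a b + ?u * S = (1 + \<delta>) * cf Y a b + J"
        using * unfolding VX by (simp add: algebra_simps)
      ultimately have "(1 - \<delta>) * cf Y a b + ?u * S = (1 + \<delta>) * cf Y a b + J"
        by (simp only:)
      then have "2 * \<delta> * cf Y a b = ?u * S - J"
        by (simp add: algebra_simps)
      \<comment> \<open>Divide by \<open>2\<delta>\<close>; the factor \<open>binpow (- (1 / 2))\<close> is \<open>1/\<delta>\<close>.\<close>
      then have "fps_const (1 / 2) * (binpow (- (1 / 2)) * (2 * \<delta> * cf Y a b))
          = fps_const (1 / 2) * (binpow (- (1 / 2)) * (?u * S - J))"
        by (simp only:)
      also have "fps_const (1 / 2) * (binpow (- (1 / 2)) * (2 * \<delta> * cf Y a b))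
          = (fps_const (1 / 2) * 2) * (binpow (- (1 / 2)) * \<delta>) * cf Y a b"
        by (simp only: mult_ac)
      also have "\<dots> = cf Y a b"
        by (simp add: numeral_fps_const flip: binpow_add)
      finally have "cf Y a b = fps_const (1 / 2) * (binpow (- (1 / 2)) * (?u * S - J))" .
      moreover have "lead (4 * int a + 3 * int b - 1 - 1) (1 * drift 1 y a b - inner_conv y y a b) (?u * S - J)"
        using lead_mult[OF lead_1_minus S] by (intro lead_diff J) simp
      from lead_cmult[OF lead_mult[OF lead_binpow[of 1] this], of "1 / 2"]
      have "lead (4 * int a + 3 * int b - 1) (1 / 2 * (drift 1 y a b - inner_conv y y a b))
         (fps_const (1 / 2) * (binpow (- (1 / 2)) * (?u * S - J)))"
        by (simp add: algebra_simps)
      moreover have "y a b = 1 / 2 * (drift 1 y a b - inner_conv y y a b)"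
        using y_rec[OF False] conv_corners[OF False, of y y] y_00 by simp
      ultimately show ?thesis by (simp only:)
    qed
  qed
  then show ?thesis by (simp add: graded_def)
qed

text \<open>The denominator of the generating function of closed walks; its leading part is \<open>2Y\<close>.\<close>

definition "L = 1 - fps_X * D0\<^sup>2"

lemma X_D0_square: "fps_X * D0\<^sup>2 = lift four_X * (1 - Y)\<^sup>2"
  unfolding lift_four_X by (subst D0_Y[symmetric]) (simp add: power2_eq_square algebra_simps)

lemma graded_lift_four_X: "graded 0 (\<lambda>a b. 1 * unit_at a b) (lift four_X)"
  using graded_lift[of 0 1 four_X] lead_four_X by simp

lemma graded_L: "graded 1 (\<lambda>a b. 2 * y a b) L"
proof -
  have "lead (- 2) 1 (1 - four_X)"
    using lead_binpow[of "- 2"] by (simp add: binpow_1)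
  then have "graded 2 (\<lambda>a b. 1 * unit_at a b) (lift (1 - four_X))"
    by (intro graded_lift) simp
  then have "graded 1 (\<lambda>_ _. 0) (lift (1 - four_X))"
    by (rule graded_weaken) simp
  moreover have "graded 1 (\<lambda>_ _. 0) (Y * Y)"
    by (rule graded_weaken[OF graded_mult[OF graded_Y graded_Y]]) simp
  then have "graded (0 + 1) (conv (\<lambda>a b. 1 * unit_at a b) (\<lambda>a b. y a b + y a b - 0))
      (lift four_X * (Y + Y - Y * Y))"
    by (intro graded_mult graded_lift_four_X graded_diff graded_add graded_Y)
  ultimately have "graded 1 (\<lambda>a b. 0 + conv (\<lambda>a b. 1 * unit_at a b) (\<lambda>a b. y a b + y a b - 0) a b)
      (lift (1 - four_X) + lift four_X * (Y + Y - Y * Y))"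
    by (intro graded_add) simp_all
  moreover have "L = lift (1 - four_X) + lift four_X * (Y + Y - Y * Y)"
    unfolding L_def X_D0_square by (simp add: lift_diff lift_1 algebra_simps power2_eq_square)
  moreover have "conv (\<lambda>a b. 1 * unit_at a b) (\<lambda>a b. y a b + y a b - 0) a b = 2 * y a b" for a b
    using conv_unit_left[of 1] by simp
  ultimately show ?thesis by simp
qed

definition "Linv = fps_const (1 / 2) * (binpow (- (1 / 2)) * (1 + \<delta>))"

text \<open>The inverse of \<open>cf L 0 0 = 2\<delta>/(1 + \<delta>)\<close>.\<close>

lemma Linv: "Linv * cf L 0 0 = 1"
proof -
  let ?u = "1 - cf Y 0 0"
  have "cf ((1 - Y)\<^sup>2) 0 0 = ?u * ?u"
    by (simp add: power2_eq_square cf_mult cf_diff cf_1)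
  then have L0: "cf L 0 0 = 1 - four_X * (?u * ?u)"
    unfolding L_def X_D0_square by (simp add: cf_diff cf_1 cf_lift_mult)
  have "(1 + \<delta>) * cf L 0 0 = (1 + \<delta>) - (four_X * ?u) * (?u * (1 + \<delta>))"
  proof -
    have "(1 + d) * (1 - x * (u * u)) = (1 + d) - (x * u) * (u * (1 + d))" for d x u :: "real fps"
      by (simp add: algebra_simps)
    then show ?thesis unfolding L0 .
  qed
  also have "\<dots> = 2 * \<delta>"
    unfolding Y_00 four_X_Y_00 by simp
  finally have L: "(1 + \<delta>) * cf L 0 0 = 2 * \<delta>" .
  have "Linv * cf L 0 0 = fps_const (1 / 2) * binpow (- (1 / 2)) * ((1 + \<delta>) * cf L 0 0)"
    unfolding Linv_def by (simp only: mult.assoc)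
  also have "\<dots> = (fps_const (1 / 2) * 2) * (binpow (- (1 / 2)) * \<delta>)"
    unfolding L by (simp only: mult_ac)
  finally have "Linv * cf L 0 0 = (fps_const (1 / 2) * 2) * (binpow (- (1 / 2)) * \<delta>)" .
  then show ?thesis
    by (simp add: numeral_fps_const flip: binpow_add)
qed

lemma lead_Linv: "lead 1 (1 / (2 * y 0 0)) Linv"
proof -
  have "lead 0 0 \<delta>"
    by (rule lead_weaken[OF lead_delta]) simp
  from lead_cmult[OF lead_mult[OF lead_binpow[of 1] lead_add[OF lead_1 this]], of "1 / 2"]
  show ?thesis by (simp add: Linv_def y_00)
qed

lemma graded_1_minus_Y: "graded 0 unit_at (1 - Y)"
  using graded_diff[OF graded_1 graded_weaken[OF graded_Y, of 0]] by simp

lemma conv_unit: "conv unit_at d a b = d a b"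
  using conv_unit_left[of 1 d] by simp

lemma graded_mult_unit:
  assumes "graded 0 (\<lambda>a b. x * unit_at a b) F" "graded v d G"
  shows "graded v (\<lambda>a b. x * d a b) (F * G)"
  using graded_mult[OF assms] unfolding graded_def by (simp add: conv_unit_left)

lemma graded_D0: "graded 0 (\<lambda>a b. 2 * unit_at a b) D0"
proof -
  have "graded 0 (\<lambda>a b. 2 * unit_at a b) (lift (fps_const 2) * (1 - Y))"
    using graded_mult_unit[OF graded_lift[of 0 2] graded_1_minus_Y] lead_const[of 2] by simp
  moreover have "lift (fps_const 2) * (1 - Y) = D0"
    using lift_numeral[of "num.Bit0 num.One"] D0_Y by (simp add: numeral_fps_const)
  ultimately show ?thesis by simp
qed

definition "Q = fps_X * fps_const (exp_uv 4 2) * D2 * D1 * D0"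

lemma graded_Q: "graded 0 (\<lambda>a b. 2 * unit_at a b) Q"
proof -
  define E0 where "E0 = fps_X * D0"
  define E1 where "E1 = fps_const (exp_uv 1 1) * fps_X * D1"
  define E2 where "E2 = fps_const (exp_uv 3 1) * (fps_const (exp_uv 1 1) * fps_X) * D2"
  have "4 * (fps_X * (1 - Y)) * half = 2 * (fps_X * (1 - Y)) * (half * 2)"
    by (simp add: algebra_simps)
  also have "\<dots> = fps_X * (2 * (1 - Y))"
    unfolding half by (simp add: mult_ac)
  also have "\<dots> = E0"
    unfolding D0_Y E0_def ..
  finally have "half * (lift four_X * (1 - Y)) = E0"
    by (simp add: lift_four_X mult_ac)
  moreover have "graded 0 (\<lambda>a b. 1 / 2 * (1 * unit_at a b)) (half * (lift four_X * (1 - Y)))"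
    using lead_const[of "1 / 2"]
    by (intro graded_mult_unit graded_lift graded_lift_four_X graded_1_minus_Y) simp
  ultimately have "graded 0 (\<lambda>a b. 1 / 2 * unit_at a b) E0"
    by simp
  moreover have "shifted E0 E1"
    unfolding E0_def E1_def by (intro shifted_mult shifted_X D_shifted)
  moreover have "shifted E1 E2"
    using shifted_exp_uv[of 1 1] unfolding E1_def E2_def
    by (intro shifted_mult shifted_X D_shifted) simp
  ultimately have "graded 0 (\<lambda>a b. 1 / 2 * unit_at a b) E2"
    using graded_shifted by blast
  moreover have "graded 0 (\<lambda>a b. 2 * unit_at a b) D1"
    using graded_shifted[OF graded_D0 D_shifted(1)] .
  ultimately have "graded 0 (\<lambda>a b. 1 / 2 * (2 * (2 * unit_at a b))) (E2 * (D1 * D0))"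
    by (intro graded_mult_unit graded_D0)
  moreover have "E2 * (D1 * D0) = (fps_const (exp_uv 3 1) * fps_const (exp_uv 1 1)) * (fps_X * D2 * D1 * D0)"
    unfolding E2_def by (simp only: mult_ac)
  moreover have "fps_const (exp_uv 3 1) * fps_const (exp_uv 1 1) = fps_const (exp_uv 4 2)"
    by (simp flip: exp_uv_add)
  ultimately have "graded 0 (\<lambda>a b. 1 / 2 * (2 * (2 * unit_at a b))) (fps_const (exp_uv 4 2) * (fps_X * D2 * D1 * D0))"
    by (simp only:)
  moreover have "fps_const (exp_uv 4 2) * (fps_X * D2 * D1 * D0) = Q"
    unfolding Q_def by (simp only: mult_ac)
  ultimately show ?thesis by simp
qed

text \<open>To leading order the equation for \<open>W\<close> reads \<open>2 Y W = 2 + v X W' + 2u dW/dv\<close>, which is what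
\<open>- 2 X Y'\<close> satisfies.\<close>

lemma graded_W: "graded (- 1) w W"
proof -
  define W' where "W' = lift four_X * W"
  define S where "S = lift four_X * fps_const (exp_uv 1 1) * W1 - W'"
  have shift: "shifted W' (lift four_X * fps_const (exp_uv 1 1) * W1)"
    unfolding W'_def by (intro shifted_mult four_X_shifted W_shifted)
  have M: "graded 0 unit_at ((1 - Y)\<^sup>2)"
    using graded_mult[OF graded_1_minus_Y graded_1_minus_Y]
    by (simp add: graded_def conv_unit power2_eq_square)
  have LW: "L * W = Q + (1 - Y)\<^sup>2 * S"
  proof -
    have "fps_X * fps_const (exp_uv 1 1) * D0\<^sup>2 * W1 = fps_const (exp_uv 1 1) * W1 * (fps_X * D0\<^sup>2)"
      by (simp only: mult_ac)
    then have "W = Q + fps_const (exp_uv 1 1) * W1 * (lift four_X * (1 - Y)\<^sup>2)"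
      using W_rec unfolding X_D0_square Q_def by metis
    then have "W - lift four_X * (1 - Y)\<^sup>2 * W = Q + (1 - Y)\<^sup>2 * S"
      by (simp add: S_def W'_def algebra_simps)
    then show ?thesis
      unfolding L_def X_D0_square by (simp add: algebra_simps)
  qed
  have "lead (4 * int a + 3 * int b - (0 - 1)) (w a b) (cf W a b)" for a b
  proof (induction "2 * a + b" arbitrary: a b rule: less_induct)
    case less
    have "lead (4 * int i + 3 * int j - 0) (drift (- 1) w i j) (cf S i j)" if "i \<le> a" "j \<le> b" for i j
    proof -
      have "lead (4 * int i + 3 * int j - (- 1) - 1) (drift (- 1) w i j)
         (cf (lift four_X * fps_const (exp_uv 1 1) * W1) i j - cf W' i j)"
      proof (rule shifted_lead[OF shift])
        fix i' j' assume "2 * i' + j' < 2 * i + j"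
        then have "2 * i' + j' < 2 * a + b" using that by linarith
        from lead_mult[OF lead_four_X less[OF this]]
        show "lead (4 * int i' + 3 * int j' - - 1) (w i' j') (cf W' i' j')"
          by (simp add: W'_def cf_lift_mult)
      qed
      then show ?thesis by (simp add: S_def cf_diff)
    qed
    then have "lead (4 * int a + 3 * int b - (0 + 0)) (conv unit_at (drift (- 1) w) a b) (cf ((1 - Y)\<^sup>2 * S) a b)"
      by (intro lead_conv gradedD[OF M])
    then have N: "lead (4 * int a + 3 * int b - 0) (2 * unit_at a b + drift (- 1) w a b) (cf (L * W) a b)"
      unfolding LW cf_add by (intro lead_add gradedD[OF graded_Q]) (simp add: conv_unit)
    have "2 * unit_at a b + drift (- 1) w a b = conv (\<lambda>a b. 2 * y a b) w a b"
    proof -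
      have "conv (\<lambda>a b. 2 * y a b) w a b = 2 * conv y w a b"
        by (simp add: conv_def sum_distrib_left case_prod_unfold mult.assoc)
      then show ?thesis
        using w_rec[of a b] by (cases "(a, b) = (0, 0)") (auto simp: unit_at_def drift_def y_00 w_def)
    qed
    with N have N': "lead (4 * int a + 3 * int b - 0) (conv (\<lambda>a b. 2 * y a b) w a b) (cf (L * W) a b)"
      by (simp only:)
    show ?case
      by (rule lead_divide[OF graded_L _ Linv lead_Linv N' less]) (simp_all add: y_00)
  qed
  then show ?thesis by (simp add: graded_def)
qed

text \<open>Both \<open>X D0' = - 2 X Y'\<close> and \<open>W\<close> contribute the leading part \<open>- 2 X Y'\<close> to the numerator, and the denominator
is \<open>2Y\<close> to leading order.\<close>

theorem graded_quotient:
  assumes "L * Z = D0 + fps_XD D0 + W"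
  shows "graded (- 2) z Z"
proof -
  have "graded (- 1) (\<lambda>_ _. 0) D0"
    by (rule graded_weaken[OF graded_D0]) simp
  moreover have "graded (- 1) w (fps_XD D0)"
  proof -
    have "fps_XD D0 = 0 - fps_XD Y - fps_XD Y"
      by (subst D0_Y[symmetric]) (simp add: fps_XD_def algebra_simps)
    moreover have "graded (- 1) (\<lambda>_ _. 0) 0"
      by (simp add: graded_def)
    then have "graded (- 1) (\<lambda>a b. 0 - (4 * real a + 3 * real b - of_int 1) / 2 * y a b
        - (4 * real a + 3 * real b - of_int 1) / 2 * y a b) (0 - fps_XD Y - fps_XD Y)"
      using graded_XD[OF graded_Y] by (intro graded_diff) simp_all
    moreover have "0 - (4 * real a + 3 * real b - of_int 1) / 2 * y a b
        - (4 * real a + 3 * real b - of_int 1) / 2 * y a b = w a b" for a b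
      by (simp add: w_def field_simps)
    ultimately show ?thesis by simp
  qed
  ultimately have N: "graded (- 1) (\<lambda>a b. 0 + w a b + w a b) (L * Z)"
    unfolding assms by (intro graded_add graded_W)
  have conv: "conv (\<lambda>a b. 2 * y a b) z a b = 0 + w a b + w a b" for a b
  proof -
    have "conv (\<lambda>a b. 2 * y a b) z a b = 2 * conv y z a b"
      by (simp add: conv_def sum_distrib_left case_prod_unfold mult.assoc)
    then show ?thesis
      by (simp add: z_rec w_def)
  qed
  have "lead (4 * int a + 3 * int b - (- 1 - 1)) (z a b) (cf Z a b)" for a b
  proof (induction "2 * a + b" arbitrary: a b rule: less_induct)
    case less
    have N': "lead (4 * int a + 3 * int b - - 1) (conv (\<lambda>a b. 2 * y a b) z a b) (cf (L * Z) a b)"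
      unfolding conv by (rule gradedD[OF N])
    show ?case
      by (rule lead_divide[OF graded_L _ Linv lead_Linv N' less]) (simp_all add: y_00)
  qed
  then show ?thesis by (simp add: graded_def)
qed

end

section \<open>Generating functions of runs and walks\<close>

declare sum.cl_ivl_Suc [simp del]

text \<open>The total weight of the sequences of \<open>k\<close> positive heights that continue a height \<open>g\<close>: each height exceeds
its predecessor by at most 1. In a height function these are consecutive heights of one parity class.\<close>

fun run_sum :: "(nat \<Rightarrow> 'k::comm_ring_1) \<Rightarrow> nat \<Rightarrow> nat \<Rightarrow> 'k" where
  "run_sum \<alpha> 0 g = 1"
| "run_sum \<alpha> (Suc k) g = (\<Sum>c=1..g+1. \<alpha> c * run_sum \<alpha> k c)"

text \<open>The same for sequences that end in the height \<open>b\<close>, where the empty sequence ends in \<open>g\<close>.\<close>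

fun run_to_sum :: "(nat \<Rightarrow> 'k::comm_ring_1) \<Rightarrow> nat \<Rightarrow> nat \<Rightarrow> nat \<Rightarrow> 'k" where
  "run_to_sum \<alpha> b 0 g = (if g = b then 1 else 0)"
| "run_to_sum \<alpha> b (Suc k) g = (\<Sum>c=1..g+1. \<alpha> c * run_to_sum \<alpha> b k c)"

text \<open>The total weight of the ways to read \<open>m\<close> further values of a height function when the last value read
is 0 and the one before it is \<open>g\<close>, such that finally the last value is 0 and the one before it is \<open>b\<close>. Either
the next value is 0, or it is some \<open>c \<le> g + 1\<close> and has to be followed by another 0.\<close>

fun walk_sum :: "(nat \<Rightarrow> 'k::comm_ring_1) \<Rightarrow> nat \<Rightarrow> nat \<Rightarrow> nat \<Rightarrow> 'k" where
  "walk_sum \<alpha> b 0 g = (if g = b then 1 else 0)"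
| "walk_sum \<alpha> b (Suc 0) g = (if b = 0 then 1 else 0)"
| "walk_sum \<alpha> b (Suc (Suc m)) g = walk_sum \<alpha> b (Suc m) 0 + (\<Sum>c=1..g+1. \<alpha> c * walk_sum \<alpha> b m c)"

definition run_gf :: "(nat \<Rightarrow> 'k::comm_ring_1) \<Rightarrow> nat \<Rightarrow> 'k fps" where
  "run_gf \<alpha> g = Abs_fps (\<lambda>k. run_sum \<alpha> k g)"

definition run_to_gf :: "(nat \<Rightarrow> 'k::comm_ring_1) \<Rightarrow> nat \<Rightarrow> nat \<Rightarrow> 'k fps" where
  "run_to_gf \<alpha> b g = Abs_fps (\<lambda>k. run_to_sum \<alpha> b k g)"

definition even_gf :: "(nat \<Rightarrow> 'k::comm_ring_1) \<Rightarrow> nat \<Rightarrow> nat \<Rightarrow> 'k fps" where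
  "even_gf \<alpha> b g = Abs_fps (\<lambda>k. walk_sum \<alpha> b (2 * k) g)"

definition odd_gf :: "(nat \<Rightarrow> 'k::comm_ring_1) \<Rightarrow> nat \<Rightarrow> nat \<Rightarrow> 'k fps" where
  "odd_gf \<alpha> b g = Abs_fps (\<lambda>k. walk_sum \<alpha> b (2 * k + 1) g)"

abbreviation step :: "(nat \<Rightarrow> 'k::comm_ring_1) \<Rightarrow> (nat \<Rightarrow> 'k fps) \<Rightarrow> nat \<Rightarrow> 'k fps" where
  "step \<alpha> F g \<equiv> fps_X * (\<Sum>c=1..g+1. fps_const (\<alpha> c) * F c)"

lemma step_nth: "step \<alpha> F g $ k = (if k = 0 then 0 else \<Sum>c=1..g+1. \<alpha> c * F c $ (k - 1))"
  by (simp add: fps_sum_nth)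

text \<open>The factor \<open>X\<close> makes the system contractive in the \<open>X\<close>-adic sense.\<close>

lemma level_system_unique:
  assumes "\<And>g. F g = P g + step \<alpha> F g" "\<And>g. G g = P g + step \<alpha> G g"
  shows "F g = G g"
proof -
  have "F g $ k = G g $ k" for k g
  proof (induction k arbitrary: g)
    case 0
    show ?case by (subst assms(1), subst assms(2)) simp
  next
    case (Suc k)
    show ?case
      by (subst assms(1), subst assms(2)) (simp only: fps_add_nth step_nth Suc diff_Suc_1)
  qed
  then show ?thesis by (simp add: fps_eq_iff)
qed

lemma run_gf_rec: "run_gf \<alpha> g = 1 + step \<alpha> (run_gf \<alpha>) g"
proof (rule fps_ext)
  fix k show "run_gf \<alpha> g $ k = (1 + step \<alpha> (run_gf \<alpha>) g) $ k"
    by (cases k) (simp_all add: run_gf_def fps_sum_nth)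
qed

lemma run_to_gf_rec: "run_to_gf \<alpha> b g = (if g = b then 1 else 0) + step \<alpha> (run_to_gf \<alpha> b) g"
proof (rule fps_ext)
  fix k show "run_to_gf \<alpha> b g $ k = ((if g = b then 1 else 0) + step \<alpha> (run_to_gf \<alpha> b) g) $ k"
    by (cases k) (simp_all add: run_to_gf_def fps_sum_nth)
qed

lemma even_gf_rec:
  "even_gf \<alpha> b g = (if g = b then 1 else 0) + fps_X * odd_gf \<alpha> b 0 + step \<alpha> (even_gf \<alpha> b) g"
proof (rule fps_ext)
  fix k
  show "even_gf \<alpha> b g $ k = ((if g = b then 1 else 0) + fps_X * odd_gf \<alpha> b 0 + step \<alpha> (even_gf \<alpha> b) g) $ k"
    by (cases k) (simp_all add: even_gf_def odd_gf_def fps_sum_nth)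
qed

lemma odd_gf_rec: "odd_gf \<alpha> b g = even_gf \<alpha> b 0 + step \<alpha> (odd_gf \<alpha> b) g"
proof (rule fps_ext)
  fix k
  show "odd_gf \<alpha> b g $ k = (even_gf \<alpha> b 0 + step \<alpha> (odd_gf \<alpha> b) g) $ k"
    by (cases k) (auto simp: even_gf_def odd_gf_def fps_sum_nth)
qed

lemma step_mult: "step \<alpha> (\<lambda>c. F c * H) g = step \<alpha> F g * H"
  by (simp add: sum_distrib_right mult.assoc)

lemma step_add: "step \<alpha> (\<lambda>c. F c + H c) g = step \<alpha> F g + step \<alpha> H g"
  by (simp add: sum.distrib distrib_left)

text \<open>A walk of odd length must at some point read two zeros in a row; before the first such point
it is a run.\<close>

lemma odd_gf_even: "odd_gf \<alpha> b g = run_gf \<alpha> g * even_gf \<alpha> b 0"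
proof (rule level_system_unique[OF odd_gf_rec])
  fix g
  show "run_gf \<alpha> g * even_gf \<alpha> b 0 = even_gf \<alpha> b 0 + step \<alpha> (\<lambda>g. run_gf \<alpha> g * even_gf \<alpha> b 0) g"
    unfolding step_mult by (subst run_gf_rec) (simp add: distrib_right)
qed

lemma even_gf_odd: "even_gf \<alpha> b g = run_to_gf \<alpha> b g + run_gf \<alpha> g * (fps_X * odd_gf \<alpha> b 0)"
proof (rule level_system_unique[OF even_gf_rec])
  fix g
  show "run_to_gf \<alpha> b g + run_gf \<alpha> g * (fps_X * odd_gf \<alpha> b 0) = (if g = b then 1 else 0) + fps_X * odd_gf \<alpha> b 0
     + step \<alpha> (\<lambda>g. run_to_gf \<alpha> b g + run_gf \<alpha> g * (fps_X * odd_gf \<alpha> b 0)) g"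
    unfolding step_mult step_add
    by (subst run_to_gf_rec, subst run_gf_rec) (simp add: distrib_right)
qed

text \<open>A walk of odd length splits at the first and at the last point at which two zeros in a row are
read. Between these points there is an even number of runs from the height 0, each closed by another
such point.\<close>

lemma odd_gf_closed: "(1 - fps_X * (run_gf \<alpha> 0)\<^sup>2) * odd_gf \<alpha> b g = run_gf \<alpha> g * run_to_gf \<alpha> b 0"
proof -
  have "even_gf \<alpha> b 0 = run_to_gf \<alpha> b 0 + run_gf \<alpha> 0 * (fps_X * (run_gf \<alpha> 0 * even_gf \<alpha> b 0))"
    using even_gf_odd[of \<alpha> b 0] odd_gf_even[of \<alpha> b 0] by simp
  then have "(1 - fps_X * (run_gf \<alpha> 0)\<^sup>2) * even_gf \<alpha> b 0 = run_to_gf \<alpha> b 0"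
    by (simp add: algebra_simps power2_eq_square)
  then show ?thesis
    unfolding odd_gf_even by (metis mult.assoc mult.commute)
qed

lemma run_to_sum_eq_0: "b > g + k \<Longrightarrow> run_to_sum \<alpha> b k g = 0"
  by (induction k arbitrary: g) (auto intro!: sum.neutral)

text \<open>Cutting a run at a fixed position and summing over the height there gives back the whole run.\<close>

lemma run_sum_split:
  assumes "g + l \<le> N"
  shows "(\<Sum>b\<le>N. run_to_sum \<alpha> b l g * run_sum \<alpha> k b) = run_sum \<alpha> (l + k) g"
  using assms
proof (induction l arbitrary: g)
  case 0
  have "(\<Sum>b\<le>N. run_to_sum \<alpha> b 0 g * run_sum \<alpha> k b) = (\<Sum>b\<le>N. if g = b then run_sum \<alpha> k b else 0)"
    by (rule sum.cong) auto
  then show ?case using 0 by simp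
next
  case (Suc l)
  have "(\<Sum>b\<le>N. run_to_sum \<alpha> b (Suc l) g * run_sum \<alpha> k b)
    = (\<Sum>b\<le>N. \<Sum>c=1..g+1. \<alpha> c * (run_to_sum \<alpha> b l c * run_sum \<alpha> k b))"
    by (simp add: sum_distrib_right mult.assoc)
  also have "\<dots> = (\<Sum>c=1..g+1. \<Sum>b\<le>N. \<alpha> c * (run_to_sum \<alpha> b l c * run_sum \<alpha> k b))"
    by (rule sum.swap)
  also have "\<dots> = (\<Sum>c=1..g+1. \<alpha> c * run_sum \<alpha> (l + k) c)"
  proof (rule sum.cong[OF refl])
    fix c assume "c \<in> {1..g+1}"
    then have "c + l \<le> N" using Suc.prems by auto
    then show "(\<Sum>b\<le>N. \<alpha> c * (run_to_sum \<alpha> b l c * run_sum \<alpha> k b)) = \<alpha> c * run_sum \<alpha> (l + k) c"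
      using Suc.IH by (simp flip: sum_distrib_left)
  qed
  finally show ?case by simp
qed

lemma sum_run_gf_split:
  assumes "n \<le> N"
  shows "(\<Sum>b\<le>N. run_gf \<alpha> b * run_to_gf \<alpha> b 0) $ n = of_nat (n + 1) * run_gf \<alpha> 0 $ n"
proof -
  have "(\<Sum>b\<le>N. run_gf \<alpha> b * run_to_gf \<alpha> b 0) $ n
     = (\<Sum>b\<le>N. \<Sum>l=0..n. run_to_sum \<alpha> b l 0 * run_sum \<alpha> (n - l) b)"
    by (simp add: fps_sum_nth mult.commute[of "run_gf _ _"]) (simp add: fps_mult_nth run_gf_def run_to_gf_def)
  also have "\<dots> = (\<Sum>l=0..n. \<Sum>b\<le>N. run_to_sum \<alpha> b l 0 * run_sum \<alpha> (n - l) b)"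
    by (rule sum.swap)
  also have "\<dots> = (\<Sum>l=0..n. run_sum \<alpha> n 0)"
    using assms by (intro sum.cong) (simp_all add: run_sum_split)
  finally show ?thesis by (simp add: run_gf_def)
qed

text \<open>A run cut at a height \<open>b\<close> whose second part starts with \<open>b + 2\<close>, one more than an ordinary step allows.\<close>

definition jump_term :: "(nat \<Rightarrow> 'k::comm_ring_1) \<Rightarrow> nat \<Rightarrow> 'k fps" where
  "jump_term \<alpha> b = fps_X * fps_const (\<alpha> (b + 2)) * run_gf \<alpha> (b + 2) * run_to_gf \<alpha> b 0"

text \<open>The sum of all jump terms; only those with \<open>b < n\<close> contribute to the coefficient of \<open>X\<^sup>n\<close>.\<close>

definition jump_gf :: "(nat \<Rightarrow> 'k::comm_ring_1) \<Rightarrow> 'k fps" where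
  "jump_gf \<alpha> = Abs_fps (\<lambda>n. (\<Sum>b\<le>n. jump_term \<alpha> b) $ n)"

lemma jump_term_nth_eq_0: "n \<le> b \<Longrightarrow> jump_term \<alpha> b $ n = 0"
  unfolding jump_term_def mult.assoc
  by (auto simp: fps_mult_nth run_to_gf_def run_to_sum_eq_0 mult.assoc intro!: sum.neutral)

lemma jump_gf_nth:
  assumes "n \<le> N"
  shows "jump_gf \<alpha> $ n = (\<Sum>b\<le>N. jump_term \<alpha> b) $ n"
proof -
  have "(\<Sum>b\<le>N. jump_term \<alpha> b $ n) = (\<Sum>b\<le>n. jump_term \<alpha> b $ n)"
    by (rule sum.mono_neutral_right) (use assms in \<open>auto simp: jump_term_nth_eq_0\<close>)
  then show ?thesis by (simp add: jump_gf_def fps_sum_nth)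
qed

definition up :: "(nat \<Rightarrow> 'k) \<Rightarrow> nat \<Rightarrow> 'k" where
  "up \<alpha> c = \<alpha> (Suc c)"

lemma step_Suc:
  "step \<alpha> F (Suc g) = fps_X * fps_const (\<alpha> 1) * F 1 + step (up \<alpha>) (\<lambda>c. F (Suc c)) g"
proof -
  have "(\<Sum>c=1..Suc g + 1. fps_const (\<alpha> c) * F c)
    = fps_const (\<alpha> 1) * F 1 + (\<Sum>c=Suc 1..Suc (g + 1). fps_const (\<alpha> c) * F c)"
    by (subst sum.atLeast_Suc_atMost) auto
  also have "(\<Sum>c=Suc 1..Suc (g + 1). fps_const (\<alpha> c) * F c) = (\<Sum>c=1..g+1. fps_const (\<alpha> (Suc c)) * F (Suc c))"
    by (rule sum.shift_bounds_cl_Suc_ivl)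
  finally show ?thesis
    by (simp add: up_def distrib_left mult.assoc)
qed

lemma step_0: "step \<alpha> F 0 = fps_X * fps_const (\<alpha> 1) * F 1"
  by (simp add: mult.assoc)

text \<open>A run from \<open>g + 1\<close> splits at the first place where it continues a run from 0; before that place all heights
are at least 2 and can be lowered by one.\<close>

lemma run_gf_Suc: "run_gf \<alpha> (Suc g) = run_gf \<alpha> 0 * run_gf (up \<alpha>) g"
proof -
  have A: "run_gf \<alpha> (Suc g) = run_gf \<alpha> 0 + step (up \<alpha>) (\<lambda>c. run_gf \<alpha> (Suc c)) g" for g
    by (subst run_gf_rec, subst step_Suc, subst (2) run_gf_rec, subst step_0) (simp add: add.assoc)
  have B: "run_gf \<alpha> 0 * run_gf (up \<alpha>) g = run_gf \<alpha> 0 + step (up \<alpha>) (\<lambda>c. run_gf \<alpha> 0 * run_gf (up \<alpha>) c) g" for g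
    unfolding mult.commute[of "run_gf \<alpha> 0"] step_mult by (subst run_gf_rec) (simp add: distrib_right)
  show ?thesis
    by (rule level_system_unique[OF A B])
qed

lemma run_to_gf_Suc_Suc:
  "run_to_gf \<alpha> (Suc b) (Suc g) = run_to_gf (up \<alpha>) b g + run_gf (up \<alpha>) g * run_to_gf \<alpha> (Suc b) 0"
proof -
  let ?u = "run_to_gf \<alpha> (Suc b) 0"
  have A: "run_to_gf \<alpha> (Suc b) (Suc g) = ((if g = b then 1 else 0) + ?u)
      + step (up \<alpha>) (\<lambda>c. run_to_gf \<alpha> (Suc b) (Suc c)) g" for g
    by (subst run_to_gf_rec, subst step_Suc, subst (2) run_to_gf_rec, subst step_0) (simp add: add.assoc)
  have B: "run_to_gf (up \<alpha>) b g + run_gf (up \<alpha>) g * ?u = ((if g = b then 1 else 0) + ?u)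
      + step (up \<alpha>) (\<lambda>g. run_to_gf (up \<alpha>) b g + run_gf (up \<alpha>) g * ?u) g" for g
    unfolding step_mult step_add
    by (subst run_to_gf_rec, subst run_gf_rec) (simp add: distrib_right)
  show ?thesis
    by (rule level_system_unique[OF A B])
qed

lemma run_gf_0_rec: "run_gf \<alpha> 0 = 1 + fps_X * fps_const (\<alpha> 1) * run_gf \<alpha> 0 * run_gf (up \<alpha>) 0"
  using run_gf_rec[of \<alpha> 0] run_gf_Suc[of \<alpha> 0] by (simp add: mult.assoc)

lemma run_to_gf_Suc_0:
  "run_to_gf \<alpha> (Suc b) 0 = fps_X * fps_const (\<alpha> 1) * run_gf \<alpha> 0 * run_to_gf (up \<alpha>) b 0"
proof -
  let ?u = "run_to_gf \<alpha> (Suc b) 0" and ?x = "fps_X * fps_const (\<alpha> 1)"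
  let ?A = "run_gf \<alpha> 0" and ?B = "run_gf (up \<alpha>) 0" and ?v = "run_to_gf (up \<alpha>) b 0"
  have "?u = ?x * (?v + ?B * ?u)"
    using run_to_gf_rec[of \<alpha> "Suc b" 0] run_to_gf_Suc_Suc[of \<alpha> b 0] by (simp add: mult.assoc)
  from arg_cong[OF this, of "\<lambda>t. ?A * t"]
  have "?A * ?u = ?A * (?x * (?v + ?B * ?u))" .
  also have "\<dots> = ?x * ?A * ?v + (?x * ?A * ?B) * ?u"
    by (simp add: distrib_left mult_ac)
  also have "?x * ?A * ?B = ?A - 1"
    using run_gf_0_rec[of \<alpha>] by (metis add_diff_cancel_left')
  finally have h: "?A * ?u = ?x * ?A * ?v + (?A - 1) * ?u" .
  have "?u = ?A * ?u - (?A - 1) * ?u"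
    by (simp add: left_diff_distrib)
  also have "\<dots> = ?x * ?A * ?v"
    by (subst h) simp
  finally show ?thesis .
qed

text \<open>The jump starts either at the height 0, or inside an arch above the height 1, where all heights
can be lowered by one.\<close>

lemma jump_gf_rec:
  "jump_gf \<alpha> = fps_X * fps_const (\<alpha> 2) * run_gf (up (up \<alpha>)) 0 * run_gf (up \<alpha>) 0 * run_gf \<alpha> 0
     + fps_X * fps_const (\<alpha> 1) * (run_gf \<alpha> 0)\<^sup>2 * jump_gf (up \<alpha>)" (is "_ = ?P + ?C * _")
proof (rule fps_ext)
  fix n
  have b0: "jump_term \<alpha> 0 = ?P"
  proof -
    have "run_to_gf \<alpha> 0 0 = 1"
    proof -
      have "run_to_sum \<alpha> 0 k c = 0" if "c > 0" for k c
        using that by (induction k arbitrary: c) (auto intro!: sum.neutral)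
      then have "run_to_sum \<alpha> 0 k 0 = (if k = 0 then 1 else 0)" for k
        by (cases k) auto
      then show ?thesis by (simp add: run_to_gf_def fps_eq_iff)
    qed
    moreover have "run_gf \<alpha> 2 = run_gf \<alpha> 0 * run_gf (up \<alpha>) 0 * run_gf (up (up \<alpha>)) 0"
      by (simp add: numeral_2_eq_2 run_gf_Suc mult.assoc)
    ultimately show ?thesis
      by (simp add: jump_term_def mult_ac numeral_2_eq_2)
  qed
  have bS: "jump_term \<alpha> (Suc b) = ?C * jump_term (up \<alpha>) b" for b
  proof -
    have "run_gf \<alpha> (Suc b + 2) = run_gf \<alpha> 0 * run_gf (up \<alpha>) (b + 2)"
      using run_gf_Suc[of \<alpha> "b + 2"] by simp
    then show ?thesis
      unfolding jump_term_def run_to_gf_Suc_0 by (simp add: up_def power2_eq_square mult_ac)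
  qed
  have "jump_gf \<alpha> $ n = (\<Sum>b\<le>Suc n. jump_term \<alpha> b) $ n"
    by (rule jump_gf_nth) simp
  also have "(\<Sum>b\<le>Suc n. jump_term \<alpha> b) = ?P + ?C * (\<Sum>b\<le>n. jump_term (up \<alpha>) b)"
    by (simp only: sum.atMost_Suc_shift b0 bS sum_distrib_left)
  also have "(?P + ?C * (\<Sum>b\<le>n. jump_term (up \<alpha>) b)) $ n = (?P + ?C * jump_gf (up \<alpha>)) $ n"
  proof -
    have "(?C * (\<Sum>b\<le>n. jump_term (up \<alpha>) b)) $ n = (?C * jump_gf (up \<alpha>)) $ n"
      unfolding fps_mult_nth[of ?C] by (rule sum.cong) (simp_all add: jump_gf_nth[of _ n])
    then show ?thesis by simp
  qed
  finally show "jump_gf \<alpha> $ n = (?P + ?C * jump_gf (up \<alpha>)) $ n" .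
qed

text \<open>Closed walks: the walk ends in the height \<open>b\<close>, and may begin with a height up to \<open>b + 2\<close>, which is why it
starts as if the height before were \<open>b + 1\<close>.\<close>

definition config_sum :: "(nat \<Rightarrow> 'k::comm_ring_1) \<Rightarrow> nat \<Rightarrow> 'k" where
  "config_sum \<alpha> n = (\<Sum>b\<le>n. walk_sum \<alpha> b (2 * n + 1) (Suc b))"

lemma run_gf_Suc_diff: "run_gf \<alpha> (Suc b) = run_gf \<alpha> b + fps_X * fps_const (\<alpha> (b + 2)) * run_gf \<alpha> (b + 2)"
  by (subst (1 2) run_gf_rec) (simp add: sum.cl_ivl_Suc distrib_left mult.assoc)

text \<open>An ordinary closed walk is a cyclic sequence of runs with a marked cut in the run that covers the
origin. A run of length \<open>k\<close> can be cut in \<open>k + 1\<close> places, which gives \<open>D0 + X D0'\<close>; the jumps add \<open>jump_gf\<close>.\<close>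

lemma config_gf:
  "(1 - fps_X * (run_gf \<alpha> 0)\<^sup>2) * Abs_fps (config_sum \<alpha>)
     = run_gf \<alpha> 0 + fps_XD (run_gf \<alpha> 0) + jump_gf \<alpha>" (is "?L * _ = _")
proof (rule fps_ext)
  fix n
  define G where "G = (\<lambda>b. odd_gf \<alpha> b (Suc b))"
  have LG: "?L * G b = run_gf \<alpha> b * run_to_gf \<alpha> b 0 + jump_term \<alpha> b" for b
    unfolding G_def odd_gf_closed run_gf_Suc_diff by (simp add: jump_term_def distrib_right)
  have G_nth: "G b $ i = walk_sum \<alpha> b (2 * i + 1) (Suc b)" for b i
    by (simp add: G_def odd_gf_def)
  have G_0: "G b $ i = 0" if "i < b" for b i
    using that
  proof (induction i rule: less_induct)
    case (less i)
    have "(?L * G b) $ i = 0"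
      unfolding LG using less.prems
      by (auto simp: jump_term_nth_eq_0 fps_mult_nth run_to_gf_def run_to_sum_eq_0 intro!: sum.neutral)
    moreover have "(fps_X * (run_gf \<alpha> 0)\<^sup>2 * G b) $ i = 0"
      using less by (auto simp: mult.assoc fps_mult_nth[of "(run_gf \<alpha> 0)\<^sup>2"] intro!: sum.neutral)
    ultimately show ?case
      by (simp add: left_diff_distrib)
  qed
  have "Abs_fps (config_sum \<alpha>) $ i = (\<Sum>b\<le>n. G b) $ i" if "i \<le> n" for i
  proof -
    have "(\<Sum>b\<le>n. G b $ i) = (\<Sum>b\<le>i. G b $ i)"
      by (rule sum.mono_neutral_right) (use that in \<open>auto simp: G_0\<close>)
    then show ?thesis
      by (simp add: fps_sum_nth config_sum_def G_nth)
  qed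
  then have "(?L * Abs_fps (config_sum \<alpha>)) $ n = (?L * (\<Sum>b\<le>n. G b)) $ n"
    unfolding fps_mult_nth by (intro sum.cong) simp_all
  also have "?L * (\<Sum>b\<le>n. G b) = (\<Sum>b\<le>n. run_gf \<alpha> b * run_to_gf \<alpha> b 0) + (\<Sum>b\<le>n. jump_term \<alpha> b)"
    by (simp only: sum_distrib_left LG sum.distrib)
  also have "\<dots> $ n = of_nat (n + 1) * run_gf \<alpha> 0 $ n + jump_gf \<alpha> $ n"
    using sum_run_gf_split[of n n \<alpha>] jump_gf_nth[of n n \<alpha>] by simp
  also have "\<dots> = (run_gf \<alpha> 0 + fps_XD (run_gf \<alpha> 0) + jump_gf \<alpha>) $ n"
    by (simp add: XD_nth algebra_simps)
  finally show "(?L * Abs_fps (config_sum \<alpha>)) $ n = (run_gf \<alpha> 0 + fps_XD (run_gf \<alpha> 0) + jump_gf \<alpha>) $ n" .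
qed

lemma shift_pair_run_sum:
  assumes "\<And>c. shift_pair 1 (\<alpha> c) (up \<alpha> c)"
  shows "shift_pair k (run_sum \<alpha> k g) (run_sum (up \<alpha>) k g)"
proof (induction k arbitrary: g)
  case 0
  show ?case using shift_pair_exp_uv[of 0 0 0] by simp
next
  case (Suc k)
  show ?case
    using shift_pair_mult[OF assms Suc] by (auto intro!: shift_pair_sum)
qed

lemma shift_pair_run_to_sum:
  assumes "\<And>c. shift_pair 1 (\<alpha> c) (up \<alpha> c)"
  shows "shift_pair k (run_to_sum \<alpha> b k g) (run_to_sum (up \<alpha>) b k g)"
proof (induction k arbitrary: g)
  case 0
  show ?case using shift_pair_exp_uv[of 0 0 0] by simp
next
  case (Suc k)
  show ?case
    using shift_pair_mult[OF assms Suc] by (auto intro!: shift_pair_sum)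
qed

lemma shifted_run_gf:
  assumes "\<And>c. shift_pair 1 (\<alpha> c) (up \<alpha> c)"
  shows "shifted (run_gf \<alpha> g) (run_gf (up \<alpha>) g)"
  using shift_pair_run_sum[OF assms] by (simp add: shifted_def run_gf_def)

lemma shifted_jump_gf:
  assumes "\<And>c. shift_pair 1 (\<alpha> c) (up \<alpha> c)"
  shows "shifted (jump_gf \<alpha>) (jump_gf (up \<alpha>))"
proof -
  have "shifted (jump_term \<alpha> b) (jump_term (up \<alpha>) b)" for b
  proof -
    have "shifted (run_to_gf \<alpha> b 0) (run_to_gf (up \<alpha>) b 0)"
      using shift_pair_run_to_sum[OF assms] by (simp add: shifted_def run_to_gf_def)
    moreover have "shifted (fps_X * fps_const (\<alpha> (b + 2))) (fps_X * fps_const (up \<alpha> (b + 2)))"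
      using assms[of "b + 2"] by (simp add: shifted_def fps_X_def)
    ultimately show ?thesis
      unfolding jump_term_def
      by (intro shifted_mult[OF _ \<open>shifted (run_to_gf _ _ _) _\<close>] shifted_mult[OF _ shifted_run_gf] assms)
  qed
  then show ?thesis
    by (auto simp: shifted_def jump_gf_def fps_sum_nth intro!: shift_pair_sum)
qed

section \<open>Height functions as closed walks\<close>

fun walk :: "nat \<Rightarrow> nat list \<Rightarrow> bool" where
  "walk g [] = True"
| "walk g [x] = (x = 0)"
| "walk g (x # y # L) = (if x = 0 then walk 0 (y # L) else x \<le> g + 1 \<and> y = 0 \<and> walk x L)"

text \<open>The height before the final 0 of a walk that starts from the height \<open>g\<close>.\<close>

fun end_level :: "nat \<Rightarrow> nat list \<Rightarrow> nat" where
  "end_level g [] = g"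
| "end_level g [x] = 0"
| "end_level g (x # y # L) = (if x = 0 then end_level 0 (y # L) else end_level x L)"

definition walks :: "nat \<Rightarrow> nat \<Rightarrow> nat \<Rightarrow> nat list set" where
  "walks b m g = {L. length L = m \<and> walk g L \<and> end_level g L = b}"

lemma walks_0: "walks b 0 g = (if g = b then {[]} else {})"
  by (auto simp: walks_def)

lemma walks_1: "walks b (Suc 0) g = (if b = 0 then {[0]} else {})"
proof -
  have "L \<in> walks b (Suc 0) g \<longleftrightarrow> L \<in> (if b = 0 then {[0]} else {})" for L
    by (cases L) (auto simp: walks_def)
  then show ?thesis by blast
qed

lemma walks_Suc_Suc:
  "walks b (Suc (Suc m)) g = (#) 0 ` walks b (Suc m) 0 \<union> (\<Union>c\<in>{1..g+1}. (\<lambda>L. c # 0 # L) ` walks b m c)"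
proof (intro equalityI subsetI)
  fix L assume L: "L \<in> walks b (Suc (Suc m)) g"
  then obtain x y L' where xy: "L = x # y # L'"
    by (auto simp: walks_def length_Suc_conv)
  show "L \<in> (#) 0 ` walks b (Suc m) 0 \<union> (\<Union>c\<in>{1..g+1}. (\<lambda>L. c # 0 # L) ` walks b m c)"
    using L by (cases "x = 0") (auto simp: xy walks_def)
next
  fix L assume "L \<in> (#) 0 ` walks b (Suc m) 0 \<union> (\<Union>c\<in>{1..g+1}. (\<lambda>L. c # 0 # L) ` walks b m c)"
  then consider L' where "L = 0 # L'" "L' \<in> walks b (Suc m) 0"
    | c L' where "L = c # 0 # L'" "c \<in> {1..g+1}" "L' \<in> walks b m c"
    by auto
  then show "L \<in> walks b (Suc (Suc m)) g"
  proof cases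
    case 1
    then obtain x L'' where "L' = x # L''"
      by (auto simp: walks_def length_Suc_conv)
    with 1 show ?thesis by (auto simp: walks_def)
  next
    case 2
    then show ?thesis by (auto simp: walks_def)
  qed
qed

lemma finite_walks: "finite (walks b m g)"
  by (induction m arbitrary: g rule: induct_nat_012) (auto simp: walks_0 walks_1 walks_Suc_Suc)

lemma sum_walks:
  assumes "\<alpha> 0 = (1 :: 'k::comm_ring_1)"
  shows "(\<Sum>L\<in>walks b m g. prod_list (map \<alpha> L)) = walk_sum \<alpha> b m g"
proof (induction m arbitrary: g rule: induct_nat_012)
  case (ge2 m)
  let ?P = "\<lambda>L. prod_list (map \<alpha> L)"
  have "(\<Sum>L\<in>walks b (Suc (Suc m)) g. ?P L)
    = (\<Sum>L\<in>(#) 0 ` walks b (Suc m) 0. ?P L) + (\<Sum>L\<in>(\<Union>c\<in>{1..g+1}. (\<lambda>L. c # 0 # L) ` walks b m c). ?P L)"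
    unfolding walks_Suc_Suc by (rule sum.union_disjoint) (auto simp: finite_walks)
  also have "(\<Sum>L\<in>(#) 0 ` walks b (Suc m) 0. ?P L) = walk_sum \<alpha> b (Suc m) 0"
    by (subst sum.reindex) (auto simp: assms ge2)
  also have "(\<Sum>L\<in>(\<Union>c\<in>{1..g+1}. (\<lambda>L. c # 0 # L) ` walks b m c). ?P L)
    = (\<Sum>c=1..g+1. \<Sum>L\<in>(\<lambda>L. c # 0 # L) ` walks b m c. ?P L)"
    by (rule sum.UNION_disjoint) (auto simp: finite_walks)
  also have "\<dots> = (\<Sum>c=1..g+1. \<alpha> c * walk_sum \<alpha> b m c)"
  proof (rule sum.cong[OF refl])
    fix c
    have "(\<Sum>L\<in>(\<lambda>L. c # 0 # L) ` walks b m c. ?P L) = (\<Sum>L\<in>walks b m c. \<alpha> c * ?P L)"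
      by (subst sum.reindex) (auto simp: assms inj_on_def)
    then show "(\<Sum>L\<in>(\<lambda>L. c # 0 # L) ` walks b m c. ?P L) = \<alpha> c * walk_sum \<alpha> b m c"
      by (simp add: ge2 flip: sum_distrib_left)
  qed
  finally show ?case by simp
qed (auto simp: walks_0 walks_1 assms)

text \<open>The numbers of elements of a beta set in the residue classes modulo \<open>2n + 1\<close>, where position \<open>2n + 1\<close>
stands for residue 0 again. Subtracting \<open>2n + 3\<close> takes class \<open>r + 2\<close> to class \<open>r\<close> and lowers the quotient by 1,
but it takes class 1 to class \<open>2n\<close> and lowers the quotient by 2; hence the last condition.\<close>

definition heights :: "nat \<Rightarrow> (nat \<Rightarrow> nat) set" where
  "heights n = {h. (\<forall>r. r = 0 \<or> r > 2 * n \<longrightarrow> h r = 0) \<and> (\<forall>r<2*n. h (r + 2) \<le> h r + 1) \<and>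
     (\<forall>r. h r = 0 \<or> h (r + 1) = 0) \<and> h 1 \<le> h (2 * n) + 2}"

text \<open>The conditions on the values of \<open>h\<close> at \<open>i, ..., j - 1\<close> when the value at \<open>i - 1\<close> counts as 0 and the one at
\<open>i - 2\<close> as \<open>g\<close>.\<close>

definition steps_ok :: "(nat \<Rightarrow> nat) \<Rightarrow> nat \<Rightarrow> nat \<Rightarrow> nat \<Rightarrow> bool" where
  "steps_ok h i j g \<longleftrightarrow>
     (\<forall>r. i \<le> r \<and> r < j \<longrightarrow> h r \<le> (if r = i then g else if r = i + 1 then 0 else h (r - 2)) + 1) \<and>
     (\<forall>r. i \<le> r \<and> r + 1 < j \<longrightarrow> h r = 0 \<or> h (r + 1) = 0) \<and> (i < j \<longrightarrow> h (j - 1) = 0)"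

lemma steps_okD:
  assumes "steps_ok h i j g" "i \<le> r" "r < j"
  shows "h r \<le> (if r = i then g else if r = i + 1 then 0 else h (r - 2)) + 1"
  using assms(1)[unfolded steps_ok_def, THEN conjunct1, rule_format, of r] assms(2,3) by blast

lemma steps_okD2:
  assumes "steps_ok h i j g" "i \<le> r" "r + 1 < j"
  shows "h r = 0 \<or> h (r + 1) = 0"
  by (rule assms(1)[unfolded steps_ok_def, THEN conjunct2, THEN conjunct1, rule_format, OF conjI[OF assms(2,3)]])

lemma steps_okD3: "steps_ok h i j g \<Longrightarrow> i < j \<Longrightarrow> h (j - 1) = 0"
  unfolding steps_ok_def by blast

lemma steps_ok_zero:
  assumes "i + 2 \<le> j" "h i = 0"
  shows "steps_ok h i j g \<longleftrightarrow> steps_ok h (i + 1) j 0"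
proof
  assume A: "steps_ok h i j g"
  show "steps_ok h (i + 1) j 0"
    unfolding steps_ok_def
  proof (intro conjI allI impI)
    fix r assume r: "i + 1 \<le> r \<and> r < j"
    then show "h r \<le> (if r = i + 1 then 0 else if r = i + 1 + 1 then 0 else h (r - 2)) + 1"
      using steps_okD[OF A, of r] assms by (cases "r = i + 2") auto
  next
    fix r assume r: "i + 1 \<le> r \<and> r + 1 < j"
    show "h r = 0 \<or> h (r + 1) = 0"
      by (rule steps_okD2[OF A]) (use r in auto)
  next
    show "h (j - 1) = 0" by (rule steps_okD3[OF A]) (use assms in auto)
  qed
next
  assume A: "steps_ok h (i + 1) j 0"
  show "steps_ok h i j g"
    unfolding steps_ok_def
  proof (intro conjI allI impI)
    fix r assume r: "i \<le> r \<and> r < j"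
    have *: "i + 1 \<le> r \<Longrightarrow> h r \<le> (if r = i + 1 then 0 else if r = i + 1 + 1 then 0 else h (r - 2)) + 1"
      using steps_okD[OF A, of r] r by blast
    show "h r \<le> (if r = i then g else if r = i + 1 then 0 else h (r - 2)) + 1"
    proof -
      consider "r = i" | "r = i + 1" | "r = i + 2" | "i + 3 \<le> r" using r by linarith
      then show ?thesis
      proof cases
        case 1
        then show ?thesis using assms by simp
      next
        case 2
        then show ?thesis using * by simp
      next
        case 3
        then show ?thesis using * assms by simp
      next
        case 4
        then show ?thesis using * by simp
      qed
    qed
  next
    fix r assume r: "i \<le> r \<and> r + 1 < j"
    show "h r = 0 \<or> h (r + 1) = 0"
    proof (cases "r = i")
      case True
      then show ?thesis using assms by simp
    next
      case False
      then show ?thesis using steps_okD2[OF A, of r] r by linarith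
    qed
  next
    show "h (j - 1) = 0" by (rule steps_okD3[OF A]) (use assms in auto)
  qed
qed

lemma steps_ok_pos:
  assumes "i + 2 \<le> j" "h i > 0"
  shows "steps_ok h i j g \<longleftrightarrow> h i \<le> g + 1 \<and> h (i + 1) = 0 \<and> steps_ok h (i + 2) j (h i)"
proof
  assume A: "steps_ok h i j g"
  then have hi: "h i \<le> g + 1"
    using assms steps_okD[of h i j g i] by auto
  moreover have hi1: "h (i + 1) = 0"
  proof (cases "i + 2 = j")
    case True
    then have "j - 1 = i + 1" by simp
    then show ?thesis using steps_okD3[OF A] True by simp
  next
    case False
    then show ?thesis using steps_okD2[OF A, of i] assms by simp
  qed
  moreover have "steps_ok h (i + 2) j (h i)"
    unfolding steps_ok_def
  proof (intro conjI allI impI)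
    fix r assume r: "i + 2 \<le> r \<and> r < j"
    then have "h r \<le> h (r - 2) + 1"
      using steps_okD[OF A, of r] by auto
    then show "h r \<le> (if r = i + 2 then h i else if r = i + 2 + 1 then 0 else h (r - 2)) + 1"
      using hi1 by auto
  next
    fix r assume r: "i + 2 \<le> r \<and> r + 1 < j"
    show "h r = 0 \<or> h (r + 1) = 0"
      by (rule steps_okD2[OF A]) (use r in auto)
  next
    assume "i + 2 < j"
    then show "h (j - 1) = 0" using steps_okD3[OF A] by simp
  qed
  ultimately show "h i \<le> g + 1 \<and> h (i + 1) = 0 \<and> steps_ok h (i + 2) j (h i)" by blast
next
  assume A: "h i \<le> g + 1 \<and> h (i + 1) = 0 \<and> steps_ok h (i + 2) j (h i)"
  then have B: "steps_ok h (i + 2) j (h i)" by blast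
  show "steps_ok h i j g"
    unfolding steps_ok_def
  proof (intro conjI allI impI)
    fix r assume r: "i \<le> r \<and> r < j"
    have *: "i + 2 \<le> r \<Longrightarrow> h r \<le> (if r = i + 2 then h i else if r = i + 2 + 1 then 0 else h (r - 2)) + 1"
      using steps_okD[OF B, of r] r by blast
    show "h r \<le> (if r = i then g else if r = i + 1 then 0 else h (r - 2)) + 1"
    proof -
      consider "r = i" | "r = i + 1" | "r = i + 2" | "r = i + 3" | "i + 4 \<le> r" using r by linarith
      then show ?thesis
      proof cases
        case 1
        then show ?thesis using A by simp
      next
        case 2
        then show ?thesis using A by simp
      next
        case 3
        then show ?thesis using * by simp
      next
        case 4
        have "r - 2 = i + 1" using 4 by simp
        then show ?thesis using 4 * A by simp
      next
        case 5
        then show ?thesis using * by simp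
      qed
    qed
  next
    fix r assume r: "i \<le> r \<and> r + 1 < j"
    consider "r = i" | "r = i + 1" | "i + 2 \<le> r" using r by linarith
    then show "h r = 0 \<or> h (r + 1) = 0"
    proof cases
      case 3
      then show ?thesis using steps_okD2[OF B, of r] r by linarith
    qed (use A in simp_all)
  next
    show "h (j - 1) = 0"
    proof (cases "i + 2 = j")
      case True
      then have "j - 1 = i + 1" by simp
      then show ?thesis using A by simp
    next
      case False
      then show ?thesis using steps_okD3[OF B] assms by simp
    qed
  qed
qed

lemma map_upt_unfold:
  "i + 2 \<le> j \<Longrightarrow> map h [i..<j] = h i # h (i + 1) # map h [i+2..<j]"
  by (simp add: upt_conv_Cons)

lemma walk_map_upt:
  "i \<le> j \<Longrightarrow> walk g (map h [i..<j]) \<longleftrightarrow> steps_ok h i j g"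
proof (induction "j - i" arbitrary: i g rule: less_induct)
  case less
  consider "j = i" | "j = i + 1" | "i + 2 \<le> j" using less.prems by linarith
  then show ?case
  proof cases
    case 1
    then show ?thesis by (simp add: steps_ok_def)
  next
    case 2
    then show ?thesis by (auto simp: steps_ok_def less_Suc_eq)
  next
    case 3
    have m: "map h [i+1..<j] = h (i + 1) # map h [i+2..<j]"
      using 3 by (simp add: upt_conv_Cons)
    show ?thesis
    proof (cases "h i = 0")
      case True
      then have "walk g (map h [i..<j]) \<longleftrightarrow> walk 0 (map h [i+1..<j])"
        unfolding map_upt_unfold[OF 3] m by simp
      also have "\<dots> \<longleftrightarrow> steps_ok h (i + 1) j 0"
        using 3 by (intro less.hyps) auto
      finally show ?thesis using steps_ok_zero[of i j h g] 3 True by simp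
    next
      case False
      have "walk (h i) (map h [i+2..<j]) \<longleftrightarrow> steps_ok h (i + 2) j (h i)"
        using 3 by (intro less.hyps) auto
      then show ?thesis
        using steps_ok_pos[of i j h g] 3 False unfolding map_upt_unfold[OF 3] by simp
    qed
  qed
qed

lemma end_level_map_upt:
  assumes "i + 2 \<le> j" "steps_ok h i j g"
  shows "end_level g (map h [i..<j]) = h (j - 2)"
  using assms
proof (induction "j - i" arbitrary: i g rule: less_induct)
  case less
  have m: "map h [i+1..<j] = h (i + 1) # map h [i+2..<j]"
    using less.prems by (simp add: upt_conv_Cons)
  consider "i + 2 = j" | "i + 3 = j" | "i + 4 \<le> j" using less.prems by linarith
  then show ?case
  proof cases
    case 1
    then show ?thesis
      using map_upt_unfold[of i j h] by auto
  next
    case 2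
    then show ?thesis
      using map_upt_unfold[of i j h] steps_ok_pos[of i j h g] less.prems
      by (auto simp: upt_conv_Cons)
  next
    case 3
    show ?thesis
    proof (cases "h i = 0")
      case True
      then have "end_level g (map h [i..<j]) = end_level 0 (map h [i+1..<j])"
        unfolding map_upt_unfold[OF less.prems(1)] m by simp
      also have "\<dots> = h (j - 2)"
        using 3 less.prems steps_ok_zero[of i j h g] True by (intro less.hyps) auto
      finally show ?thesis .
    next
      case False
      then have "end_level g (map h [i..<j]) = end_level (h i) (map h [i+2..<j])"
        unfolding map_upt_unfold[OF less.prems(1)] by simp
      also have "\<dots> = h (j - 2)"
        using 3 less.prems steps_ok_pos[of i j h g] False by (intro less.hyps) auto
      finally show ?thesis .
    qed
  qed
qed

lemma heightsD:
  assumes "h \<in> heights n"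
  shows "r = 0 \<or> r > 2 * n \<Longrightarrow> h r = 0"
    and "r < 2 * n \<Longrightarrow> h (r + 2) \<le> h r + 1"
    and "h r = 0 \<or> h (r + 1) = 0"
    and "h 1 \<le> h (2 * n) + 2"
proof -
  note * = assms[unfolded heights_def mem_Collect_eq]
  show "r = 0 \<or> r > 2 * n \<Longrightarrow> h r = 0"
    by (rule *[THEN conjunct1, rule_format])
  show "r < 2 * n \<Longrightarrow> h (r + 2) \<le> h r + 1"
    by (rule *[THEN conjunct2, THEN conjunct1, rule_format])
  show "h r = 0 \<or> h (r + 1) = 0"
    by (rule *[THEN conjunct2, THEN conjunct2, THEN conjunct1, rule_format])
  show "h 1 \<le> h (2 * n) + 2"
    by (rule *[THEN conjunct2, THEN conjunct2, THEN conjunct2])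
qed

lemma heights_iff:
  assumes "n \<ge> 1" "\<And>r. r = 0 \<or> r > 2 * n + 1 \<Longrightarrow> h r = 0"
  shows "h \<in> heights n \<longleftrightarrow> steps_ok h 1 (2 * n + 2) (Suc (h (2 * n)))"
proof
  assume h: "h \<in> heights n"
  note zero = heightsD(1)[OF h] and st = heightsD(2)[OF h] and adj = heightsD(3)[OF h]
  have "h 1 \<le> h (2 * n) + 2"
    by (rule heightsD(4)[OF h])
  moreover have "h 2 \<le> 1"
    using st[of 0] zero[of 0] assms(1) by (simp add: numeral_2_eq_2)
  ultimately have bound: "h r \<le> (if r = 1 then Suc (h (2 * n)) else if r = 1 + 1 then 0 else h (r - 2)) + 1"
    if r: "1 \<le> r \<and> r < 2 * n + 2" for r
  proof -
    consider "r = 1" | "r = 2" | "3 \<le> r" using r by linarith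
    then show ?thesis
    proof cases
      case 1
      then show ?thesis using \<open>h 1 \<le> _\<close> by simp
    next
      case 2
      then show ?thesis using \<open>h 2 \<le> 1\<close> by simp
    next
      case 3
      then have "r - 2 + 2 = r" "r - 2 < 2 * n"
        using r by linarith+
      then have "h r \<le> h (r - 2) + 1"
        using st[of "r - 2"] by metis
      then show ?thesis using 3 by simp
    qed
  qed
  have "h (2 * n + 2 - 1) = 0"
    using zero[of "2 * n + 1"] by simp
  then show "steps_ok h 1 (2 * n + 2) (Suc (h (2 * n)))"
    unfolding steps_ok_def by (intro conjI allI impI bound adj) simp_all
next
  assume A: "steps_ok h 1 (2 * n + 2) (Suc (h (2 * n)))"
  have last: "h (2 * n + 1) = 0"
    using steps_okD3[OF A] by simp
  show "h \<in> heights n"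
    unfolding heights_def mem_Collect_eq
  proof (intro conjI allI impI)
    fix r assume "r = 0 \<or> 2 * n < r"
    then show "h r = 0"
      using assms(2)[of r] last by (cases "r = 2 * n + 1") auto
  next
    fix r assume r: "r < 2 * n"
    show "h (r + 2) \<le> h r + 1"
    proof (cases "r = 0")
      case True
      then show ?thesis using steps_okD[OF A, of 2] r assms(2)[of 0] by (simp add: numeral_2_eq_2)
    next
      case False
      then show ?thesis using steps_okD[OF A, of "r + 2"] r by simp
    qed
  next
    fix r
    consider "r = 0" | "1 \<le> r" "r + 1 < 2 * n + 2" | "r = 2 * n + 1" | "r > 2 * n + 1" by linarith
    then show "h r = 0 \<or> h (r + 1) = 0"
    proof cases
      case 2
      then show ?thesis by (rule steps_okD2[OF A])
    qed (use assms(2) last in auto)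
  next
    show "h 1 \<le> h (2 * n) + 2"
      using steps_okD[OF A, of 1] by simp
  qed
qed

lemma heights_even_le:
  assumes "h \<in> heights n" "j \<le> n"
  shows "h (2 * j) \<le> j"
  using assms(2)
proof (induction j)
  case 0
  show ?case using assms(1) by (simp add: heightsD)
next
  case (Suc j)
  have "h (2 * j + 2) \<le> h (2 * j) + 1"
    using heightsD(2)[OF assms(1), of "2 * j"] Suc.prems by simp
  then show ?case using Suc by simp
qed

text \<open>The list contains the position \<open>2n + 1\<close>, that is, the zero at residue 0, so that its end state records \<open>h (2n)\<close>.\<close>

lemma bij_betw_heights_walks:
  assumes "n \<ge> 1"
  shows "bij_betw (\<lambda>h. map h [1..<2*n+2]) {h \<in> heights n. h (2 * n) = b} (walks b (2 * n + 1) (Suc b))"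
proof (rule bij_betw_byWitness[where f' = "\<lambda>L r. if 1 \<le> r \<and> r \<le> 2 * n + 1 then L ! (r - 1) else 0"])
  let ?f = "\<lambda>L r. if 1 \<le> r \<and> r \<le> 2 * n + 1 then L ! (r - 1) else (0 :: nat)"
  let ?m = "\<lambda>h :: nat \<Rightarrow> nat. map h [1..<2*n+2]"
  have mf: "?m (?f L) = L" if "length L = 2 * n + 1" for L
    using that by (intro nth_equalityI) (auto simp del: upt_Suc)
  show "\<forall>h\<in>{h \<in> heights n. h (2 * n) = b}. ?f (?m h) = h"
  proof (intro ballI ext)
    fix h r assume "h \<in> {h \<in> heights n. h (2 * n) = b}"
    then have "r = 0 \<or> r > 2 * n + 1 \<Longrightarrow> h r = 0"
      by (auto dest: heightsD(1)[where r = r])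
    then show "?f (?m h) r = h r"
      by (cases "r = 0 \<or> r > 2 * n + 1") (auto simp del: upt_Suc)
  qed
  show "\<forall>L\<in>walks b (2 * n + 1) (Suc b). ?m (?f L) = L"
    using mf by (auto simp: walks_def)
  show "?m ` {h \<in> heights n. h (2 * n) = b} \<subseteq> walks b (2 * n + 1) (Suc b)"
  proof (intro image_subsetI)
    fix h assume h: "h \<in> {h \<in> heights n. h (2 * n) = b}"
    then have hn: "h \<in> heights n" "h (2 * n) = b"
      by auto
    have "h \<in> heights n \<longleftrightarrow> steps_ok h 1 (2 * n + 2) (Suc (h (2 * n)))"
      by (rule heights_iff[OF assms heightsD(1)[OF hn(1)]]) auto
    then have ok: "steps_ok h 1 (2 * n + 2) (Suc b)"
      using hn by simp
    then have "walk (Suc b) (?m h)"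
      by (simp add: walk_map_upt del: upt_Suc)
    moreover have "end_level (Suc b) (?m h) = b"
      using end_level_map_upt[OF _ ok] h assms by (simp del: upt_Suc)
    ultimately show "?m h \<in> walks b (2 * n + 1) (Suc b)"
      by (simp add: walks_def del: upt_Suc)
  qed
  show "?f ` walks b (2 * n + 1) (Suc b) \<subseteq> {h \<in> heights n. h (2 * n) = b}"
  proof (intro image_subsetI)
    fix L assume L: "L \<in> walks b (2 * n + 1) (Suc b)"
    define F where "F = ?f L"
    from L have m: "?m F = L"
      unfolding F_def using mf by (auto simp: walks_def)
    have zero: "F r = 0" if "r = 0 \<or> r > 2 * n + 1" for r
      using that by (auto simp: F_def)
    have "walk (Suc b) (?m F)"
      using L unfolding m by (simp add: walks_def)
    then have ok: "steps_ok F 1 (2 * n + 2) (Suc b)"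
      using walk_map_upt[of 1 "2 * n + 2" "Suc b" F] by simp
    have "end_level (Suc b) (?m F) = F (2 * n + 2 - 2)"
      by (rule end_level_map_upt[OF _ ok]) (use assms in simp)
    moreover have "end_level (Suc b) L = b"
      using L by (simp add: walks_def)
    ultimately have "F (2 * n) = b"
      unfolding m by (simp only: add_diff_cancel_right')
    moreover have "F \<in> heights n \<longleftrightarrow> steps_ok F 1 (2 * n + 2) (Suc (F (2 * n)))"
      by (rule heights_iff[OF assms zero])
    ultimately have "F \<in> {h \<in> heights n. h (2 * n) = b}"
      using ok by simp
    then show "?f L \<in> {h \<in> heights n. h (2 * n) = b}"
      by (simp only: F_def)
  qed
qed

lemma heights_partition: "heights n = (\<Union>b\<in>{..n}. {h \<in> heights n. h (2 * n) = b})"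
  using heights_even_le[of _ n n] by auto

lemma finite_heights: "n \<ge> 1 \<Longrightarrow> finite (heights n)"
  using bij_betw_finite[OF bij_betw_heights_walks] finite_walks
  by (subst heights_partition) blast

lemma sum_heights:
  assumes "n \<ge> 1" "\<alpha> 0 = (1 :: 'k::comm_ring_1)"
  shows "(\<Sum>h\<in>heights n. \<Prod>r=1..2*n. \<alpha> (h r)) = config_sum \<alpha> n"
proof -
  have prod: "(\<Prod>r=1..2*n. \<alpha> (h r)) = prod_list (map \<alpha> (map h [1..<2*n+2]))" if "h \<in> heights n" for h
  proof -
    have "h (2 * n + 1) = 0"
      using heightsD(1)[OF that, of "2 * n + 1"] by simp
    then have "prod_list (map \<alpha> (map h [1..<2*n+2])) = prod_list (map (\<lambda>r. \<alpha> (h r)) [1..<2*n+1])"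
      by (simp add: assms o_def)
    also have "\<dots> = (\<Prod>r\<in>set [1..<2*n+1]. \<alpha> (h r))"
      by (rule prod.distinct_set_conv_list[symmetric]) simp
    also have "set [1..<2*n+1] = {1..2*n}"
      by auto
    finally show ?thesis ..
  qed
  have fin: "finite {h \<in> heights n. h (2 * n) = b}" for b
    using finite_heights[OF assms(1)] by simp
  have "(\<Sum>h\<in>heights n. \<Prod>r=1..2*n. \<alpha> (h r))
     = (\<Sum>h\<in>heights n. prod_list (map \<alpha> (map h [1..<2*n+2])))"
    by (rule sum.cong[OF refl prod])
  also have "\<dots> = (\<Sum>b\<le>n. \<Sum>h\<in>{h \<in> heights n. h (2 * n) = b}. prod_list (map \<alpha> (map h [1..<2*n+2])))"
    by (subst heights_partition, rule sum.UNION_disjoint) (use fin in auto)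
  also have "\<dots> = (\<Sum>b\<le>n. \<Sum>L\<in>walks b (2 * n + 1) (Suc b). prod_list (map \<alpha> L))"
    by (intro sum.cong[OF refl] sum.reindex_bij_betw[OF bij_betw_heights_walks[OF assms(1)]])
  finally show ?thesis
    unfolding config_sum_def sum_walks[of \<alpha>, OF assms(2)] .
qed

section \<open>Limits of the moments\<close>

definition height_sum :: "nat \<Rightarrow> (nat \<Rightarrow> nat) \<Rightarrow> real" where
  "height_sum n h = (\<Sum>r=1..2*n. real (h r))"

definition sq_sum :: "nat \<Rightarrow> (nat \<Rightarrow> nat) \<Rightarrow> real" where
  "sq_sum n h = (\<Sum>r=1..2*n. real (h r) ^ 2)"

definition height_weight :: "nat \<Rightarrow> wt" where
  "height_weight c = exp_uv (real c ^ 2) (real c)"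

lemma prod_height_weight: "(\<Prod>r\<in>A. height_weight (h r)) = exp_uv (\<Sum>r\<in>A. real (h r) ^ 2) (\<Sum>r\<in>A. real (h r))"
  by (induction A rule: infinite_finite_induct) (simp_all add: height_weight_def exp_uv_add)

lemma config_sum_nth:
  assumes "n \<ge> 1"
  shows "config_sum height_weight n $ a $ b = (\<Sum>h\<in>heights n. sq_sum n h ^ a * height_sum n h ^ b) / (fact a * fact b)"
proof -
  have "height_weight 0 = 1" by (simp add: height_weight_def)
  from sum_heights[of n height_weight, OF assms this]
  have "config_sum height_weight n = (\<Sum>h\<in>heights n. exp_uv (sq_sum n h) (height_sum n h))"
    by (simp add: prod_height_weight sq_sum_def height_sum_def)
  then show ?thesis
    by (simp add: fps_sum_nth sum_divide_distrib)
qed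

lemma shift_pair_height_weight: "shift_pair 1 (exp_uv (real c ^ 2) (real c)) (exp_uv (real (Suc c) ^ 2) (real (Suc c)))"
proof -
  have "exp_uv (real (Suc c) ^ 2) (real (Suc c)) = exp_uv (real c ^ 2 + 2 * real c + real 1) (real c + real 1)"
    by (simp add: power2_eq_square algebra_simps)
  then show ?thesis
    by (simp only: shift_pair_exp_uv)
qed

context scaled_coeffs
begin

text \<open>The coefficients of the generating function of closed walks at \<open>u\<^sup>a v\<^sup>b X\<^sup>n\<close> are the power sums of the statistics
over all height functions, divided by \<open>a! b!\<close>.\<close>

lemma moment_asymp:
  "(\<lambda>n. (\<Sum>h\<in>heights n. sq_sum n h ^ a * height_sum n h ^ b) / (4 ^ n * real n powr (2 * real a + 3 / 2 * real b)))
     \<longlonglongrightarrow> fact a * fact b * z a b * rGamma (2 * real a + 3 / 2 * real b + 1)"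
proof -
  interpret run_series y z "run_gf height_weight 0" "run_gf (up height_weight) 0" "run_gf (up (up height_weight)) 0"
    "jump_gf height_weight" "jump_gf (up height_weight)"
  proof
    have e: "height_weight 1 = exp_uv 1 1" "height_weight 2 = exp_uv 4 2"
      by (simp_all add: height_weight_def)
    show "run_gf height_weight 0 = 1 + fps_X * fps_const (exp_uv 1 1) * run_gf height_weight 0 * run_gf (up height_weight) 0"
      using run_gf_0_rec[of height_weight] by (simp only: e)
    show "shifted (run_gf height_weight 0) (run_gf (up height_weight) 0)"
      by (rule shifted_run_gf) (use shift_pair_height_weight in \<open>simp add: up_def height_weight_def\<close>)
    show "shifted (run_gf (up height_weight) 0) (run_gf (up (up height_weight)) 0)"
      by (rule shifted_run_gf) (use shift_pair_height_weight[of "Suc _"] in \<open>simp add: up_def height_weight_def\<close>)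
    show "shifted (jump_gf height_weight) (jump_gf (up height_weight))"
      by (rule shifted_jump_gf) (use shift_pair_height_weight in \<open>simp add: up_def height_weight_def\<close>)
    show "jump_gf height_weight = fps_X * fps_const (exp_uv 4 2) * run_gf (up (up height_weight)) 0 * run_gf (up height_weight) 0 * run_gf height_weight 0
        + fps_X * fps_const (exp_uv 1 1) * (run_gf height_weight 0)\<^sup>2 * jump_gf (up height_weight)"
      using jump_gf_rec[of height_weight] by (simp only: e)
  qed
  have "graded (- 2) z (Abs_fps (config_sum height_weight))"
    by (rule graded_quotient) (simp only: L_def config_gf)
  from gradedD[OF this, of a b]
  have "lead (4 * int a + 3 * int b + 2) (z a b) (Abs_fps (\<lambda>n. config_sum height_weight n $ a $ b))"
    by (simp add: cf_def)
  note lead_nth_asymp[OF this]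
  moreover have "of_int (4 * int a + 3 * int b + 2) / 2 - 1 = 2 * real a + 3 / 2 * real b"
    "of_int (4 * int a + 3 * int b + 2) / 2 = 2 * real a + 3 / 2 * real b + 1"
    by (simp_all add: field_simps)
  ultimately have "(\<lambda>n. config_sum height_weight n $ a $ b / (4 ^ n * real n powr (2 * real a + 3 / 2 * real b)))
     \<longlonglongrightarrow> z a b * rGamma (2 * real a + 3 / 2 * real b + 1)"
    by (simp only: fps_nth_Abs_fps)
  from tendsto_mult_left[OF this, of "fact a * fact b"]
  have "(\<lambda>n. fact a * fact b * (config_sum height_weight n $ a $ b / (4 ^ n * real n powr (2 * real a + 3 / 2 * real b))))
     \<longlonglongrightarrow> fact a * fact b * z a b * rGamma (2 * real a + 3 / 2 * real b + 1)"
    by (simp add: mult.assoc)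
  moreover have "eventually (\<lambda>n. fact a * fact b * (config_sum height_weight n $ a $ b / (4 ^ n * real n powr (2 * real a + 3 / 2 * real b)))
     = (\<Sum>h\<in>heights n. sq_sum n h ^ a * height_sum n h ^ b) / (4 ^ n * real n powr (2 * real a + 3 / 2 * real b))) sequentially"
    using eventually_ge_at_top[of 1] by eventually_elim (simp add: config_sum_nth)
  ultimately show ?thesis
    by (rule Lim_transform_eventually)
qed

end

definition mean :: "nat \<Rightarrow> ((nat \<Rightarrow> nat) \<Rightarrow> real) \<Rightarrow> real" where
  "mean n f = (\<Sum>h\<in>heights n. f h) / real (card (heights n))"

lemma mean_add: "mean n (\<lambda>h. f h + g h) = mean n f + mean n g"
  and mean_cmult: "mean n (\<lambda>h. c * f h) = c * mean n f"
  by (simp_all add: mean_def sum.distrib add_divide_distrib flip: sum_distrib_left)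

lemma mean_sum: "mean n (\<lambda>h. \<Sum>i\<in>A. f i h) = (\<Sum>i\<in>A. mean n (f i))"
  unfolding mean_def by (subst sum.swap) (simp add: sum_divide_distrib)

lemma mean_mono: "(\<And>h. h \<in> heights n \<Longrightarrow> f h \<le> g h) \<Longrightarrow> mean n f \<le> mean n g"
  unfolding mean_def by (intro divide_right_mono sum_mono) auto

lemma mean_abs: "\<bar>mean n f\<bar> \<le> mean n (\<lambda>h. \<bar>f h\<bar>)"
  unfolding mean_def by (auto simp: abs_divide intro!: divide_right_mono sum_abs)

definition sq_scaled :: "nat \<Rightarrow> (nat \<Rightarrow> nat) \<Rightarrow> real" where
  "sq_scaled n h = sq_sum n h / real n ^ 2"

definition tot_scaled :: "nat \<Rightarrow> (nat \<Rightarrow> nat) \<Rightarrow> real" where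
  "tot_scaled n h = height_sum n h / real n powr (3 / 2)"

text \<open>The size of the core with the height function \<open>h\<close>. The part in parentheses has smaller order than the rest.\<close>

definition height_size :: "nat \<Rightarrow> (nat \<Rightarrow> nat) \<Rightarrow> real" where
  "height_size n h = real n * sq_sum n h - height_sum n h ^ 2 / 2
     + (sq_sum n h / 2 + (\<Sum>r=1..2*n. (real r - real n) * real (h r)))"

text \<open>It dominates the main part of the scaled size and, divided by \<open>\<surd>n\<close>, the remainder.\<close>

definition bound :: "nat \<Rightarrow> (nat \<Rightarrow> nat) \<Rightarrow> real" where
  "bound n h = 1 + sq_scaled n h + tot_scaled n h ^ 2"

lemma sq_scaled_nonneg: "0 \<le> sq_scaled n h"
  by (simp add: sq_scaled_def sq_sum_def sum_nonneg)

lemma tot_scaled_nonneg: "0 \<le> tot_scaled n h"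
  by (simp add: tot_scaled_def height_sum_def sum_nonneg)

lemma height_size_close:
  assumes "n \<ge> 1"
  shows "\<bar>height_size n h / real n ^ 3 - (sq_scaled n h - tot_scaled n h ^ 2 / 2)\<bar> \<le> bound n h / sqrt (real n)"
proof -
  let ?R = "\<Sum>r=1..2*n. (real r - real n) * real (h r)"
  have n: "real n > 0" "sqrt (real n) \<ge> 1" "sqrt (real n) > 0" "sqrt (real n) \<le> real n"
    using assms by (auto simp: power2_eq_square intro: real_le_lsqrt)
  have "real n powr (3 / 2) = real n * sqrt (real n)"
    using n(1) powr_add[of "real n" 1 "1 / 2"] by (simp add: powr_half_sqrt)
  then have q: "tot_scaled n h = height_sum n h / (real n * sqrt (real n))"
    by (simp add: tot_scaled_def)
  have q2: "tot_scaled n h ^ 2 = height_sum n h ^ 2 / real n ^ 3"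
    unfolding q using n(1) by (simp add: power_divide power_mult_distrib eval_nat_numeral)
  have main: "height_size n h / real n ^ 3 - (sq_scaled n h - tot_scaled n h ^ 2 / 2)
     = (sq_sum n h / 2 + ?R) / real n ^ 3"
    unfolding q2 sq_scaled_def height_size_def using n(1) by (simp add: field_simps eval_nat_numeral)
  have "\<bar>?R\<bar> \<le> (\<Sum>r=1..2*n. real n * real (h r))"
    by (rule order_trans[OF sum_abs]) (auto simp: abs_mult intro!: sum_mono mult_right_mono)
  also have "\<dots> = real n * height_sum n h"
    by (simp add: height_sum_def sum_distrib_left)
  finally have "\<bar>sq_sum n h / 2 + ?R\<bar> \<le> sq_sum n h / 2 + real n * height_sum n h"
    using sum_nonneg[of "{1..2*n}" "\<lambda>r. real (h r) ^ 2"] by (simp add: sq_sum_def)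
  then have "\<bar>(sq_sum n h / 2 + ?R) / real n ^ 3\<bar> \<le> (sq_sum n h / 2 + real n * height_sum n h) / real n ^ 3"
    using n(1) by (simp add: abs_divide divide_right_mono)
  also have "\<dots> = sq_scaled n h / 2 / real n + tot_scaled n h / sqrt (real n)"
    unfolding q sq_scaled_def using n(1,3) by (simp add: field_simps eval_nat_numeral)
  also have "\<dots> \<le> sq_scaled n h / sqrt (real n) + (1 + tot_scaled n h ^ 2) / sqrt (real n)"
  proof (rule add_mono)
    have "sq_scaled n h / 2 / real n \<le> sq_scaled n h / real n"
      using sq_scaled_nonneg[of n h] n(1) by (intro divide_right_mono) auto
    also have "\<dots> \<le> sq_scaled n h / sqrt (real n)"
      using n sq_scaled_nonneg[of n h] by (intro divide_left_mono) auto
    finally show "sq_scaled n h / 2 / real n \<le> sq_scaled n h / sqrt (real n)" .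
    have "2 * tot_scaled n h \<le> 1 + tot_scaled n h ^ 2"
      using zero_le_power2[of "tot_scaled n h - 1"] by (simp add: power2_diff)
    then show "tot_scaled n h / sqrt (real n) \<le> (1 + tot_scaled n h ^ 2) / sqrt (real n)"
      using n(3) tot_scaled_nonneg[of n h] by (intro divide_right_mono) auto
  qed
  also have "\<dots> = bound n h / sqrt (real n)"
    by (simp add: bound_def add_divide_distrib)
  finally show ?thesis
    unfolding main .
qed

text \<open>After scaling to the interval from -1 to 1, the power \<open>x\<^sup>k\<close> has Lipschitz constant \<open>k\<close>.\<close>

lemma power_diff_le:
  fixes x u B :: real
  assumes "\<bar>x\<bar> \<le> B" "\<bar>u\<bar> \<le> B" "B > 0"
  shows "\<bar>x ^ k - u ^ k\<bar> / B ^ k \<le> real k * (\<bar>x - u\<bar> / B)"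
proof -
  have "norm ((x / B) ^ k - (u / B) ^ k) \<le> real k * norm (x / B - u / B)"
    by (rule norm_power_diff) (use assms in \<open>auto simp: abs_divide\<close>)
  then show ?thesis
    using assms(3) by (simp add: power_divide abs_divide flip: diff_divide_distrib)
qed

lemma height_size_power_close:
  assumes "n \<ge> 1"
  shows "\<bar>(height_size n h / real n ^ 3) ^ k - (sq_scaled n h - tot_scaled n h ^ 2 / 2) ^ k\<bar>
     \<le> 2 ^ k * real k / sqrt (real n) * bound n h ^ k"
proof -
  let ?B = "2 * bound n h"
  let ?x = "height_size n h / real n ^ 3" and ?u = "sq_scaled n h - tot_scaled n h ^ 2 / 2"
  have B: "bound n h \<ge> 1"
    using sq_scaled_nonneg[of n h] by (simp add: bound_def)
  have s: "sqrt (real n) \<ge> 1" using assms by simp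
  have u: "\<bar>?u\<bar> \<le> bound n h"
    using sq_scaled_nonneg[of n h] zero_le_power2[of "tot_scaled n h"] unfolding bound_def by linarith
  have "bound n h / sqrt (real n) \<le> bound n h"
    using B s by (simp add: divide_le_eq)
  then have x: "\<bar>?x\<bar> \<le> ?B"
    using height_size_close[OF assms, of h] u by linarith
  have "\<bar>?x ^ k - ?u ^ k\<bar> / ?B ^ k \<le> real k * (\<bar>?x - ?u\<bar> / ?B)"
    by (rule power_diff_le[OF x]) (use u B in linarith)+
  also have "\<dots> \<le> real k * (bound n h / sqrt (real n) / ?B)"
    using height_size_close[OF assms, of h] B by (intro mult_left_mono divide_right_mono) auto
  also have "\<dots> \<le> real k / sqrt (real n)"
    using B s by (simp add: divide_simps)
  finally have "\<bar>?x ^ k - ?u ^ k\<bar> \<le> real k / sqrt (real n) * ?B ^ k"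
    using B by (simp add: divide_le_eq)
  then show ?thesis
    by (simp add: power_mult_distrib mult_ac)
qed

context scaled_coeffs
begin

lemma mean_moment:
  "(\<lambda>n. mean n (\<lambda>h. sq_scaled n h ^ a * tot_scaled n h ^ b))
     \<longlonglongrightarrow> fact a * fact b * z a b * rGamma (2 * real a + 3 / 2 * real b + 1)"
proof -
  have z00: "z 0 0 = 1"
    using z_rec[of 0 0] by (simp add: y_00)
  have "(\<lambda>n. real (card (heights n)) / (4 ^ n * real n powr 0)) \<longlonglongrightarrow> 1"
    using moment_asymp[of 0 0] by (simp add: z00)
  from tendsto_divide[OF moment_asymp[of a b] this]
  have "(\<lambda>n. (\<Sum>h\<in>heights n. sq_sum n h ^ a * height_sum n h ^ b) / (4 ^ n * real n powr (2 * real a + 3 / 2 * real b))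
       / (real (card (heights n)) / (4 ^ n * real n powr 0)))
     \<longlonglongrightarrow> fact a * fact b * z a b * rGamma (2 * real a + 3 / 2 * real b + 1)"
    by simp
  moreover have "eventually (\<lambda>n. (\<Sum>h\<in>heights n. sq_sum n h ^ a * height_sum n h ^ b) / (4 ^ n * real n powr (2 * real a + 3 / 2 * real b))
       / (real (card (heights n)) / (4 ^ n * real n powr 0))
     = mean n (\<lambda>h. sq_scaled n h ^ a * tot_scaled n h ^ b)) sequentially"
    using eventually_ge_at_top[of 1]
  proof eventually_elim
    case (elim n)
    have "(real n ^ 2) ^ a * (real n powr (3 / 2)) ^ b = real n powr (2 * real a + 3 / 2 * real b)"
    proof -
      have "(real n ^ 2) ^ a = real n powr (2 * real a)"
        using elim powr_realpow[of "real n" "2 * a"] by (simp add: power_mult)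
      moreover have "(real n powr (3 / 2)) ^ b = real n powr (3 / 2 * real b)"
        using elim powr_power[of "real n" "3 / 2" b] by (simp add: mult.commute)
      ultimately show ?thesis by (simp only: powr_add)
    qed
    then have "mean n (\<lambda>h. sq_scaled n h ^ a * tot_scaled n h ^ b)
      = (\<Sum>h\<in>heights n. sq_sum n h ^ a * height_sum n h ^ b / real n powr (2 * real a + 3 / 2 * real b)) / real (card (heights n))"
      unfolding mean_def sq_scaled_def tot_scaled_def by (simp add: power_divide)
    then show ?case
      using elim by (simp add: divide_simps flip: sum_divide_distrib)
  qed
  ultimately show ?thesis
    by (rule Lim_transform_eventually)
qed

text \<open>The limit of the \<open>k\<close>-th moment of \<open>T/n\<^sup>2 - H\<^sup>2/(2n\<^sup>3)\<close>, by binomial expansion; since only even powers of \<open>H\<close>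
occur, the Gamma function is evaluated at integers.\<close>

definition limit_moment :: "nat \<Rightarrow> real" where
  "limit_moment k = (\<Sum>j\<le>k. real (k choose j) * (- 1 / 2) ^ j *
     (fact (k - j) * fact (2 * j) * z (k - j) (2 * j) / fact (2 * (k - j) + 3 * j)))"

lemma main_part_moment:
  "(\<lambda>n. mean n (\<lambda>h. (sq_scaled n h - tot_scaled n h ^ 2 / 2) ^ k)) \<longlonglongrightarrow> limit_moment k"
proof -
  have ex: "(sq_scaled n h - tot_scaled n h ^ 2 / 2) ^ k =
     (\<Sum>j\<le>k. (real (k choose j) * (- 1 / 2) ^ j) * (sq_scaled n h ^ (k - j) * tot_scaled n h ^ (2 * j)))" for n h
  proof -
    have "(sq_scaled n h - tot_scaled n h ^ 2 / 2) ^ k = ((- 1 / 2) * tot_scaled n h ^ 2 + sq_scaled n h) ^ k"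
      by simp
    also have "\<dots> = (\<Sum>j\<le>k. real (k choose j) * ((- 1 / 2) * tot_scaled n h ^ 2) ^ j * sq_scaled n h ^ (k - j))"
      by (rule binomial_ring)
    finally show ?thesis
      by (simp only: power_mult_distrib power_mult) (simp only: mult_ac)
  qed
  have rG: "rGamma (2 * real (k - j) + 3 / 2 * real (2 * j) + 1) = 1 / fact (2 * (k - j) + 3 * j)" for j
  proof -
    have "2 * real (k - j) + 3 / 2 * real (2 * j) + 1 = 1 + real (2 * (k - j) + 3 * j)"
      by simp
    then show ?thesis
      by (simp only: rGamma_inverse_Gamma Gamma_fact inverse_eq_divide)
  qed
  have "(\<lambda>n. \<Sum>j\<le>k. (real (k choose j) * (- 1 / 2) ^ j) * mean n (\<lambda>h. sq_scaled n h ^ (k - j) * tot_scaled n h ^ (2 * j)))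
     \<longlonglongrightarrow> (\<Sum>j\<le>k. (real (k choose j) * (- 1 / 2) ^ j) *
       (fact (k - j) * fact (2 * j) * z (k - j) (2 * j) * rGamma (2 * real (k - j) + 3 / 2 * real (2 * j) + 1)))"
    by (intro tendsto_sum tendsto_mult tendsto_const mean_moment)
  then show ?thesis
    unfolding rG ex mean_sum mean_cmult limit_moment_def by simp
qed

lemma bound_moment: "\<exists>C. eventually (\<lambda>n. mean n (\<lambda>h. bound n h ^ k) \<le> C) sequentially"
proof -
  have le: "bound n h ^ k \<le> 3 ^ k * (1 + sq_scaled n h ^ k + tot_scaled n h ^ (2 * k))" for n h
  proof -
    let ?p = "sq_scaled n h" and ?q = "tot_scaled n h ^ 2"
    define M where "M = max 1 (max ?p ?q)"
    have p: "0 \<le> ?p" "0 \<le> ?q"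
      by (simp_all add: sq_scaled_nonneg)
    have "bound n h \<le> 3 * M"
      unfolding bound_def M_def by linarith
    then have "bound n h ^ k \<le> (3 * M) ^ k"
      by (rule power_mono) (use p in \<open>simp add: bound_def\<close>)
    also have "M ^ k \<le> 1 + ?p ^ k + ?q ^ k"
    proof -
      have "0 \<le> ?p ^ k" "0 \<le> ?q ^ k" using p by simp_all
      then show ?thesis unfolding M_def max_def by auto
    qed
    then have "(3 * M) ^ k \<le> 3 ^ k * (1 + ?p ^ k + ?q ^ k)"
      by (simp add: power_mult_distrib)
    finally show ?thesis
      by (simp add: power_mult)
  qed
  have "(\<lambda>n. mean n (\<lambda>h. sq_scaled n h ^ 0 * tot_scaled n h ^ 0) + mean n (\<lambda>h. sq_scaled n h ^ k * tot_scaled n h ^ 0)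
      + mean n (\<lambda>h. sq_scaled n h ^ 0 * tot_scaled n h ^ (2 * k)))
     \<longlonglongrightarrow> fact 0 * fact 0 * z 0 0 * rGamma (2 * real 0 + 3 / 2 * real 0 + 1)
      + fact k * fact 0 * z k 0 * rGamma (2 * real k + 3 / 2 * real 0 + 1)
      + fact 0 * fact (2 * k) * z 0 (2 * k) * rGamma (2 * real 0 + 3 / 2 * real (2 * k) + 1)"
    (is "?s \<longlonglongrightarrow> ?l")
    by (intro tendsto_add mean_moment)
  then have "eventually (\<lambda>n. ?s n < ?l + 1) sequentially"
    by (rule order_tendstoD) simp
  then have "eventually (\<lambda>n. mean n (\<lambda>h. bound n h ^ k) \<le> 3 ^ k * (?l + 1)) sequentially"
  proof eventually_elim
    case (elim n)
    have "mean n (\<lambda>h. bound n h ^ k) \<le> mean n (\<lambda>h. 3 ^ k * (1 + sq_scaled n h ^ k + tot_scaled n h ^ (2 * k)))"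
      by (intro mean_mono le)
    also have "\<dots> = 3 ^ k * ?s n"
      by (simp add: mean_cmult mean_add)
    also have "\<dots> \<le> 3 ^ k * (?l + 1)"
      using elim by (intro mult_left_mono) auto
    finally show ?case .
  qed
  then show ?thesis by blast
qed

lemma mean_height_size_power: "(\<lambda>n. mean n (\<lambda>h. (height_size n h / real n ^ 3) ^ k)) \<longlonglongrightarrow> limit_moment k"
proof -
  let ?x = "\<lambda>n h. height_size n h / real n ^ 3" and ?u = "\<lambda>n h. sq_scaled n h - tot_scaled n h ^ 2 / 2"
  obtain C where C: "eventually (\<lambda>n. mean n (\<lambda>h. bound n h ^ k) \<le> C) sequentially"
    using bound_moment by blast
  have "(\<lambda>n. mean n (\<lambda>h. ?x n h ^ k - ?u n h ^ k)) \<longlonglongrightarrow> 0"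
  proof (rule Lim_null_comparison)
    show "eventually (\<lambda>n. norm (mean n (\<lambda>h. ?x n h ^ k - ?u n h ^ k)) \<le> 2 ^ k * real k / sqrt (real n) * C) sequentially"
      using C eventually_ge_at_top[of 1]
    proof eventually_elim
      case (elim n)
      have "norm (mean n (\<lambda>h. ?x n h ^ k - ?u n h ^ k)) \<le> mean n (\<lambda>h. \<bar>?x n h ^ k - ?u n h ^ k\<bar>)"
        using mean_abs by simp
      also have "\<dots> \<le> mean n (\<lambda>h. 2 ^ k * real k / sqrt (real n) * bound n h ^ k)"
        by (intro mean_mono height_size_power_close elim)
      also have "\<dots> \<le> 2 ^ k * real k / sqrt (real n) * C"
        unfolding mean_cmult using elim by (intro mult_left_mono) auto
      finally show ?case .
    qed
    show "(\<lambda>n. 2 ^ k * real k / sqrt (real n) * C) \<longlonglongrightarrow> 0"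
      by real_asymp
  qed
  from tendsto_add[OF this main_part_moment[of k]]
  show ?thesis
    by (simp flip: mean_add)
qed

end

section \<open>Cores and their beta sets\<close>

text \<open>The hook length of the first cell in the row \<open>i\<close>, where rows are counted from 0.\<close>

definition beta :: "nat list \<Rightarrow> nat \<Rightarrow> nat" where
  "beta l i = l ! i + (length l - 1 - i)"

definition beta_set :: "nat list \<Rightarrow> nat set" where
  "beta_set l = beta l ` {..<length l}"

lemma downset_nat:
  fixes k :: nat
  assumes "\<And>i j. i \<le> j \<Longrightarrow> j < k \<Longrightarrow> P j \<Longrightarrow> P i"
  shows "\<exists>N\<le>k. \<forall>m<k. P m \<longleftrightarrow> m < N"
proof -
  \<comment> \<open>The alternative \<open>m = k\<close> makes the minimum exist.\<close>
  define N where "N = (LEAST m. m = k \<or> \<not> P m)"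
  have N: "N = k \<or> \<not> P N"
    unfolding N_def by (rule LeastI[of _ k]) simp
  have "N \<le> k"
    unfolding N_def by (rule Least_le) simp
  moreover have "P m \<longleftrightarrow> m < N" if "m < k" for m
  proof
    assume "P m"
    show "m < N"
    proof (rule ccontr)
      assume "\<not> m < N"
      then have "N \<le> m" by simp
      then have "P N" using assms[of N m] \<open>m < k\<close> \<open>P m\<close> by simp
      then show False using N \<open>N \<le> m\<close> \<open>m < k\<close> by simp
    qed
  next
    assume "m < N"
    then show "P m" unfolding N_def using not_less_Least by blast
  qed
  ultimately show ?thesis by blast
qed

lemma partition_antimono:
  assumes "is_partition l" "i \<le> j" "j < length l"
  shows "l ! j \<le> l ! i"
  using assms sorted_wrt_nth_less[of "(\<ge>)" l i j] by (cases "i = j") (auto simp: is_partition_def)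

lemma partition_pos: "is_partition l \<Longrightarrow> i < length l \<Longrightarrow> 0 < l ! i"
  by (auto simp: is_partition_def)

lemma conjugate_part_eqI:
  assumes "N \<le> length l" "\<And>m. m < length l \<Longrightarrow> j \<le> l ! m \<longleftrightarrow> m < N"
  shows "conjugate_part l j = N"
proof -
  have "{i \<in> {1..length l}. j \<le> part l i} = {1..N}"
    using assms by (force simp: part_def Suc_le_eq)
  then show ?thesis by (simp add: conjugate_part_def)
qed

lemma beta_strict_antimono:
  assumes "is_partition l" "i < j" "j < length l"
  shows "beta l j < beta l i"
  using partition_antimono[OF assms(1), of i j] assms unfolding beta_def by linarith

text \<open>The hook lengths in row \<open>i\<close> are the numbers \<open>\<beta> - x\<close>, where \<open>\<beta>\<close> is the beta number of the row and \<open>x < \<beta>\<close>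
runs through the non-members of the beta set: the column \<open>j\<close> with \<open>N\<close> cells belongs to \<open>x = k - N + j - 1\<close> for
\<open>k\<close> parts, and this \<open>x\<close> lies strictly between the beta numbers of the rows \<open>N - 1\<close> and \<open>N\<close>.\<close>

lemma hook_length_iff:
  assumes l: "is_partition l" and i: "i < length l" and s: "1 \<le> s"
  shows "(\<exists>j. (Suc i, j) \<in> cells l \<and> hook_length l (Suc i, j) = int s)
    \<longleftrightarrow> s \<le> beta l i \<and> beta l i - s \<notin> beta_set l"
proof
  assume "\<exists>j. (Suc i, j) \<in> cells l \<and> hook_length l (Suc i, j) = int s"
  then obtain j where j: "1 \<le> j" "j \<le> l ! i" "hook_length l (Suc i, j) = int s"
    by (auto simp: cells_def part_def)
  have "j \<le> l ! m'" if "m' \<le> m" "m < length l" "j \<le> l ! m" for m' m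
    using partition_antimono[OF l that(1,2)] that(3) by simp
  from downset_nat[of "length l" "\<lambda>m. j \<le> l ! m", OF this]
  obtain N where "N \<le> length l \<and> (\<forall>m<length l. (j \<le> l ! m) = (m < N))" ..
  note N = this[THEN conjunct1] this[THEN conjunct2, rule_format]
  have "int (l ! i) - int i + int N - int j = int s"
    using j(3) conjugate_part_eqI[OF N] by (simp add: hook_length_def part_def)
  then have x: "beta l i = s + (length l - N + (j - 1))"
    using i j(1) N(1) unfolding beta_def by linarith
  have "beta l m \<noteq> length l - N + (j - 1)" if m: "m < length l" for m
    using N(2)[OF m] j(1) m N(1) unfolding beta_def by (cases "m < N") linarith+
  then have "length l - N + (j - 1) \<notin> beta_set l"
    unfolding beta_set_def by (metis imageE lessThan_iff)
  then show "s \<le> beta l i \<and> beta l i - s \<notin> beta_set l"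
    using x by simp
next
  assume s': "s \<le> beta l i \<and> beta l i - s \<notin> beta_set l"
  define x where "x = beta l i - s"
  have "x < beta l m'" if "m' \<le> m" "m < length l" "x < beta l m" for m' m
    using beta_strict_antimono[OF l, of m' m] that by (cases "m' = m") auto
  from downset_nat[of "length l" "\<lambda>m. x < beta l m", OF this]
  obtain N where "N \<le> length l \<and> (\<forall>m<length l. (x < beta l m) = (m < N))" ..
  note N = this[THEN conjunct1] this[THEN conjunct2, rule_format]
  have "x < beta l i" using s s' by (simp add: x_def)
  then have "i < N" using N(2)[OF i] by simp
  have xB: "x \<noteq> beta l m" if "m < length l" for m
    using s' that by (auto simp: x_def beta_set_def)
  have upper: "l ! m + length l < x + 1 + N" if "N \<le> m" "m < length l" for m
  proof -
    have "N < length l" using that by simp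
    then have "beta l N < x"
      using N(2)[of N] xB[of N] by (metis linorder_neqE_nat order_less_irrefl)
    then show ?thesis
      using partition_antimono[OF l that] \<open>N < length l\<close> unfolding beta_def by linarith
  qed
  have lower: "x + 1 + N \<le> l ! m + length l" if "m < N" for m
  proof -
    have "x < beta l (N - 1)" using N that by simp
    moreover have "l ! (N - 1) \<le> l ! m"
      using partition_antimono[OF l, of m "N - 1"] that N(1) by simp
    ultimately show ?thesis
      using that N(1) unfolding beta_def by linarith
  qed
  define j where "j = x + 1 + N - length l"
  have j: "length l + j = x + 1 + N" "1 \<le> j"
  proof -
    have "length l < x + 1 + N"
    proof (cases "N < length l")
      case True
      then show ?thesis using upper[of N] by linarith
    qed (use N(1) in simp)
    then show "length l + j = x + 1 + N" "1 \<le> j" unfolding j_def by simp_all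
  qed
  have "j \<le> l ! m \<longleftrightarrow> m < N" if "m < length l" for m
    using upper[of m] lower[of m] j(1) that by (cases "m < N") linarith+
  then have "conjugate_part l j = N" "j \<le> l ! i"
    using conjugate_part_eqI[OF N(1)] \<open>i < N\<close> i by blast+
  moreover have "int (l ! i) - int i + int N - int j = int s"
    using j(1) i s' unfolding x_def beta_def by linarith
  ultimately show "\<exists>j. (Suc i, j) \<in> cells l \<and> hook_length l (Suc i, j) = int s"
    using j(2) i by (intro exI[of _ j]) (simp add: cells_def hook_length_def part_def)
qed

definition closed_under :: "nat \<Rightarrow> nat set \<Rightarrow> bool" where
  "closed_under s B \<longleftrightarrow> (\<forall>b\<in>B. s \<le> b \<longrightarrow> b - s \<in> B)"

lemma no_hook_iff:
  assumes "is_partition l" "1 \<le> s"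
  shows "(\<forall>c\<in>cells l. hook_length l c \<noteq> int s) \<longleftrightarrow> closed_under s (beta_set l)"
proof -
  have "(\<exists>c\<in>cells l. hook_length l c = int s)
    \<longleftrightarrow> (\<exists>i<length l. \<exists>j. (Suc i, j) \<in> cells l \<and> hook_length l (Suc i, j) = int s)"
  proof
    assume "\<exists>c\<in>cells l. hook_length l c = int s"
    then obtain i j where ij: "(i, j) \<in> cells l" "hook_length l (i, j) = int s" by auto
    then have "1 \<le> i" "i \<le> length l" by (auto simp: cells_def)
    then have "Suc (i - 1) = i" "i - 1 < length l" by auto
    then show "\<exists>i<length l. \<exists>j. (Suc i, j) \<in> cells l \<and> hook_length l (Suc i, j) = int s"
      using ij by metis
  qed blast
  also have "\<dots> \<longleftrightarrow> (\<exists>i<length l. s \<le> beta l i \<and> beta l i - s \<notin> beta_set l)"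
    using hook_length_iff[OF assms(1) _ assms(2)] by blast
  also have "\<dots> \<longleftrightarrow> \<not> closed_under s (beta_set l)"
    by (auto simp: closed_under_def beta_set_def)
  finally show ?thesis by blast
qed

lemma inj_on_beta:
  assumes "is_partition l"
  shows "inj_on (beta l) {..<length l}"
proof (rule inj_onI)
  fix i j assume "i \<in> {..<length l}" "j \<in> {..<length l}" "beta l i = beta l j"
  then show "i = j"
    using beta_strict_antimono[OF assms, of i j] beta_strict_antimono[OF assms, of j i]
    by (cases i j rule: linorder_cases) auto
qed

lemma distinct_iff_beta_set:
  assumes l: "is_partition l"
  shows "distinct l \<longleftrightarrow> (\<forall>b\<in>beta_set l. b + 1 \<notin> beta_set l)"
proof
  assume d: "distinct l"
  show "\<forall>b\<in>beta_set l. b + 1 \<notin> beta_set l"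
  proof (intro ballI notI)
    fix b assume "b \<in> beta_set l" "b + 1 \<in> beta_set l"
    then obtain i j where ij: "i < length l" "j < length l" "beta l j = beta l i + 1"
      by (auto simp: beta_set_def)
    then have "j < i"
      using beta_strict_antimono[OF l, of i j] by (cases j i rule: linorder_cases) auto
    moreover have "l ! i < l ! j"
      using partition_antimono[OF l, of j i] d ij \<open>j < i\<close> by (metis distinct_conv_nth le_neq_implies_less less_imp_le nat_neq_iff)
    ultimately show False
      using ij unfolding beta_def by linarith
  qed
next
  assume B: "\<forall>b\<in>beta_set l. b + 1 \<notin> beta_set l"
  have "l ! i \<noteq> l ! j" if "i < j" "j < length l" for i j
  proof
    assume "l ! i = l ! j"
    then have "l ! Suc i = l ! i"
      using partition_antimono[OF l, of i "Suc i"] partition_antimono[OF l, of "Suc i" j] that by simp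
    then have "beta l i = beta l (Suc i) + 1"
      using that unfolding beta_def by simp
    moreover have "beta l i \<in> beta_set l" "beta l (Suc i) \<in> beta_set l"
      using that by (auto simp: beta_set_def)
    ultimately show False using B by metis
  qed
  then show "distinct l"
    unfolding distinct_conv_nth by (metis nat_neq_iff)
qed

definition beta_sets :: "nat \<Rightarrow> nat \<Rightarrow> nat set set" where
  "beta_sets s t = {B. finite B \<and> 0 \<notin> B \<and> closed_under s B \<and> closed_under t B \<and> (\<forall>b\<in>B. b + 1 \<notin> B)}"

lemma beta_list:
  assumes "is_partition l"
  shows "rev (map (beta l) [0..<length l]) = sorted_list_of_set (beta_set l)"
proof (rule sorted_distinct_set_unique)
  have "sorted_wrt (>) (map (beta l) [0..<length l])"
    using beta_strict_antimono[OF assms] by (auto simp: sorted_wrt_iff_nth_less)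
  then show "sorted (rev (map (beta l) [0..<length l]))"
    unfolding sorted_wrt_rev by (rule sorted_wrt_mono_rel[rotated]) auto
  show "distinct (rev (map (beta l) [0..<length l]))"
    using inj_on_beta[OF assms] by (simp add: distinct_map atLeast0LessThan)
qed (auto simp: beta_set_def atLeast0LessThan)

lemma card_beta_set: "is_partition l \<Longrightarrow> card (beta_set l) = length l"
  unfolding beta_set_def using card_image[OF inj_on_beta] by simp

lemma inj_on_beta_set: "inj_on beta_set {l. is_partition l}"
proof (rule inj_onI)
  fix l l' assume l: "l \<in> {l. is_partition l}" "l' \<in> {l. is_partition l}" "beta_set l = beta_set l'"
  then have len: "length l = length l'"
    using card_beta_set[of l] card_beta_set[of l'] by simp
  have "map (beta l) [0..<length l] = map (beta l') [0..<length l']"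
    using beta_list[of l] beta_list[of l'] l by (metis mem_Collect_eq rev_rev_ident)
  then have "beta l i = beta l' i" if "i < length l" for i
    using that len by (metis add_0 diff_zero length_upt nth_map nth_upt)
  then have "l ! i = l' ! i" if "i < length l" for i
    using that len unfolding beta_def by (metis add_right_cancel)
  then show "l = l'"
    using len by (intro nth_equalityI)
qed

lemma beta_set_surj:
  assumes "finite B" "0 \<notin> B"
  obtains l where "is_partition l" "beta_set l = B"
proof
  define bs where "bs = rev (sorted_list_of_set B)"
  define k where "k = length bs"
  define l where "l = map (\<lambda>i. bs ! i - (k - 1 - i)) [0..<k]"
  have len: "length l = k" by (simp add: l_def)
  have set: "set bs = B" using assms by (simp add: bs_def)
  have "sorted_wrt (<) (sorted_list_of_set B)"
    by (rule strict_sorted_list_of_set)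
  then have "sorted_wrt (\<lambda>x y. y < x) bs"
    unfolding bs_def sorted_wrt_rev .
  then have dec: "bs ! j < bs ! i" if "i < j" "j < k" for i j
    using that sorted_wrt_nth_less[of _ bs i j] by (simp add: k_def)
  have ge: "k - i \<le> bs ! i" if "i < k" for i
    using that
  proof (induction "k - i" arbitrary: i rule: less_induct)
    case less
    show ?case
    proof (cases "Suc i = k")
      case True
      have "bs ! i \<in> B" using less.prems set by (auto simp: k_def)
      then show ?thesis using True assms(2) by (cases "bs ! i") auto
    next
      case False
      then have "k - Suc i \<le> bs ! Suc i" using less by simp
      then show ?thesis using dec[of i "Suc i"] False less.prems by linarith
    qed
  qed
  have nth: "l ! i = bs ! i - (k - 1 - i)" if "i < k" for i
    using that by (simp add: l_def)
  have step: "bs ! j + (j - i) \<le> bs ! i" if "i \<le> j" "j < k" for i j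
    using that
  proof (induction j rule: dec_induct)
    case (step m)
    then show ?case using dec[of m "Suc m"] by simp
  qed simp
  show "is_partition l"
    unfolding is_partition_def
  proof
    have "l ! j \<le> l ! i" if "i < j" "j < k" for i j
      using nth[of i] nth[of j] step[of i j] ge[of i] ge[of j] that by simp
    then show "sorted_wrt (\<ge>) l"
      by (simp add: sorted_wrt_iff_nth_less len)
    have "0 < l ! i" if "i < k" for i
      using nth[OF that] ge[OF that] that by simp
    then show "\<forall>p\<in>set l. 0 < p"
      by (auto simp: in_set_conv_nth len)
  qed
  have "beta l i = bs ! i" if "i < k" for i
    using nth[OF that] ge[OF that] that by (simp add: beta_def len)
  then have "beta_set l = (\<lambda>i. bs ! i) ` {..<k}"
    by (auto simp: beta_set_def len)
  also have "\<dots> = set bs"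
    unfolding k_def by (auto simp: set_conv_nth)
  finally show "beta_set l = B" by (simp add: set)
qed

lemma bij_betw_beta_set:
  assumes "1 \<le> s" "1 \<le> t"
  shows "bij_betw beta_set (distinct_cores s t) (beta_sets s t)"
proof -
  have iff: "l \<in> distinct_cores s t \<longleftrightarrow> is_partition l \<and> beta_set l \<in> beta_sets s t" for l
  proof (cases "is_partition l")
    case True
    have "0 < beta l i" if "i < length l" for i
      using partition_pos[OF True that] unfolding beta_def by linarith
    then have "0 \<notin> beta_set l"
      by (force simp: beta_set_def)
    moreover have "finite (beta_set l)"
      by (simp add: beta_set_def)
    ultimately show ?thesis
      using True no_hook_iff[OF True assms(1)] no_hook_iff[OF True assms(2)] distinct_iff_beta_set[OF True]
      by (auto simp: distinct_cores_def core_partition_def beta_sets_def)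
  qed (auto simp: distinct_cores_def core_partition_def)
  show ?thesis
  proof (rule bij_betw_imageI)
    show "inj_on beta_set (distinct_cores s t)"
      by (rule inj_on_subset[OF inj_on_beta_set]) (auto simp: iff)
    show "beta_set ` distinct_cores s t = beta_sets s t"
    proof
      show "beta_sets s t \<subseteq> beta_set ` distinct_cores s t"
      proof
        fix B assume B: "B \<in> beta_sets s t"
        obtain l where "is_partition l" "beta_set l = B"
          using beta_set_surj[of B] B by (auto simp: beta_sets_def)
        then show "B \<in> beta_set ` distinct_cores s t"
          using B iff by blast
      qed
    qed (auto simp: iff)
  qed
qed

lemma sum_list_beta_set:
  assumes "is_partition l"
  shows "real (sum_list l) = real (\<Sum>(beta_set l)) - real (card (beta_set l)) * (real (card (beta_set l)) - 1) / 2"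
proof -
  let ?k = "length l"
  have "\<Sum>(beta_set l) = (\<Sum>i<?k. beta l i)"
    unfolding beta_set_def by (subst sum.reindex[OF inj_on_beta[OF assms]]) simp
  also have "\<dots> = (\<Sum>i<?k. l ! i) + (\<Sum>i<?k. ?k - 1 - i)"
    unfolding beta_def by (rule sum.distrib)
  also have "(\<Sum>i<?k. l ! i) = sum_list l"
    by (simp add: sum_list_sum_nth atLeast0LessThan)
  also have "(\<Sum>i<?k. ?k - 1 - i) = (\<Sum>i<?k. i)"
    by (rule sum.reindex_bij_witness[of _ "\<lambda>i. ?k - 1 - i" "\<lambda>i. ?k - 1 - i"]) auto
  finally have "real (\<Sum>(beta_set l)) = real (sum_list l) + (\<Sum>i<?k. real i)"
    by simp
  moreover have "(\<Sum>i<m. real i) = real m * (real m - 1) / 2" for m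
    by (induction m) (simp_all add: field_simps)
  ultimately show ?thesis
    by (simp add: card_beta_set[OF assms])
qed

section \<open>Beta sets and height functions\<close>

definition height_set :: "nat \<Rightarrow> (nat \<Rightarrow> nat) \<Rightarrow> nat set" where
  "height_set n h = {b. b div (2 * n + 1) < h (b mod (2 * n + 1))}"

lemma residue_div_mod:
  fixes r s :: nat
  assumes "r < s"
  shows "(m * s + r) div s = m" "(m * s + r) mod s = r"
  using assms by simp_all

lemma mem_height_set: "r < 2 * n + 1 \<Longrightarrow> m * (2 * n + 1) + r \<in> height_set n h \<longleftrightarrow> m < h r"
  unfolding height_set_def mem_Collect_eq by (simp only: residue_div_mod)

lemma height_set_image:
  assumes "h \<in> heights n"
  shows "height_set n h = (\<lambda>(r, m). m * (2 * n + 1) + r) ` (SIGMA r:{1..2*n}. {..<h r})"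
proof (intro equalityI subsetI)
  fix b assume b: "b \<in> height_set n h"
  have r: "b mod (2 * n + 1) \<in> {1..2*n}"
  proof -
    have "b mod (2 * n + 1) \<noteq> 0"
      using b heightsD(1)[OF assms, of 0] unfolding height_set_def
      by (metis mem_Collect_eq less_nat_zero_code)
    moreover have "b mod (2 * n + 1) < 2 * n + 1" by simp
    ultimately show ?thesis by simp
  qed
  have "b = (\<lambda>(r, m). m * (2 * n + 1) + r) (b mod (2 * n + 1), b div (2 * n + 1))"
    by (simp only: prod.case div_mult_mod_eq)
  then show "b \<in> (\<lambda>(r, m). m * (2 * n + 1) + r) ` (SIGMA r:{1..2*n}. {..<h r})"
  proof (rule image_eqI)
    show "(b mod (2 * n + 1), b div (2 * n + 1)) \<in> (SIGMA r:{1..2*n}. {..<h r})"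
      using r b by (simp add: height_set_def)
  qed
next
  fix b assume "b \<in> (\<lambda>(r, m). m * (2 * n + 1) + r) ` (SIGMA r:{1..2*n}. {..<h r})"
  then obtain r m where rm: "b = m * (2 * n + 1) + r" "r \<in> {1..2*n}" "m < h r"
    by (elim imageE SigmaE) simp
  then have "r < 2 * n + 1" by simp
  then show "b \<in> height_set n h"
    unfolding rm(1) using mem_height_set rm(3) by blast
qed

lemma inj_on_residue:
  fixes n :: nat
  shows "inj_on (\<lambda>(r, m). m * (2 * n + 1) + r) (SIGMA r:{1..2*n}. A r)"
proof (rule inj_onI)
  fix p q assume p: "p \<in> (SIGMA r:{1..2*n}. A r)" "q \<in> (SIGMA r:{1..2*n}. A r)"
    and eq: "(\<lambda>(r, m). m * (2 * n + 1) + r) p = (\<lambda>(r, m). m * (2 * n + 1) + r) q"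
  obtain r m r' m' where pq: "p = (r, m)" "q = (r', m')" by (cases p, cases q)
  have r: "r < 2 * n + 1" "r' < 2 * n + 1" using p pq by auto
  have e: "m * (2 * n + 1) + r = m' * (2 * n + 1) + r'" using eq pq by simp
  have "(m * (2 * n + 1) + r) mod (2 * n + 1) = r" "(m' * (2 * n + 1) + r') mod (2 * n + 1) = r'"
    "(m * (2 * n + 1) + r) div (2 * n + 1) = m" "(m' * (2 * n + 1) + r') div (2 * n + 1) = m'"
    by (rule residue_div_mod[OF r(1)] residue_div_mod[OF r(2)])+
  then show "p = q"
    using e pq by metis
qed

lemma residue_cases:
  fixes b n :: nat
  obtains m r where "b = m * (2 * n + 1) + r" "r < 2 * n + 1"
  by (rule that[OF div_mult_mod_eq[symmetric]]) simp

text \<open>Write \<open>b = m (2n+1) + r\<close>. Subtracting \<open>2n + 1\<close> decreases \<open>m\<close>. Subtracting \<open>2n + 3\<close> also decreases \<open>r\<close> by 2; for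
\<open>r = 1\<close> this borrows once more, giving residue \<open>2n\<close> and \<open>m - 2\<close>.\<close>

lemma height_set_in_beta_sets:
  assumes n: "1 \<le> n" and h: "h \<in> heights n"
  shows "height_set n h \<in> beta_sets (2 * n + 1) (2 * n + 3)"
  unfolding beta_sets_def mem_Collect_eq closed_under_def
proof (intro conjI ballI impI)
  show "finite (height_set n h)"
    unfolding height_set_image[OF h] by simp
  show "0 \<notin> height_set n h"
    using heightsD(1)[OF h, of 0] by (simp add: height_set_def)
next
  fix b assume b: "b \<in> height_set n h" "2 * n + 1 \<le> b"
  obtain m r where mr: "b = m * (2 * n + 1) + r" "r < 2 * n + 1" by (rule residue_cases)
  have "m < h r" using b(1) mr mem_height_set by simp
  obtain m' where m': "m = Suc m'" using b(2) mr by (cases m) auto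
  have "b - (2 * n + 1) = m' * (2 * n + 1) + r" by (simp add: mr m')
  then show "b - (2 * n + 1) \<in> height_set n h"
    using mem_height_set[OF mr(2)] \<open>m < h r\<close> m' by (metis Suc_lessD)
next
  fix b assume b: "b \<in> height_set n h" "2 * n + 3 \<le> b"
  obtain m r where mr: "b = m * (2 * n + 1) + r" "r < 2 * n + 1" by (rule residue_cases)
  have mh: "m < h r" using b(1) mr mem_height_set by simp
  then have "r \<noteq> 0" using heightsD(1)[OF h, of r] by (metis less_nat_zero_code)
  obtain m' where m': "m = Suc m'" using b(2) mr by (cases m) auto
  show "b - (2 * n + 3) \<in> height_set n h"
  proof (cases "r = 1")
    case True
    then obtain m'' where m'': "m' = Suc m''" using b(2) mr m' by (cases m') auto
    have "m'' < h (2 * n)"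
      using heightsD(4)[OF h] mh True m' m'' by simp
    moreover have "b - (2 * n + 3) = m'' * (2 * n + 1) + 2 * n"
      using True n by (simp add: mr m' m'')
    ultimately show ?thesis
      using mem_height_set[of "2 * n" n m'' h] by simp
  next
    case False
    then have r2: "r - 2 + 2 = r" "r - 2 < 2 * n" using \<open>r \<noteq> 0\<close> mr(2) by linarith+
    then have "h r \<le> h (r - 2) + 1"
      using heightsD(2)[OF h, of "r - 2"] by metis
    then have "m' < h (r - 2)" using mh m' by simp
    moreover have "b - (2 * n + 3) = m' * (2 * n + 1) + (r - 2)"
      using r2 unfolding mr m' by simp
    ultimately show ?thesis
      using mem_height_set[of "r - 2" n m' h] r2 by simp
  qed
next
  fix b assume b: "b \<in> height_set n h"
  obtain m r where mr: "b = m * (2 * n + 1) + r" "r < 2 * n + 1" by (rule residue_cases)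
  have "m < h r" using b mr mem_height_set by simp
  then have hr: "h (r + 1) = 0" using heightsD(3)[OF h, of r] by simp
  show "b + 1 \<notin> height_set n h"
  proof (cases "r = 2 * n")
    case True
    then have "b + 1 = (m + 1) * (2 * n + 1) + 0" by (simp add: mr)
    then show ?thesis
      using mem_height_set[of 0 n "m + 1" h] heightsD(1)[OF h, of 0] by (metis less_nat_zero_code zero_less_Suc Suc_eq_plus1)
  next
    case False
    then have "r + 1 < 2 * n + 1" "b + 1 = m * (2 * n + 1) + (r + 1)" using mr by simp_all
    then show ?thesis
      using mem_height_set[of "r + 1" n m h] hr by (metis less_nat_zero_code)
  qed
qed

lemma height_set_inj: "inj_on (height_set n) (heights n)"
proof (rule inj_onI)
  fix h h' assume h: "h \<in> heights n" "h' \<in> heights n" "height_set n h = height_set n h'"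
  show "h = h'"
  proof
    fix r
    show "h r = h' r"
    proof (cases "r < 2 * n + 1")
      case True
      have "m < h r \<longleftrightarrow> m < h' r" for m
        using mem_height_set[OF True, of m h] mem_height_set[OF True, of m h'] h(3) by simp
      then show ?thesis by (metis nat_neq_iff order_less_irrefl)
    next
      case False
      then show ?thesis using heightsD(1)[OF h(1), of r] heightsD(1)[OF h(2), of r] by simp
    qed
  qed
qed

lemma height_set_surj:
  assumes n: "1 \<le> n" and B: "B \<in> beta_sets (2 * n + 1) (2 * n + 3)"
  shows "\<exists>h\<in>heights n. height_set n h = B"
proof -
  let ?s = "2 * n + 1"
  have fin: "finite B" and B0: "0 \<notin> B" and Bs: "\<And>b. b \<in> B \<Longrightarrow> ?s \<le> b \<Longrightarrow> b - ?s \<in> B"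
    and Bt: "\<And>b. b \<in> B \<Longrightarrow> 2 * n + 3 \<le> b \<Longrightarrow> b - (2 * n + 3) \<in> B" and B1: "\<And>b. b \<in> B \<Longrightarrow> b + 1 \<notin> B"
    using B by (auto simp: beta_sets_def closed_under_def)
  have "\<exists>N. \<forall>m. m * ?s + r \<in> B \<longleftrightarrow> m < N" for r
  proof -
    obtain K where K: "\<And>b. b \<in> B \<Longrightarrow> b < K"
      using fin finite_nat_set_iff_bounded by auto
    have down: "i * ?s + r \<in> B" if "i \<le> j" "j < K" "j * ?s + r \<in> B" for i j
      using that(1,3)
    proof (induction j rule: dec_induct)
      case (step j)
      have e: "(Suc j * ?s + r) - ?s = j * ?s + r" by simp
      have "(Suc j * ?s + r) - ?s \<in> B" by (rule Bs[OF step.prems]) simp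
      then show ?case unfolding e by (rule step.IH)
    qed simp
    from downset_nat[of K "\<lambda>m. m * ?s + r \<in> B", OF this]
    obtain N where "N \<le> K \<and> (\<forall>m<K. (m * ?s + r \<in> B) = (m < N))" ..
    note N = this[THEN conjunct1] this[THEN conjunct2, rule_format]
    have "m * ?s + r \<in> B \<longleftrightarrow> m < N" for m
    proof (cases "m < K")
      case False
      then have "\<not> m * ?s + r < K" by (simp add: not_less trans_le_add1)
      then show ?thesis using K[of "m * ?s + r"] False N(1) by auto
    qed (rule N(2))
    then show ?thesis by blast
  qed
  then obtain g where g: "\<And>r m. m * ?s + r \<in> B \<longleftrightarrow> m < g r" by metis
  define h where "h = (\<lambda>r. if r < ?s then g r else 0)"
  have hB: "m * ?s + r \<in> B \<longleftrightarrow> m < h r" if "r < ?s" for m r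
    using g[of m r] that by (simp add: h_def)
  have h0: "h 0 = 0"
    using hB[of 0 0] B0 by simp
  have big: "h r = 0" if "r \<ge> ?s" for r
    using that by (simp add: h_def)
  have "h \<in> heights n"
    unfolding heights_def mem_Collect_eq
  proof (intro conjI allI impI)
    fix r assume "r = 0 \<or> 2 * n < r"
    then show "h r = 0" using h0 big[of r] by auto
  next
    fix r assume r: "r < 2 * n"
    show "h (r + 2) \<le> h r + 1"
    proof (rule ccontr)
      assume "\<not> h (r + 2) \<le> h r + 1"
      then have c: "Suc (h r) < h (r + 2)" by simp
      then have lt: "r + 2 < ?s" using big[of "r + 2"] by (cases "r + 2 < ?s") auto
      have "Suc (h r) * ?s + (r + 2) \<in> B" by (simp only: hB[OF lt] c)
      from Bt[OF this] have "h r * ?s + r \<in> B" by (simp add: add.assoc)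
      then show False using hB[of r "h r"] r by simp
    qed
  next
    fix r
    show "h r = 0 \<or> h (r + 1) = 0"
    proof (rule ccontr)
      assume c: "\<not> (h r = 0 \<or> h (r + 1) = 0)"
      then have "r + 1 < ?s" using big[of "r + 1"] by (cases "r + 1 < ?s") auto
      then have "r \<in> B" "r + 1 \<in> B" using hB[of r 0] hB[of "r + 1" 0] c by simp_all
      then show False using B1 by blast
    qed
  next
    show "h 1 \<le> h (2 * n) + 2"
    proof (rule ccontr)
      assume "\<not> h 1 \<le> h (2 * n) + 2"
      then have "Suc (Suc (h (2 * n))) < h 1" by simp
      moreover have "1 < ?s" using n by simp
      ultimately have "Suc (Suc (h (2 * n))) * ?s + 1 \<in> B" by (simp only: hB)
      from Bt[OF this] have "h (2 * n) * ?s + 2 * n \<in> B" by (simp add: add_ac)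
      then show False using hB[of "2 * n" "h (2 * n)"] by simp
    qed
  qed
  moreover have "height_set n h = B"
  proof (rule set_eqI)
    fix b
    obtain m r where mr: "b = m * ?s + r" "r < ?s" by (rule residue_cases)
    show "b \<in> height_set n h \<longleftrightarrow> b \<in> B"
      using mem_height_set[OF mr(2), of m h] hB[OF mr(2), of m] unfolding mr(1) by simp
  qed
  ultimately show ?thesis by blast
qed

lemma bij_betw_height_set:
  assumes "1 \<le> n"
  shows "bij_betw (height_set n) (heights n) (beta_sets (2 * n + 1) (2 * n + 3))"
  unfolding bij_betw_def
  using height_set_inj height_set_in_beta_sets[OF assms] height_set_surj[OF assms] by blast

lemma card_height_set:
  assumes "h \<in> heights n"
  shows "real (card (height_set n h)) = height_sum n h"
  unfolding height_set_image[OF assms] card_image[OF inj_on_residue]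
  by (simp add: height_sum_def)

text \<open>The elements of the residue class \<open>r\<close> form an arithmetic progression with difference \<open>2n + 1\<close>.\<close>

lemma sum_height_set:
  assumes "h \<in> heights n"
  shows "real (\<Sum>(height_set n h)) =
    (\<Sum>r=1..2*n. (2 * real n + 1) * (real (h r) * (real (h r) - 1) / 2) + real r * real (h r))"
proof -
  have "\<Sum>(height_set n h) = (\<Sum>p\<in>(SIGMA r:{1..2*n}. {..<h r}). case p of (r, m) \<Rightarrow> m * (2 * n + 1) + r)"
    unfolding height_set_image[OF assms] by (subst sum.reindex[OF inj_on_residue]) simp
  also have "\<dots> = (\<Sum>r=1..2*n. \<Sum>m<h r. m * (2 * n + 1) + r)"
    by (rule sum.Sigma[symmetric]) auto
  finally have "real (\<Sum>(height_set n h)) = (\<Sum>r=1..2*n. \<Sum>m<h r. real m * (2 * real n + 1) + real r)"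
    by (simp add: algebra_simps)
  moreover have "(\<Sum>m<k. real m * (2 * real n + 1) + x) = (2 * real n + 1) * (real k * (real k - 1) / 2) + x * real k" for k x
    by (induction k) (simp_all add: field_simps)
  ultimately show ?thesis by (simp add: mult.commute)
qed

lemma height_set_height_size:
  assumes "h \<in> heights n"
  shows "real (\<Sum>(height_set n h)) - real (card (height_set n h)) * (real (card (height_set n h)) - 1) / 2 = height_size n h"
proof -
  have "(\<Sum>r=1..2*n. (2 * real n + 1) * (real (h r) * (real (h r) - 1) / 2) + real r * real (h r))
    = (\<Sum>r=1..2*n. (real n + 1 / 2) * real (h r) ^ 2 + (real r - real n) * real (h r) - 1 / 2 * real (h r))"
    by (rule sum.cong) (simp_all add: field_simps power2_eq_square)
  also have "\<dots> = (real n + 1 / 2) * sq_sum n h + (\<Sum>r=1..2*n. (real r - real n) * real (h r)) - 1 / 2 * height_sum n h"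
    by (simp only: sum.distrib sum_subtractf sum_distrib_left[symmetric] sq_sum_def height_sum_def)
  finally show ?thesis
    unfolding sum_height_set[OF assms] card_height_set[OF assms]
    by (simp add: height_size_def field_simps power2_eq_square)
qed

lemma sum_distinct_cores:
  assumes n: "1 \<le> n"
  shows "(\<Sum>l\<in>distinct_cores (2 * n + 1) (2 * n + 3). f (core_size l)) = (\<Sum>h\<in>heights n. f (height_size n h))"
proof -
  let ?size = "\<lambda>B :: nat set. real (\<Sum>B) - real (card B) * (real (card B) - 1) / 2"
  have "(\<Sum>l\<in>distinct_cores (2 * n + 1) (2 * n + 3). f (core_size l))
    = (\<Sum>l\<in>distinct_cores (2 * n + 1) (2 * n + 3). f (?size (beta_set l)))"
    by (rule sum.cong) (auto simp: core_size_def sum_list_beta_set distinct_cores_def core_partition_def)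
  also have "\<dots> = (\<Sum>B\<in>beta_sets (2 * n + 1) (2 * n + 3). f (?size B))"
    by (rule sum.reindex_bij_betw[OF bij_betw_beta_set]) simp_all
  also have "\<dots> = (\<Sum>h\<in>heights n. f (?size (height_set n h)))"
    by (rule sum.reindex_bij_betw[OF bij_betw_height_set[OF n], symmetric])
  also have "\<dots> = (\<Sum>h\<in>heights n. f (height_size n h))"
    by (rule sum.cong[OF refl]) (simp only: height_set_height_size)
  finally show ?thesis .
qed

lemma card_distinct_cores:
  assumes n: "1 \<le> n"
  shows "card (distinct_cores (2 * n + 1) (2 * n + 3)) = card (heights n)"
  using bij_betw_same_card[OF bij_betw_beta_set] bij_betw_same_card[OF bij_betw_height_set[OF n]] by simp

lemma finite_distinct_cores:
  assumes n: "1 \<le> n"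
  shows "finite (distinct_cores (2 * n + 1) (2 * n + 3))"
  using bij_betw_finite[OF bij_betw_beta_set] bij_betw_finite[OF bij_betw_height_set[OF n]] finite_heights[OF n]
  by simp

lemma expectation_random_core:
  assumes n: "1 \<le> n"
  shows "measure_pmf.expectation (random_core n) (\<lambda>l. f (core_size l)) = mean n (\<lambda>h. f (height_size n h))"
proof -
  have "[] \<in> distinct_cores (2 * n + 1) (2 * n + 3)"
    by (simp add: distinct_cores_def core_partition_def is_partition_def cells_def)
  then have ne: "distinct_cores (2 * n + 1) (2 * n + 3) \<noteq> {}" by blast
  show ?thesis
    unfolding random_core_def mean_def
    using integral_pmf_of_set[OF ne finite_distinct_cores[OF n], of "\<lambda>l. f (core_size l)"]
    by (simp only: sum_distinct_cores[OF n] card_distinct_cores[OF n])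
qed

section \<open>Numerical values of the coefficients\<close>

text \<open>The recursions determine \<open>y a b\<close> and \<open>z a b\<close> from values of smaller level \<open>2a + b\<close>; the levels up to 14 suffice
for the moments of order at most 7. Finite sums are unfolded as sums over explicit lists.\<close>

named_theorems val

lemma conv_list: "conv f g a b = (\<Sum>i\<leftarrow>[0..<a+1]. \<Sum>j\<leftarrow>[0..<b+1]. f i j * g (a - i) (b - j))"
  unfolding conv_nested interv_sum_list_conv_sum_set_nat set_upt atLeast0LessThan Suc_eq_plus1[symmetric] lessThan_Suc_atMost ..

lemma upt_list:
  "[0..<1] = [0]"
  "[0..<2] = [0, 1]"
  "[0..<3] = [0, 1, 2]"
  "[0..<4] = [0, 1, 2, 3]"
  "[0..<5] = [0, 1, 2, 3, 4]"
  "[0..<6] = [0, 1, 2, 3, 4, 5]"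
  "[0..<7] = [0, 1, 2, 3, 4, 5, 6]"
  "[0..<8] = [0, 1, 2, 3, 4, 5, 6, 7]"
  "[0..<9] = [0, 1, 2, 3, 4, 5, 6, 7, 8]"
  "[0..<10] = [0, 1, 2, 3, 4, 5, 6, 7, 8, 9]"
  "[0..<11] = [0, 1, 2, 3, 4, 5, 6, 7, 8, 9, 10]"
  "[0..<12] = [0, 1, 2, 3, 4, 5, 6, 7, 8, 9, 10, 11]"
  "[0..<13] = [0, 1, 2, 3, 4, 5, 6, 7, 8, 9, 10, 11, 12]"
  "[0..<14] = [0, 1, 2, 3, 4, 5, 6, 7, 8, 9, 10, 11, 12, 13]"
  "[0..<15] = [0, 1, 2, 3, 4, 5, 6, 7, 8, 9, 10, 11, 12, 13, 14]"
  by (simp_all add: upt_rec)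

context scaled_coeffs
begin

declare conv_list [val] drift_def [val] y_00 [val] upt_list [val] One_nat_def [symmetric, val] One_nat_def [simp del]

lemma [val]: "y 0 1 = - (1 / 4)" using y_rec[of 0 1] by (simp add: val)
lemma [val]: "y 0 2 = - (5 / 32)" using y_rec[of 0 2] by (simp add: val)
lemma [val]: "y 1 0 = - (1 / 4)" using y_rec[of 1 0] by (simp add: val)
lemma [val]: "y 0 3 = - (15 / 64)" using y_rec[of 0 3] by (simp add: val)
lemma [val]: "y 1 1 = - (9 / 16)" using y_rec[of 1 1] by (simp add: val)
lemma [val]: "y 0 4 = - (1105 / 2048)" using y_rec[of 0 4] by (simp add: val)
lemma [val]: "y 1 2 = - (221 / 128)" using y_rec[of 1 2] by (simp add: val)
lemma [val]: "y 2 0 = - (19 / 32)" using y_rec[of 2 0] by (simp add: val)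
lemma [val]: "y 0 5 = - (1695 / 1024)" using y_rec[of 0 5] by (simp add: val)
lemma [val]: "y 1 3 = - (1695 / 256)" using y_rec[of 1 3] by (simp add: val)
lemma [val]: "y 2 1 = - (153 / 32)" using y_rec[of 2 1] by (simp add: val)
lemma [val]: "y 0 6 = - (414125 / 65536)" using y_rec[of 0 6] by (simp add: val)
lemma [val]: "y 1 4 = - (248475 / 8192)" using y_rec[of 1 4] by (simp add: val)
lemma [val]: "y 2 2 = - (34503 / 1024)" using y_rec[of 2 2] by (simp add: val)
lemma [val]: "y 3 0 = - (631 / 128)" using y_rec[of 3 0] by (simp add: val)
lemma [val]: "y 0 7 = - (59025 / 2048)" using y_rec[of 0 7] by (simp add: val)
lemma [val]: "y 1 5 = - (82635 / 512)" using y_rec[of 1 5] by (simp add: val)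
lemma [val]: "y 2 3 = - (248595 / 1024)" using y_rec[of 2 3] by (simp add: val)
lemma [val]: "y 3 1 = - (21429 / 256)" using y_rec[of 3 1] by (simp add: val)
lemma [val]: "y 0 8 = - (1282031525 / 8388608)" using y_rec[of 0 8] by (simp add: val)
lemma [val]: "y 1 6 = - (256406305 / 262144)" using y_rec[of 1 6] by (simp add: val)
lemma [val]: "y 2 4 = - (121782417 / 65536)" using y_rec[of 2 4] by (simp add: val)
lemma [val]: "y 3 2 = - (4321753 / 4096)" using y_rec[of 3 2] by (simp add: val)
lemma [val]: "y 4 0 = - (174317 / 2048)" using y_rec[of 4 0] by (simp add: val)
lemma [val]: "y 0 9 = - (242183775 / 262144)" using y_rec[of 0 9] by (simp add: val)
lemma [val]: "y 1 7 = - (435930795 / 65536)" using y_rec[of 1 7] by (simp add: val)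
lemma [val]: "y 2 5 = - (62579385 / 4096)" using y_rec[of 2 5] by (simp add: val)
lemma [val]: "y 3 3 = - (12581985 / 1024)" using y_rec[of 3 3] by (simp add: val)
lemma [val]: "y 4 1 = - (1268343 / 512)" using y_rec[of 4 1] by (simp add: val)
lemma [val]: "y 0 10 = - (1683480621875 / 268435456)" using y_rec[of 0 10] by (simp add: val)
lemma [val]: "y 1 8 = - (1683480621875 / 33554432)" using y_rec[of 1 8] by (simp add: val)
lemma [val]: "y 2 6 = - (283532034835 / 2097152)" using y_rec[of 2 6] by (simp add: val)
lemma [val]: "y 3 4 = - (37170498953 / 262144)" using y_rec[of 3 4] by (simp add: val)
lemma [val]: "y 4 2 = - (3210756043 / 65536)" using y_rec[of 4 2] by (simp add: val)
lemma [val]: "y 5 0 = - (20491783 / 8192)" using y_rec[of 5 0] by (simp add: val)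
lemma [val]: "y 0 11 = - (198147676875 / 4194304)" using y_rec[of 0 11] by (simp add: val)
lemma [val]: "y 1 9 = - (435924889125 / 1048576)" using y_rec[of 1 9] by (simp add: val)
lemma [val]: "y 2 7 = - (168547250115 / 131072)" using y_rec[of 2 7] by (simp add: val)
lemma [val]: "y 3 5 = - (54720110505 / 32768)" using y_rec[of 3 5] by (simp add: val)
lemma [val]: "y 4 3 = - (6891019275 / 8192)" using y_rec[of 4 3] by (simp add: val)
lemma [val]: "y 5 1 = - (227803437 / 2048)" using y_rec[of 5 1] by (simp add: val)
lemma [val]: "y 0 12 = - (6718940277925125 / 17179869184)" using y_rec[of 0 12] by (simp add: val)
lemma [val]: "y 1 10 = - (4031364166755075 / 1073741824)" using y_rec[of 1 10] by (simp add: val)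
lemma [val]: "y 2 8 = - (3519322894490985 / 268435456)" using y_rec[of 2 8] by (simp add: val)
lemma [val]: "y 3 6 = - (170697667410417 / 8388608)" using y_rec[of 3 6] by (simp add: val)
lemma [val]: "y 4 4 = - (57307008450195 / 4194304)" using y_rec[of 4 4] by (simp add: val)
lemma [val]: "y 5 2 = - (833230887615 / 262144)" using y_rec[of 5 2] by (simp add: val)
lemma [val]: "y 6 0 = - (7334801895 / 65536)" using y_rec[of 6 0] by (simp add: val)
lemma [val]: "y 0 13 = - (59217351295125 / 16777216)" using y_rec[of 0 13] by (simp add: val)
lemma [val]: "y 1 11 = - (153965113367325 / 4194304)" using y_rec[of 1 11] by (simp add: val)
lemma [val]: "y 2 9 = - (74884959583665 / 524288)" using y_rec[of 2 9] by (simp add: val)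
lemma [val]: "y 3 7 = - (135402852992055 / 524288)" using y_rec[of 3 7] by (simp add: val)
lemma [val]: "y 4 5 = - (57260948102385 / 262144)" using y_rec[of 4 5] by (simp add: val)
lemma [val]: "y 5 3 = - (4953842988285 / 65536)" using y_rec[of 5 3] by (simp add: val)
lemma [val]: "y 6 1 = - (28918062729 / 4096)" using y_rec[of 6 1] by (simp add: val)
lemma [val]: "y 0 14 = - (18962375127249928125 / 549755813888)" using y_rec[of 0 14] by (simp add: val)
lemma [val]: "y 1 12 = - (26547325178149899375 / 68719476736)" using y_rec[of 1 12] by (simp add: val)
lemma [val]: "y 2 10 = - (14236898961062777625 / 8589934592)" using y_rec[of 2 10] by (simp add: val)
lemma [val]: "y 3 8 = - (3676854288648185805 / 1073741824)" using y_rec[of 3 8] by (simp add: val)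
lemma [val]: "y 4 6 = - (471062858679945987 / 134217728)" using y_rec[of 4 6] by (simp add: val)
lemma [val]: "y 5 4 = - (27597100605482205 / 16777216)" using y_rec[of 5 4] by (simp add: val)
lemma [val]: "y 6 2 = - (577463272990095 / 2097152)" using y_rec[of 6 2] by (simp add: val)
lemma [val]: "y 7 0 = - (1858590154455 / 262144)" using y_rec[of 7 0] by (simp add: val)

lemma [val]: "z 0 0 = 1" using z_rec[of 0 0] by (simp add: val)
lemma [val]: "z 0 1 = 3 / 4" using z_rec[of 0 1] by (simp add: val)
lemma [val]: "z 0 2 = 9 / 8" using z_rec[of 0 2] by (simp add: val)
lemma [val]: "z 1 0 = 1" using z_rec[of 1 0] by (simp add: val)
lemma [val]: "z 0 3 = 321 / 128" using z_rec[of 0 3] by (simp add: val)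
lemma [val]: "z 1 1 = 35 / 8" using z_rec[of 1 1] by (simp add: val)
lemma [val]: "z 0 4 = 477 / 64" using z_rec[of 0 4] by (simp add: val)
lemma [val]: "z 1 2 = 615 / 32" using z_rec[of 1 2] by (simp add: val)
lemma [val]: "z 2 0 = 5" using z_rec[of 2 0] by (simp add: val)
lemma [val]: "z 0 5 = 227349 / 8192" using z_rec[of 0 5] by (simp add: val)
lemma [val]: "z 1 3 = 12077 / 128" using z_rec[of 1 3] by (simp add: val)
lemma [val]: "z 2 1 = 7161 / 128" using z_rec[of 2 1] by (simp add: val)
lemma [val]: "z 0 6 = 254529 / 2048" using z_rec[of 0 6] by (simp add: val)
lemma [val]: "z 1 4 = 33513 / 64" using z_rec[of 1 4] by (simp add: val)
lemma [val]: "z 2 2 = 31983 / 64" using z_rec[of 2 2] by (simp add: val)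
lemma [val]: "z 3 0 = 61" using z_rec[of 3 0] by (simp add: val)
lemma [val]: "z 0 7 = 170484033 / 262144" using z_rec[of 0 7] by (simp add: val)
lemma [val]: "z 1 5 = 53516103 / 16384" using z_rec[of 1 5] by (simp add: val)
lemma [val]: "z 2 3 = 17787389 / 4096" using z_rec[of 2 3] by (simp add: val)
lemma [val]: "z 3 1 = 332475 / 256" using z_rec[of 3 1] by (simp add: val)
lemma [val]: "z 0 8 = 15947073 / 4096" using z_rec[of 0 8] by (simp add: val)
lemma [val]: "z 1 6 = 46477827 / 2048" using z_rec[of 1 6] by (simp add: val)
lemma [val]: "z 2 4 = 39790035 / 1024" using z_rec[of 2 4] by (simp add: val)
lemma [val]: "z 3 2 = 10048347 / 512" using z_rec[of 3 2] by (simp add: val)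
lemma [val]: "z 4 0 = 1385" using z_rec[of 4 0] by (simp add: val)
lemma [val]: "z 0 9 = 880415984769 / 33554432" using z_rec[of 0 9] by (simp add: val)
lemma [val]: "z 1 7 = 22814553275 / 131072" using z_rec[of 1 7] by (simp add: val)
lemma [val]: "z 2 5 = 95799267627 / 262144" using z_rec[of 2 5] by (simp add: val)
lemma [val]: "z 3 3 = 544942181 / 2048" using z_rec[of 3 3] by (simp add: val)
lemma [val]: "z 4 1 = 393206957 / 8192" using z_rec[of 4 1] by (simp add: val)
lemma [val]: "z 0 10 = 103054669839 / 524288" using z_rec[of 0 10] by (simp add: val)
lemma [val]: "z 1 8 = 95808986931 / 65536" using z_rec[of 1 8] by (simp add: val)
lemma [val]: "z 2 6 = 29818312407 / 8192" using z_rec[of 2 6] by (simp add: val)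
lemma [val]: "z 3 4 = 1792771497 / 512" using z_rec[of 3 4] by (simp add: val)
lemma [val]: "z 4 2 = 1126390089 / 1024" using z_rec[of 4 2] by (simp add: val)
lemma [val]: "z 5 0 = 50521" using z_rec[of 5 0] by (simp add: val)
lemma [val]: "z 0 11 = 1739691997222023 / 1073741824" using z_rec[of 0 11] by (simp add: val)
lemma [val]: "z 1 9 = 895991681089717 / 67108864" using z_rec[of 1 9] by (simp add: val)
lemma [val]: "z 2 7 = 322798696084089 / 8388608" using z_rec[of 2 7] by (simp add: val)
lemma [val]: "z 3 5 = 24272508555855 / 524288" using z_rec[of 3 5] by (simp add: val)
lemma [val]: "z 4 3 = 5625489430875 / 262144" using z_rec[of 4 3] by (simp add: val)
lemma [val]: "z 5 1 = 42438348225 / 16384" using z_rec[of 5 1] by (simp add: val)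
lemma [val]: "z 0 12 = 61119388864647 / 4194304" using z_rec[of 0 12] by (simp add: val)
lemma [val]: "z 1 10 = 276346721444631 / 2097152" using z_rec[of 1 10] by (simp add: val)
lemma [val]: "z 2 8 = 3536344181175 / 8192" using z_rec[of 2 8] by (simp add: val)
lemma [val]: "z 3 6 = 41003286473025 / 65536" using z_rec[of 3 6] by (simp add: val)
lemma [val]: "z 4 4 = 3196407005925 / 8192" using z_rec[of 4 4] by (simp add: val)
lemma [val]: "z 5 2 = 343169012667 / 4096" using z_rec[of 5 2] by (simp add: val)
lemma [val]: "z 6 0 = 2702765" using z_rec[of 6 0] by (simp add: val)
lemma [val]: "z 0 13 = 9758123137142768457 / 68719476736" using z_rec[of 0 13] by (simp add: val)
lemma [val]: "z 1 11 = 1501047966464995689 / 1073741824" using z_rec[of 1 11] by (simp add: val)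
lemma [val]: "z 2 9 = 5510156838531600395 / 1073741824" using z_rec[of 2 9] by (simp add: val)
lemma [val]: "z 3 7 = 73153126274052627 / 8388608" using z_rec[of 3 7] by (simp add: val)
lemma [val]: "z 4 5 = 115790816921428971 / 16777216" using z_rec[of 4 5] by (simp add: val)
lemma [val]: "z 5 3 = 582918573873165 / 262144" using z_rec[of 5 3] by (simp add: val)
lemma [val]: "z 6 1 = 50395494890385 / 262144" using z_rec[of 6 1] by (simp add: val)
lemma [val]: "z 0 14 = 50007023550662931 / 33554432" using z_rec[of 0 14] by (simp add: val)
lemma [val]: "z 1 12 = 33274994274007785 / 2097152" using z_rec[of 1 12] by (simp add: val)
lemma [val]: "z 2 10 = 135316125389063709 / 2097152" using z_rec[of 2 10] by (simp add: val)
lemma [val]: "z 3 8 = 66038287244674905 / 524288" using z_rec[of 3 8] by (simp add: val)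
lemma [val]: "z 4 6 = 63719710794020655 / 524288" using z_rec[of 4 6] by (simp add: val)
lemma [val]: "z 5 4 = 437492589037299 / 8192" using z_rec[of 5 4] by (simp add: val)
lemma [val]: "z 6 2 = 68341027466655 / 8192" using z_rec[of 6 2] by (simp add: val)
lemma [val]: "z 7 0 = 199360981" using z_rec[of 7 0] by (simp add: val)

end

section \<open>The seventh moment\<close>

text \<open>The solution of the quadratic recursion of \<open>scaled_coeffs\<close>, obtained by solving for the two equal corner
terms of the convolution.\<close>

function ycoef :: "nat \<Rightarrow> nat \<Rightarrow> real" where
  "ycoef a b = (if a = 0 \<and> b = 0 then 1 else
     ((if b = 0 then 0 else (4 * real a + 3 * (real b - 1) - 1) / 2 * ycoef a (b - 1)) +
      (if a = 0 then 0 else 2 * (real b + 1) * ycoef (a - 1) (b + 1)) -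
      (\<Sum>(i, j)\<in>{..a} \<times> {..b} - {(0, 0), (a, b)}. ycoef i j * ycoef (a - i) (b - j))) / 2)"
  by pat_completeness auto
termination
proof (relation "Wellfounded.measure (\<lambda>(a, b). 2 * a + b)", goal_cases)
  case (4 a b p i j)
  then have "i \<le> a" "j \<le> b" "i < a \<or> j < b" by auto
  then show ?case by auto
next
  case (5 a b p i j)
  then have "i \<le> a" "j \<le> b" "0 < i \<or> 0 < j" by auto
  then have "2 * (a - i) + (b - j) < 2 * a + b" by linarith
  then show ?case by simp
qed auto

function zcoef :: "nat \<Rightarrow> nat \<Rightarrow> real" where
  "zcoef a b = - (4 * real a + 3 * real b - 1) * ycoef a b
     - (\<Sum>(i, j)\<in>{..a} \<times> {..b} - {(0, 0)}. ycoef i j * zcoef (a - i) (b - j))"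
  by pat_completeness auto
termination
proof (relation "Wellfounded.measure (\<lambda>(a, b). 2 * a + b)", goal_cases)
  case (2 a b p i j)
  then have "i \<le> a" "j \<le> b" "0 < i \<or> 0 < j" by auto
  then have "2 * (a - i) + (b - j) < 2 * a + b" by linarith
  then show ?case by simp
qed auto

declare ycoef.simps [simp del] zcoef.simps [simp del]

lemma ycoef_00: "ycoef 0 0 = 1"
  by (simp add: ycoef.simps)

interpretation scaled_coeffs ycoef zcoef
proof
  show "ycoef 0 0 = 1" by (rule ycoef_00)
  show "conv ycoef ycoef a b = drift 1 ycoef a b" if "(a, b) \<noteq> (0, 0)" for a b
  proof -
    have "2 * ycoef a b = drift 1 ycoef a b - inner_conv ycoef ycoef a b"
      unfolding drift_def inner_conv_def by (subst (1) ycoef.simps) (use that in simp)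
    then show ?thesis
      using conv_corners[OF that, of ycoef ycoef] by (simp add: ycoef_00)
  qed
  show "conv ycoef zcoef a b = - (4 * real a + 3 * real b - 1) * ycoef a b" for a b
  proof -
    have "conv ycoef zcoef a b = ycoef 0 0 * zcoef a b
        + (\<Sum>(i, j)\<in>{..a} \<times> {..b} - {(0, 0)}. ycoef i j * zcoef (a - i) (b - j))"
      unfolding conv_def by (subst sum.remove[of _ "(0, 0)"]) auto
    then show ?thesis
      by (simp add: ycoef_00 zcoef.simps[of a b])
  qed
qed

lemma limit_moment_list:
  "limit_moment k = (\<Sum>j\<leftarrow>[0..<k+1]. fact k * fact (2 * j) / fact j * (- 1 / 2) ^ j *
     zcoef (k - j) (2 * j) / fact (2 * (k - j) + 3 * j))"
proof -
  have "limit_moment k = (\<Sum>j\<le>k. fact k * fact (2 * j) / fact j * (- 1 / 2) ^ j *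
     zcoef (k - j) (2 * j) / fact (2 * (k - j) + 3 * j))"
    unfolding limit_moment_def by (rule sum.cong) (auto simp: binomial_fact)
  then show ?thesis
    by (simp only: interv_sum_list_conv_sum_set_nat set_upt atLeast0LessThan Suc_eq_plus1[symmetric] lessThan_Suc_atMost)
qed

lemmas moment_simps = limit_moment_list upt_list val One_nat_def[symmetric] fact_numeral power_divide

lemma limit_moment_0: "limit_moment 0 = 1"
  by (simp add: moment_simps)

lemma limit_moment_1: "limit_moment 1 = 5 / 16"
  by (simp add: moment_simps)

lemma limit_moment_2: "limit_moment 2 = 1217 / 7680"
  by (simp add: moment_simps)

lemma limit_moment_3: "limit_moment 3 = 1601353 / 13762560"
  by (simp add: moment_simps)

lemma limit_moment_4: "limit_moment 4 = 3264219 / 28835840"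
  by (simp add: moment_simps)

lemma limit_moment_5: "limit_moment 5 = 226724203201 / 1648864788480"
  by (simp add: moment_simps)

lemma limit_moment_6: "limit_moment 6 = 55362976940435959 / 276270593039400960"
  by (simp add: moment_simps)

lemma limit_moment_7: "limit_moment 7 = 480953429184700141 / 1411533786285342720"
  by (simp add: moment_simps)

definition central_moment :: "nat \<Rightarrow> nat \<Rightarrow> real" where
  "central_moment k n = mean n (\<lambda>h. (height_size n h / real n ^ 3 - mean n (\<lambda>h. height_size n h / real n ^ 3)) ^ k)"

lemma central_moment_tendsto:
  "central_moment k \<longlonglongrightarrow> (\<Sum>j\<le>k. real (k choose j) * (- limit_moment 1) ^ (k - j) * limit_moment j)"
proof -
  have ex: "central_moment k n = (\<Sum>j\<le>k. real (k choose j) * (- mean n (\<lambda>h. (height_size n h / real n ^ 3) ^ 1)) ^ (k - j) *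
     mean n (\<lambda>h. (height_size n h / real n ^ 3) ^ j))" for n
  proof -
    have "(x - m) ^ k = (\<Sum>j\<le>k. (real (k choose j) * (- m) ^ (k - j)) * x ^ j)" for x m :: real
      using binomial_ring[of x "- m" k] by (simp add: mult_ac)
    then show ?thesis
      unfolding central_moment_def by (simp only: mean_sum mean_cmult power_one_right)
  qed
  show ?thesis
    unfolding ex by (intro tendsto_sum tendsto_mult tendsto_const tendsto_power tendsto_minus mean_height_size_power)
qed

lemma central_moment_2: "central_moment 2 \<longlonglongrightarrow> 467 / 7680"
proof -
  have m: "limit_moment (Suc 0) = 5 / 16" "limit_moment (Suc (Suc 0)) = 1217 / 7680"
    using limit_moment_1 limit_moment_2 by (simp_all add: numeral_2_eq_2 One_nat_def)
  have "(\<Sum>j\<le>2. real (2 choose j) * (- limit_moment 1) ^ (2 - j) * limit_moment j) = 467 / 7680"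
    by (simp add: numeral_2_eq_2 One_nat_def limit_moment_0 m)
  then show ?thesis
    using central_moment_tendsto[of 2] by (simp only:)
qed

lemma central_moment_7: "central_moment 7 \<longlonglongrightarrow> 2258370492842875387 / 23996074366850826240"
proof -
  have "(\<Sum>j\<le>7. real (7 choose j) * (- limit_moment 1) ^ (7 - j) * limit_moment j)
    = (\<Sum>j\<leftarrow>[0..<7+1]. fact 7 / (fact j * fact (7 - j)) * (- limit_moment 1) ^ (7 - j) * limit_moment j)"
  proof -
    have "(\<Sum>j\<le>7. real (7 choose j) * (- limit_moment 1) ^ (7 - j) * limit_moment j)
      = (\<Sum>j\<le>7. fact 7 / (fact j * fact (7 - j)) * (- limit_moment 1) ^ (7 - j) * limit_moment j)"
      by (rule sum.cong) (auto simp: binomial_fact)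
    then show ?thesis
      by (simp only: interv_sum_list_conv_sum_set_nat set_upt atLeast0LessThan Suc_eq_plus1[symmetric] lessThan_Suc_atMost)
  qed
  also have "\<dots> = 2258370492842875387 / 23996074366850826240"
    by (simp add: upt_list limit_moment_0 limit_moment_1 limit_moment_2 limit_moment_3 limit_moment_4
      limit_moment_5 limit_moment_6 limit_moment_7 One_nat_def[symmetric] fact_numeral power_divide)
  finally show ?thesis
    using central_moment_tendsto[of 7] by (simp only:)
qed

text \<open>Scaling the size by \<open>n\<^sup>3\<close> cancels in the quotient of the seventh central moment and the power 7/2 of
the variance.\<close>

lemma expectation_central:
  assumes "1 \<le> n"
  shows "measure_pmf.expectation (random_core n)
     (\<lambda>l. (core_size l - measure_pmf.expectation (random_core n) core_size) ^ k) = (real n ^ 3) ^ k * central_moment k n"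
proof -
  define m where "m = measure_pmf.expectation (random_core n) core_size"
  have "m = mean n (\<lambda>h. height_size n h)"
    using expectation_random_core[OF assms, of "\<lambda>x. x"] by (simp add: m_def)
  also have "\<dots> = mean n (\<lambda>h. real n ^ 3 * (height_size n h / real n ^ 3))"
    using assms by simp
  also have "\<dots> = real n ^ 3 * mean n (\<lambda>h. height_size n h / real n ^ 3)"
    by (rule mean_cmult)
  finally have m: "m = real n ^ 3 * mean n (\<lambda>h. height_size n h / real n ^ 3)" .
  have "measure_pmf.expectation (random_core n) (\<lambda>l. (core_size l - m) ^ k) = mean n (\<lambda>h. (height_size n h - m) ^ k)"
    by (rule expectation_random_core[OF assms])
  also have "\<dots> = mean n (\<lambda>h. (real n ^ 3) ^ k * (height_size n h / real n ^ 3 - mean n (\<lambda>h. height_size n h / real n ^ 3)) ^ k)"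
  proof -
    have "height_size n h - m = real n ^ 3 * (height_size n h / real n ^ 3 - mean n (\<lambda>h. height_size n h / real n ^ 3))" for h
      using assms unfolding m by (simp add: right_diff_distrib)
    then show ?thesis by (simp only: power_mult_distrib)
  qed
  finally show ?thesis
    by (simp only: mean_cmult central_moment_def m_def)
qed

theorem mainTheorem14:
  shows "(\<lambda>n::nat.
      measure_pmf.expectation (random_core n)
        (\<lambda>l. (core_size l - measure_pmf.expectation (random_core n) core_size) ^ 7)
      / measure_pmf.variance (random_core n) core_size powr (7 / 2))
    \<longlonglongrightarrow> 56459262321071884675 / 62988906654652346368 * sqrt 467 * sqrt 7680"
proof -
  have "(\<lambda>n. central_moment 7 n / central_moment 2 n powr (7 / 2))
     \<longlonglongrightarrow> (2258370492842875387 / 23996074366850826240) / (467 / 7680) powr (7 / 2)"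
    by (intro tendsto_divide tendsto_powr central_moment_2 central_moment_7 tendsto_const) auto
  also have "(2258370492842875387 / 23996074366850826240) / (467 / 7680) powr (7 / 2)
    = 56459262321071884675 / 62988906654652346368 * sqrt 467 * sqrt (7680 :: real)"
  proof -
    have "(467 / 7680 :: real) powr (7 / 2) = (467 / 7680) powr (3 + 1 / 2)"
      by simp
    also have "\<dots> = (467 / 7680) ^ 3 * (sqrt 467 / sqrt 7680)"
      unfolding powr_add by (simp add: powr_half_sqrt real_sqrt_divide)
    finally have p: "(467 / 7680 :: real) powr (7 / 2) = (467 / 7680) ^ 3 * (sqrt 467 / sqrt 7680)" .
    have "1 / sqrt (467 :: real) = sqrt 467 / 467"
      by (simp add: field_simps)
    then have q: "1 / (sqrt 467 / sqrt (7680 :: real)) = sqrt 467 / 467 * sqrt 7680"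
      by (metis divide_divide_eq_left' divide_divide_eq_right mult.commute times_divide_eq_left mult_1)
    have "(2258370492842875387 / 23996074366850826240) / ((467 / 7680 :: real) ^ 3 * (sqrt 467 / sqrt 7680))
      = (2258370492842875387 / 23996074366850826240) / (467 / 7680) ^ 3 * (1 / (sqrt 467 / sqrt 7680))"
      by simp
    then show ?thesis
      unfolding p q by (simp add: power3_eq_cube)
  qed
  finally have lim: "(\<lambda>n. central_moment 7 n / central_moment 2 n powr (7 / 2))
     \<longlonglongrightarrow> 56459262321071884675 / 62988906654652346368 * sqrt 467 * sqrt 7680" .
  show ?thesis
  proof (rule Lim_transform_eventually[OF lim])
    show "eventually (\<lambda>n. central_moment 7 n / central_moment 2 n powr (7 / 2) =
      measure_pmf.expectation (random_core n)
        (\<lambda>l. (core_size l - measure_pmf.expectation (random_core n) core_size) ^ 7)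
      / measure_pmf.variance (random_core n) core_size powr (7 / 2)) sequentially"
      using eventually_ge_at_top[of 1]
    proof eventually_elim
      case (elim n)
      have pos: "0 \<le> central_moment 2 n"
        unfolding central_moment_def mean_def by (intro divide_nonneg_nonneg sum_nonneg) auto
      have n3: "((real n ^ 3) ^ 2) powr (7 / 2) = (real n ^ 3) ^ 7"
      proof -
        have n: "0 \<le> real n ^ 3" by simp
        have "((real n ^ 3) powr 2) powr (7 / 2) = (real n ^ 3) powr 7"
          by (subst powr_powr) simp
        then show ?thesis by (simp only: powr_numeral[OF n])
      qed
      have "((real n ^ 3) ^ 2 * central_moment 2 n) powr (7 / 2) = (real n ^ 3) ^ 7 * central_moment 2 n powr (7 / 2)"
        using pos by (simp only: powr_mult n3)
      then show ?case
        unfolding expectation_central[OF elim] using elim by (simp only:) simp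
    qed
  qed
qed

end
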